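(* Let $(\mathcal A,\mathscr D(\mathcal A))$ be a Lévy-type operator in $\mathbb R^d$ with characteristic triplet $(a,b,\Pi)$, and assume that $\mathcal C_c^\infty(\mathbb R^d)\subset\mathscr D(\mathcal A)$. Let $\pi=(\nu,\mu,\rho)$ be a convenient decomposition of $\Pi$. A measure $\eta\in\mathcal M(\mathcal A,\pi)$ is infinitesimally invariant for $(\mathcal A,\mathscr D(\mathcal A))$ if and only if $\eta$ solves the distributional equation $$-\nabla\cdot((a+a_\pi)\eta)+\tfrac12\nabla\cdot b\nabla\eta+U^\pi(\eta)+\nabla\cdot V^\pi(\eta)+\mathbf H\cdot W^\pi(\eta)=0,$$ where $U^\pi(\eta),V^\pi(\eta)$ and $W^\pi(\eta)$ denote the jump functionals of $\Pi$ with respect to $\pi$ and $\eta$.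
   Context: **Lévy-type operators.** Let $\mathcal E$ be a Banach space of functions $f:\mathbb R^d\to\mathbb R$. A Lévy-type operator is a pair $(\mathcal A,\mathscr D(\mathcal A))$ with $\mathscr D(\mathcal A)\subset\mathcal E$ and $\mathcal A:\mathscr D(\mathcal A)\to\mathcal E$ of the form $$\mathcal Af(x)=a(x)\cdot\nabla f(x)+\tfrac12\nabla\cdot b(x)\nabla f(x)+\int_{\mathbb R^d}\big(f(x+y)-f(x)-\nabla f(x)\cdot y\mathbf 1_{\{|y|<1\}}\big)\Pi(x,dy),$$ where $\nabla\cdot b\nabla f=\sum_{i,j}\partial_i(b_{ij}\partial_jf)$, $a:\mathbb R^d\to\mathbb R^d$ is Borel, $b$ is Borel with values in the symmetric positive semidefinite $d\times d$ matrices, and $\Pi$ is a Lévy kernel: $\Pi(x,\cdot)$ is a Lévy measure on $\mathbb R^d$ for each $x$, $\Pi(\cdot,B)$ is Borel for each Borel $B$, and $\Pi(x,\{0\})=0$. $(a,b,\Pi)$ is the characteristic triplet. **Infinitesimal invariance.** A measure $\eta$ on $\mathbb R^d$ (possibly infinite) is infinitesimally invariant for $(\mathcal A,\mathscr D(\mathcal A))$ if $\mathcal Af\in L^1(\eta)$ and $\int\mathcal Af\,d\eta=0$ for all $f\in\mathcal C_c^\infty(\mathbb R^d)$. **Convenient decomposition.** $\pi=(\nu,\mu,\rho)$ is a convenient decomposition of $\Pi$ if there are non-negative continuous functions $h_\nu,h_\mu,h_\rho$ on $\mathbb R^d$ with $\nu=h_\nu\Pi$, $\mu=h_\mu\Pi$,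 $\rho=h_\rho\Pi$ (i.e. $\nu(x,dy)=h_\nu(y)\Pi(x,dy)$ etc.), $\Pi=\nu+\mu+\rho$, and for all $x$: $\nu(x,\mathbb R^d)<\infty$, $\int(1\wedge|y|)\mu(x,dy)<\infty$, $\int(|y|\wedge|y|^2)\rho(x,dy)<\infty$. Put $a_\pi(x)=-\int_{|y|<1}y\,\nu(x,dy)-\int_{|y|<1}y\,\mu(x,dy)+\int_{|y|\ge1}y\,\rho(x,dy)$. **Integrated tails.** A polar decomposition of a $\sigma$-finite measure $Q$ on $\mathbb R^d$ with $Q(\{0\})=0$ is a finite measure $Q_o$ on the unit sphere $S^{d-1}$ and a measurable family $(Q_\xi)_{\xi\in S^{d-1}}$ of $\sigma$-finite measures on $(0,\infty)$ with $Q_\xi((0,\infty))>0$ and $Q(B)=\int_{S^{d-1}}\int_{(0,\infty)}\mathbf 1_B(r\xi)Q_\xi(dr)Q_o(d\xi)$. For a Lévy kernel $Q$ choose for each $x$ a polar decomposition of $Q(x,\cdot)$ whose radial parts are Lévy measures. The integrated radial tail is $$\overline Q(x,B)=\int_{S^{d-1}}\int_{(0,\infty)}\mathbf 1_B(z\xi)\int_{(z,\infty)}Q_\xi(x,dr)\,dz\,Q_o(x,d\xi),$$ and, if $\int(|y|\wedge|y|^2)Q(x,dy)<\infty$ for all $x$ (radial parts chosen with $\int_{(0,\infty)}(r\wedge r^2)Q_\xi(x,dr)<\infty$), the double-integrated radial tail is $$\overline{\overline Q}(x,B)=\int_{S^{d-1}}\int_{(0,\infty)}\mathbf 1_B(z_2\xi)\int_{(z_2,\infty)}\int_{(z_1,\infty)}Q_\xi(x,dr)\,dz_1\,dz_2\,Q_o(x,d\xi).$$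 These do not depend on the chosen polar decompositions. **Jump functionals.** $U^\pi(\eta)$, $V^\pi(\eta)=(V^\pi_i(\eta))_{i}$ and $W^\pi(\eta)=(W^\pi_{ij}(\eta))_{i,j}$ are defined, for $f\in\mathcal C_c^\infty(\mathbb R^d)$ for which the right-hand side is well defined, by $\langle U^\pi(\eta),f\rangle=\int\big(\int f(x+y)\nu(x,dy)-f(x)\nu(x,\mathbb R^d)\big)\eta(dx)$, $\langle V^\pi_i(\eta),f\rangle=\int\int f(x+y)\frac{y_i}{|y|}\overline\mu(x,dy)\eta(dx)$, $\langle W^\pi_{ij}(\eta),f\rangle=\int\int f(x+y)\frac{y_iy_j}{|y|^2}\overline{\overline\rho}(x,dy)\eta(dx)$. **The space $\mathcal M(\mathcal A,\pi)$.** It is the set of measures $\eta$ on $\mathbb R^d$ such that $\nabla\cdot((a+a_\pi)\eta)$, $\frac12\nabla\cdot b\nabla\eta$, $U^\pi(\eta)$, $\nabla\cdot V^\pi(\eta)$ and $\mathbf H\cdot W^\pi(\eta)$ define distributions on $\mathbb R^d$. Here $\nabla\cdot F=\sum_i\partial_iF_i$ and $\mathbf H\cdot M=\sum_{i,j}\partial_i\partial_jM_{ij}$, with derivatives understood in the distributional sense; $\frac12\nabla\cdot b\nabla\eta$ is the functional $f\mapsto\int\frac12\nabla\cdot b\nabla f\,d\eta$.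
   Formalization: The term +∇·V^π(η) is corrected to −∇·V^π(η); with the + sign the claim fails, e.g. d=1, b=0, a=−1 on (0,1) and 0 elsewhere, Π(0,·)=δ_1, Π(x,·)=0 for x≠0, μ=Π, η=δ_0+Lebesgue on [0,1]. *)

theory Defs
  imports "HOL-Analysis.Analysis"
begin

section \<open>Partial derivatives and test functions\<close>

definition has_partial :: "'d::finite \<Rightarrow> (real^'d \<Rightarrow> real) \<Rightarrow> real^'d \<Rightarrow> bool" where
  "has_partial i f x \<longleftrightarrow> (\<lambda>t. f (x + t *\<^sub>R axis i 1)) field_differentiable (at 0)"

definition partial :: "'d::finite \<Rightarrow> (real^'d \<Rightarrow> real) \<Rightarrow> real^'d \<Rightarrow> real" where
  "partial i f x = deriv (\<lambda>t. f (x + t *\<^sub>R axis i 1)) 0"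

definition grad :: "(real^'d::finite \<Rightarrow> real) \<Rightarrow> real^'d \<Rightarrow> real^'d" where
  "grad f x = (\<chi> i. partial i f x)"

definition partials :: "'d::finite list \<Rightarrow> (real^'d \<Rightarrow> real) \<Rightarrow> real^'d \<Rightarrow> real" where
  "partials is f = foldr partial is f"

text \<open>Infinitely differentiable: the iterated partial derivatives of every order (the order 0
  included) are differentiable everywhere. Multi-indices are represented by lists of coordinates.\<close>

definition smooth :: "(real^'d::finite \<Rightarrow> real) \<Rightarrow> bool" where
  "smooth f \<longleftrightarrow> (\<forall>is. partials is f differentiable_on UNIV)"

definition supp :: "(real^'d::finite \<Rightarrow> real) \<Rightarrow> (real^'d) set" where
  "supp f = closure {x. f x \<noteq> 0}"

definition test_functions :: "(real^'d::finite \<Rightarrow> real) set" where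
  "test_functions = {f. smooth f \<and> compact (supp f)}"


section \<open>Functionals on test functions and distributions\<close>

text \<open>A functional need not be defined at every test function; the value \<open>None\<close> means that the
  defining expression is not well defined there.\<close>

type_synonym 'd pfunctional = "(real^'d \<Rightarrow> real) \<Rightarrow> real option"

definition pairing :: "'d::finite pfunctional \<Rightarrow> (real^'d \<Rightarrow> real) \<Rightarrow> real" where
  "pairing T f = the (T f)"

text \<open>A distribution is an everywhere defined linear functional satisfying, on each compact set,
  an estimate by finitely many sup-norms of derivatives.\<close>

definition is_distribution :: "'d::finite pfunctional \<Rightarrow> bool" where
  "is_distribution T \<longleftrightarrow>
     (\<forall>f\<in>test_functions. T f \<noteq> None) \<and>
     (\<forall>f\<in>test_functions. \<forall>g\<in>test_functions.
        pairing T (\<lambda>x. f x + g x) = pairing T f + pairing T g) \<and>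
     (\<forall>c. \<forall>f\<in>test_functions. pairing T (\<lambda>x. c * f x) = c * pairing T f) \<and>
     (\<forall>C. compact C \<longrightarrow> (\<exists>M n. \<forall>f\<in>test_functions. supp f \<subseteq> C \<longrightarrow>
        \<bar>pairing T f\<bar> \<le> M * (\<Sum>is | length is \<le> n. SUP x. \<bar>partials is f x\<bar>)))"

text \<open>Distributional derivative: \<open>\<langle>\<partial>\<^sub>i T, f\<rangle> = - \<langle>T, \<partial>\<^sub>i f\<rangle>\<close>.\<close>

definition dist_partial :: "'d::finite \<Rightarrow> 'd pfunctional \<Rightarrow> 'd pfunctional" where
  "dist_partial i T = (\<lambda>f. map_option uminus (T (partial i f)))"

definition pf_sum :: "('i::finite \<Rightarrow> 'd::finite pfunctional) \<Rightarrow> 'd pfunctional" where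
  "pf_sum T = (\<lambda>f. if \<forall>i. T i f \<noteq> None then Some (\<Sum>i\<in>UNIV. the (T i f)) else None)"

definition dist_div :: "('d::finite \<Rightarrow> 'd pfunctional) \<Rightarrow> 'd pfunctional" where
  "dist_div F = pf_sum (\<lambda>i. dist_partial i (F i))"

definition dist_hess :: "('d::finite \<Rightarrow> 'd \<Rightarrow> 'd pfunctional) \<Rightarrow> 'd pfunctional" where
  "dist_hess M = pf_sum (\<lambda>i. pf_sum (\<lambda>j. dist_partial i (dist_partial j (M i j))))"


section \<open>Levy kernels and Levy-type operators\<close>

definition levy_measure :: "(real^'d::finite) measure \<Rightarrow> bool" where
  "levy_measure Q \<longleftrightarrow> sets Q = sets borel \<and> emeasure Q {0} = 0 \<and>
     (\<integral>\<^sup>+y. ennreal (min 1 ((norm y)\<^sup>2)) \<partial>Q) < \<infinity>"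

definition levy_kernel :: "(real^'d::finite \<Rightarrow> (real^'d) measure) \<Rightarrow> bool" where
  "levy_kernel K \<longleftrightarrow> (\<forall>x. levy_measure (K x)) \<and>
     (\<forall>B\<in>sets borel. (\<lambda>x. emeasure (K x) B) \<in> borel_measurable borel)"

definition characteristic_triplet ::
  "(real^'d::finite \<Rightarrow> real^'d) \<Rightarrow> (real^'d \<Rightarrow> real^'d^'d) \<Rightarrow> (real^'d \<Rightarrow> (real^'d) measure) \<Rightarrow> bool" where
  "characteristic_triplet a b K \<longleftrightarrow>
     a \<in> borel_measurable borel \<and>
     b \<in> borel_measurable borel \<and>
     (\<forall>x. transpose (b x) = b x \<and> (\<forall>v. 0 \<le> v \<bullet> (b x *v v))) \<and>
     levy_kernel K"

text \<open>A linear space \<open>E\<close> of functions which is complete for the norm \<open>N\<close>.\<close>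

definition banach_function_space ::
  "(real^'d::finite \<Rightarrow> real) set \<Rightarrow> ((real^'d \<Rightarrow> real) \<Rightarrow> real) \<Rightarrow> bool" where
  "banach_function_space E N \<longleftrightarrow>
     (\<lambda>x. 0) \<in> E \<and>
     (\<forall>f\<in>E. \<forall>g\<in>E. (\<lambda>x. f x + g x) \<in> E) \<and>
     (\<forall>c. \<forall>f\<in>E. (\<lambda>x. c * f x) \<in> E) \<and>
     (\<forall>f\<in>E. 0 \<le> N f \<and> (N f = 0 \<longleftrightarrow> f = (\<lambda>x. 0))) \<and>
     (\<forall>c. \<forall>f\<in>E. N (\<lambda>x. c * f x) = \<bar>c\<bar> * N f) \<and>
     (\<forall>f\<in>E. \<forall>g\<in>E. N (\<lambda>x. f x + g x) \<le> N f + N g) \<and>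
     Metric_space.mcomplete E (\<lambda>f g. N (\<lambda>x. f x - g x))"

definition div_grad :: "(real^'d::finite \<Rightarrow> real^'d^'d) \<Rightarrow> (real^'d \<Rightarrow> real) \<Rightarrow> real^'d \<Rightarrow> real" where
  "div_grad b f x = (\<Sum>i\<in>UNIV. \<Sum>j\<in>UNIV. partial i (\<lambda>z. b z $ i $ j * partial j f z) x)"

definition jump_integrand :: "(real^'d::finite \<Rightarrow> real) \<Rightarrow> real^'d \<Rightarrow> real^'d \<Rightarrow> real" where
  "jump_integrand f x y = f (x + y) - f x - (grad f x \<bullet> y) * indicator {y. norm y < 1} y"

text \<open>The last clause says that the expression defining \<open>A f x\<close> is meaningful (all derivatives
  exist and the integral converges absolutely) and that \<open>A f x\<close> is equal to it.\<close>

definition levy_type_operator ::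
  "(real^'d::finite \<Rightarrow> real) set \<Rightarrow> ((real^'d \<Rightarrow> real) \<Rightarrow> real) \<Rightarrow>
   (real^'d \<Rightarrow> real) set \<Rightarrow> ((real^'d \<Rightarrow> real) \<Rightarrow> (real^'d \<Rightarrow> real)) \<Rightarrow>
   (real^'d \<Rightarrow> real^'d) \<Rightarrow> (real^'d \<Rightarrow> real^'d^'d) \<Rightarrow> (real^'d \<Rightarrow> (real^'d) measure) \<Rightarrow> bool" where
  "levy_type_operator E N D A a b K \<longleftrightarrow>
     banach_function_space E N \<and> D \<subseteq> E \<and> A ` D \<subseteq> E \<and>
     characteristic_triplet a b K \<and>
     (\<forall>f\<in>D. \<forall>x.
        (\<forall>i. has_partial i f x) \<and>
        (\<forall>i j. has_partial i (\<lambda>z. b z $ i $ j * partial j f z) x) \<and>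
        integrable (K x) (jump_integrand f x) \<and>
        A f x = a x \<bullet> grad f x + 1 / 2 * div_grad b f x + (LINT y|K x. jump_integrand f x y))"

definition infinitesimally_invariant ::
  "((real^'d::finite \<Rightarrow> real) \<Rightarrow> (real^'d \<Rightarrow> real)) \<Rightarrow> (real^'d) measure \<Rightarrow> bool" where
  "infinitesimally_invariant A \<eta> \<longleftrightarrow>
     (\<forall>f\<in>test_functions. integrable \<eta> (A f) \<and> (LINT x|\<eta>. A f x) = 0)"


section \<open>Convenient decompositions\<close>

definition convenient_decomposition ::
  "(real^'d::finite \<Rightarrow> (real^'d) measure) \<Rightarrow> (real^'d \<Rightarrow> (real^'d) measure) \<Rightarrow>
   (real^'d \<Rightarrow> (real^'d) measure) \<Rightarrow> (real^'d \<Rightarrow> (real^'d) measure) \<Rightarrow> bool" where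
  "convenient_decomposition K \<nu> \<mu> \<rho> \<longleftrightarrow>
     (\<exists>h\<^sub>\<nu> h\<^sub>\<mu> h\<^sub>\<rho> :: real^'d \<Rightarrow> real.
        continuous_on UNIV h\<^sub>\<nu> \<and> continuous_on UNIV h\<^sub>\<mu> \<and> continuous_on UNIV h\<^sub>\<rho> \<and>
        (\<forall>y. 0 \<le> h\<^sub>\<nu> y \<and> 0 \<le> h\<^sub>\<mu> y \<and> 0 \<le> h\<^sub>\<rho> y) \<and>
        (\<forall>x. \<nu> x = density (K x) (\<lambda>y. ennreal (h\<^sub>\<nu> y)) \<and>
             \<mu> x = density (K x) (\<lambda>y. ennreal (h\<^sub>\<mu> y)) \<and>
             \<rho> x = density (K x) (\<lambda>y. ennreal (h\<^sub>\<rho> y)))) \<and>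
     (\<forall>x. \<forall>B\<in>sets borel. emeasure (K x) B = emeasure (\<nu> x) B + emeasure (\<mu> x) B + emeasure (\<rho> x) B) \<and>
     (\<forall>x. emeasure (\<nu> x) UNIV < \<infinity> \<and>
          (\<integral>\<^sup>+y. ennreal (min 1 (norm y)) \<partial>\<mu> x) < \<infinity> \<and>
          (\<integral>\<^sup>+y. ennreal (min (norm y) ((norm y)\<^sup>2)) \<partial>\<rho> x) < \<infinity>)"

definition drift_correction ::
  "(real^'d::finite \<Rightarrow> (real^'d) measure) \<Rightarrow> (real^'d \<Rightarrow> (real^'d) measure) \<Rightarrow>
   (real^'d \<Rightarrow> (real^'d) measure) \<Rightarrow> real^'d \<Rightarrow> real^'d" where
  "drift_correction \<nu> \<mu> \<rho> x =
     - (LINT y:{y. norm y < 1}|\<nu> x. y) - (LINT y:{y. norm y < 1}|\<mu> x. y)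
     + (LINT y:{y. 1 \<le> norm y}|\<rho> x. y)"


section \<open>Polar decompositions and integrated tails\<close>

definition polar_decomposition ::
  "(real^'d::finite) measure \<Rightarrow> (real^'d) measure \<Rightarrow> (real^'d \<Rightarrow> real measure) \<Rightarrow> bool" where
  "polar_decomposition Q Q\<^sub>o Q\<^sub>r \<longleftrightarrow>
     sets Q\<^sub>o = sets (restrict_space borel (sphere 0 1)) \<and> finite_measure Q\<^sub>o \<and>
     (\<forall>\<xi>\<in>sphere 0 1. sets (Q\<^sub>r \<xi>) = sets (restrict_space borel {0<..}) \<and>
        sigma_finite_measure (Q\<^sub>r \<xi>) \<and> 0 < emeasure (Q\<^sub>r \<xi>) {0<..}) \<and>
     (\<forall>R\<in>sets (restrict_space borel {0<..}).
        (\<lambda>\<xi>. emeasure (Q\<^sub>r \<xi>) R) \<in> borel_measurable (restrict_space borel (sphere 0 1))) \<and>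
     (\<forall>B\<in>sets borel. emeasure Q B = (\<integral>\<^sup>+\<xi>. (\<integral>\<^sup>+r. indicator B (r *\<^sub>R \<xi>) \<partial>Q\<^sub>r \<xi>) \<partial>Q\<^sub>o))"

text \<open>Choices of polar decompositions. The tail measures below do not depend on them; existence
  holds for all Levy measures, respectively for all those integrating \<open>min |y| |y|\<^sup>2\<close>.\<close>

definition levy_polar ::
  "(real^'d::finite) measure \<Rightarrow> (real^'d) measure \<times> (real^'d \<Rightarrow> real measure)" where
  "levy_polar Q = (SOME (Q\<^sub>o, Q\<^sub>r). polar_decomposition Q Q\<^sub>o Q\<^sub>r \<and>
     (\<forall>\<xi>\<in>sphere 0 1. (\<integral>\<^sup>+r. ennreal (min 1 (r\<^sup>2)) \<partial>Q\<^sub>r \<xi>) < \<infinity>))"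

definition levy_polar2 ::
  "(real^'d::finite) measure \<Rightarrow> (real^'d) measure \<times> (real^'d \<Rightarrow> real measure)" where
  "levy_polar2 Q = (SOME (Q\<^sub>o, Q\<^sub>r). polar_decomposition Q Q\<^sub>o Q\<^sub>r \<and>
     (\<forall>\<xi>\<in>sphere 0 1. (\<integral>\<^sup>+r. ennreal (min r (r\<^sup>2)) \<partial>Q\<^sub>r \<xi>) < \<infinity>))"

definition integrated_tail :: "(real^'d::finite) measure \<Rightarrow> (real^'d) measure" where
  "integrated_tail Q = (case levy_polar Q of (Q\<^sub>o, Q\<^sub>r) \<Rightarrow>
     measure_of UNIV (sets borel) (\<lambda>B.
       \<integral>\<^sup>+\<xi>. (\<integral>\<^sup>+z\<in>{0<..}. indicator B (z *\<^sub>R \<xi>) * emeasure (Q\<^sub>r \<xi>) {z<..} \<partial>lborel) \<partial>Q\<^sub>o))"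

definition double_integrated_tail :: "(real^'d::finite) measure \<Rightarrow> (real^'d) measure" where
  "double_integrated_tail Q = (case levy_polar2 Q of (Q\<^sub>o, Q\<^sub>r) \<Rightarrow>
     measure_of UNIV (sets borel) (\<lambda>B.
       \<integral>\<^sup>+\<xi>. (\<integral>\<^sup>+z\<^sub>2\<in>{0<..}. indicator B (z\<^sub>2 *\<^sub>R \<xi>) *
         (\<integral>\<^sup>+z\<^sub>1\<in>{z\<^sub>2<..}. emeasure (Q\<^sub>r \<xi>) {z\<^sub>1<..} \<partial>lborel) \<partial>lborel) \<partial>Q\<^sub>o))"


section \<open>The functionals in the distributional equation\<close>

text \<open>The integral of \<open>g\<close>, provided it exists; \<open>P x\<close> is the condition that \<open>g x\<close> (itself given
  by an integral) is well defined.\<close>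

definition partial_integral :: "'a measure \<Rightarrow> ('a \<Rightarrow> bool) \<Rightarrow> ('a \<Rightarrow> real) \<Rightarrow> real option" where
  "partial_integral \<eta> P g =
     (if (AE x in \<eta>. P x) \<and> integrable \<eta> g then Some (LINT x|\<eta>. g x) else None)"

definition weighted :: "(real^'d::finite \<Rightarrow> real^'d) \<Rightarrow> (real^'d) measure \<Rightarrow> 'd \<Rightarrow> 'd pfunctional" where
  "weighted c \<eta> i = (\<lambda>f. partial_integral \<eta> (\<lambda>x. True) (\<lambda>x. f x * c x $ i))"

definition diffusion_functional ::
  "(real^'d::finite \<Rightarrow> real^'d^'d) \<Rightarrow> (real^'d) measure \<Rightarrow> 'd pfunctional" where
  "diffusion_functional b \<eta> = (\<lambda>f. partial_integral \<eta> (\<lambda>x. True) (\<lambda>x. 1 / 2 * div_grad b f x))"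

definition jump_U ::
  "(real^'d::finite \<Rightarrow> (real^'d) measure) \<Rightarrow> (real^'d) measure \<Rightarrow> 'd pfunctional" where
  "jump_U \<nu> \<eta> = (\<lambda>f. partial_integral \<eta>
     (\<lambda>x. integrable (\<nu> x) (\<lambda>y. f (x + y)))
     (\<lambda>x. (LINT y|\<nu> x. f (x + y)) - f x * measure (\<nu> x) UNIV))"

text \<open>Sign pitfall: Fubini's theorem gives
  \<open>\<Sum>\<^sub>i \<langle>V\<^sub>i, \<partial>\<^sub>i f\<rangle> = \<integral> \<integral> (f (x + y) - f x) \<mu>(x, dy) \<eta>(dx)\<close>, so the jumps in \<open>\<mu>\<close> contribute
  \<open>- \<nabla>\<cdot>V\<close> (just as the drift contributes \<open>- \<nabla>\<cdot>((a + a\<^sub>\<pi>) \<eta>)\<close>), and not \<open>+ \<nabla>\<cdot>V\<close>, to the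
  distributional equation. For \<open>W\<close> two derivatives are moved and the sign is \<open>+\<close>.\<close>

definition jump_V ::
  "(real^'d::finite \<Rightarrow> (real^'d) measure) \<Rightarrow> (real^'d) measure \<Rightarrow> 'd \<Rightarrow> 'd pfunctional" where
  "jump_V \<mu> \<eta> i = (\<lambda>f. partial_integral \<eta>
     (\<lambda>x. integrable (integrated_tail (\<mu> x)) (\<lambda>y. f (x + y) * (y $ i / norm y)))
     (\<lambda>x. LINT y|integrated_tail (\<mu> x). f (x + y) * (y $ i / norm y)))"

definition jump_W ::
  "(real^'d::finite \<Rightarrow> (real^'d) measure) \<Rightarrow> (real^'d) measure \<Rightarrow> 'd \<Rightarrow> 'd \<Rightarrow> 'd pfunctional" where
  "jump_W \<rho> \<eta> i j = (\<lambda>f. partial_integral \<eta>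
     (\<lambda>x. integrable (double_integrated_tail (\<rho> x)) (\<lambda>y. f (x + y) * (y $ i * y $ j / (norm y)\<^sup>2)))
     (\<lambda>x. LINT y|double_integrated_tail (\<rho> x). f (x + y) * (y $ i * y $ j / (norm y)\<^sup>2)))"

definition admissible_measures ::
  "(real^'d::finite \<Rightarrow> real^'d) \<Rightarrow> (real^'d \<Rightarrow> real^'d^'d) \<Rightarrow> (real^'d \<Rightarrow> (real^'d) measure) \<Rightarrow>
   (real^'d \<Rightarrow> (real^'d) measure) \<Rightarrow> (real^'d \<Rightarrow> (real^'d) measure) \<Rightarrow> (real^'d) measure set" where
  "admissible_measures a b \<nu> \<mu> \<rho> = {\<eta>. sets \<eta> = sets borel \<and>
     is_distribution (dist_div (weighted (\<lambda>x. a x + drift_correction \<nu> \<mu> \<rho> x) \<eta>)) \<and>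
     is_distribution (diffusion_functional b \<eta>) \<and>
     is_distribution (jump_U \<nu> \<eta>) \<and>
     is_distribution (dist_div (jump_V \<mu> \<eta>)) \<and>
     is_distribution (dist_hess (jump_W \<rho> \<eta>))}"

end

theory Submission
  imports Defs "HOL-Probability.Giry_Monad" "HOL-Probability.Distribution_Functions"
begin

text \<open>
  Fix a test function \<open>f\<close> and a point \<open>x\<close>, and expand along rays: in polar coordinates \<open>y = r \<xi>\<close>,
  \<open>f (x + r \<xi>) - f x = \<integral>\<^sub>0\<^sup>r \<xi> \<bullet> \<nabla>f (x + z \<xi>) dz\<close>, and the second order remainder is
  \<open>\<integral>\<^sub>0\<^sup>r (r - z) (d/dz)\<^sup>2 f (x + z \<xi>) dz\<close>. Integrating in \<open>r\<close> against the radial parts and exchanging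
  the order of integration turns the weights \<open>1\<close> and \<open>r - z\<close> into the single and the double integrated
  tail. Hence the jump part of \<open>A f x\<close> is, for every \<open>x\<close>, the sum of the integrands of \<open>U\<close>,
  \<open>\<Sum>\<^sub>i V\<^sub>i\<close> and \<open>\<Sum>\<^sub>i\<^sub>j W\<^sub>i\<^sub>j\<close> plus the drift correction. Admissibility makes each of the five terms
  integrable with respect to \<open>\<eta>\<close>, so \<open>\<integral> A f d\<eta>\<close> is the left-hand side of the distributional equation.

  Since the tails are built from an unspecified choice of polar decomposition, its existence has to be
  proved: weighting a Levy measure by \<open>w |y|\<close> makes it finite, and a finite measure on
  directions times radii disintegrates by means of conditional distribution functions.\<close>

section \<open>Disintegration of probability measures\<close>

text \<open>The measure \<open>\<eta>\<close> may fail to be sigma-finite, so only finite sums are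
  interchanged with the integral over \<open>\<eta>\<close>. Every genuine exchange of integrals
  happens for a fixed \<open>x\<close>, between Lebesgue measure on a ray and one radial part. The
  choice of polar decomposition disappears early: both tails integrate \<open>g\<close> to the
  \<open>Q\<close>-integral of \<open>radial_integral k g\<close>, with k(r, z) equal to 1 or to r -
  z, and this expression mentions neither directions nor radial parts as separate measures. The
  Taylor argument uses only that formula. The obstacle before it is that
  \<open>polar_decomposition\<close> gives measurability of the radial parts set by set and
  sigma-finiteness direction by direction, from which joint measurability does not follow directly.
  The choices in \<open>levy_polar\<close> and \<open>levy_polar2\<close> also bound a weighted
  radial mass, with weights min 1 r^2 and min r r^2; both are positive for r > 0, so the weight can
  be divided out again.\<close>

lemma AE_add_eq_if_set_nn_integral_eq:
  assumes "finite_measure M1" "f \<in> borel_measurable M1" "g \<in> borel_measurable M1" "h \<in> borel_measurable M1"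
    and fin: "(\<integral>\<^sup>+x. h x \<partial>M1) < \<infinity>"
    and eq: "\<And>B. B \<in> sets M1 \<Longrightarrow> (\<integral>\<^sup>+x\<in>B. f x \<partial>M1) + (\<integral>\<^sup>+x\<in>B. g x \<partial>M1) = (\<integral>\<^sup>+x\<in>B. h x \<partial>M1)"
  shows "AE x in M1. f x + g x = h x"
proof -
  have [measurable]: "f \<in> borel_measurable M1" "g \<in> borel_measurable M1" "h \<in> borel_measurable M1" by fact+
  have "density M1 (\<lambda>x. f x + g x) = density M1 h"
    by (rule measure_eqI)
       (auto simp: emeasure_density eq[symmetric] nn_integral_add[symmetric] distrib_right intro!: nn_integral_cong)
  moreover have "integral\<^sup>N M1 (\<lambda>x. f x + g x) \<noteq> \<infinity>"
    using eq[OF sets.top] fin by (simp add: nn_integral_add cong: nn_integral_cong)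
  \<comment> \<open>Equal measures have almost everywhere equal densities once one density has
    finite integral; this is where \<open>fin\<close> enters.\<close>
  ultimately show ?thesis
    by (subst (asm) finite_density_unique) (use assms in auto)
qed

text \<open>Real second coordinates make this elementary: a law on the line is determined by its
  distribution function, hence by countably many rational values, and countably many almost sure
  relations can be collected in a single null set.\<close>

lemma prob_disintegration:
  fixes J :: "('a \<times> real) measure" and M :: "'a measure"
  assumes "prob_space J" and sets_J: "sets J = sets (M \<Otimes>\<^sub>M borel)"
  obtains \<kappa> where "\<kappa> \<in> M \<rightarrow>\<^sub>M prob_algebra borel"
    and "J = distr J M fst \<bind> (\<lambda>x. distr (\<kappa> x) (M \<Otimes>\<^sub>M borel) (Pair x))"
proof -
  interpret J: prob_space J by fact
  note sets_J[measurable_cong]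
  define M1 where "M1 = distr J M fst"
  have sets_M1[measurable_cong]: "sets M1 = sets M" by (simp add: M1_def)
  have space_M1[simp]: "space M1 = space M" by (simp add: M1_def)
  interpret M1: prob_space M1 unfolding M1_def by (rule J.prob_space_distr) measurable
  \<comment> \<open>\<open>Nq A\<close> is the measure B |-> J(B x A). Its derivative
    \<open>\<phi> A\<close> with respect to the first marginal is the conditional probability of
    \<open>A\<close>, fixed only up to a null set that depends on \<open>A\<close>.\<close>
  define Nq where "Nq A = distr (density J (indicator (space M \<times> A))) M fst" for A :: "real set"
  define \<phi> where "\<phi> A = RN_deriv M1 (Nq A)" for A
  have [measurable]: "\<phi> A \<in> borel_measurable M" for A
    unfolding \<phi>_def using borel_measurable_RN_deriv[of M1] by (simp add: measurable_cong_sets[OF sets_M1 refl])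
  have space_J: "space J = space M \<times> UNIV"
    using sets_eq_imp_space_eq[OF sets_J] by (simp add: space_pair_measure)
  have em_M1: "emeasure M1 B = emeasure J (B \<times> UNIV)" if "B \<in> sets M" for B
    using that sets.sets_into_space[OF that] unfolding M1_def
    by (subst emeasure_distr) (auto simp: space_J intro!: arg_cong[where f="emeasure J"])
  have em_Nq: "emeasure (Nq A) B = emeasure J (B \<times> A)" if [measurable]: "B \<in> sets M" "A \<in> sets borel" for A B
  proof -
    have "emeasure (Nq A) B = (\<integral>\<^sup>+p. indicator (space M \<times> A) p * indicator (fst -` B \<inter> space J) p \<partial>J)"
      unfolding Nq_def by (simp add: emeasure_distr emeasure_density)
    also have "\<dots> = (\<integral>\<^sup>+p. indicator (B \<times> A) p \<partial>J)"
      using sets.sets_into_space[OF that(1)] by (intro nn_integral_cong) (auto simp: space_J indicator_def)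
    finally show ?thesis by simp
  qed
  have \<phi>: "(\<integral>\<^sup>+x\<in>B. \<phi> A x \<partial>M1) = emeasure J (B \<times> A)" if [measurable]: "B \<in> sets M" "A \<in> sets borel" for A B
  proof -
    have "absolutely_continuous M1 (Nq A)"
    proof (unfold absolutely_continuous_def, safe)
      fix C assume C: "C \<in> null_sets M1"
      then have [measurable]: "C \<in> sets M" using sets_M1 by auto
      have "emeasure J (C \<times> A) \<le> emeasure J (C \<times> UNIV)" by (intro emeasure_mono) auto
      also have "\<dots> = 0" using C em_M1[of C] by auto
      finally show "C \<in> null_sets (Nq A)" by (auto simp: null_sets_def em_Nq) (simp add: Nq_def)
    qed
    moreover have "sets (Nq A) = sets M1" by (simp add: Nq_def sets_M1)
    ultimately have "density M1 (\<phi> A) = Nq A" unfolding \<phi>_def by (rule M1.density_RN_deriv)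
    then have "emeasure (density M1 (\<phi> A)) B = emeasure (Nq A) B" by simp
    with em_Nq[OF that] show ?thesis by (simp add: emeasure_density)
  qed
  \<comment> \<open>Monotonicity of \<open>\<phi>\<close> in the set is read off from this
    additivity, the remainder \<open>\<phi> (A' - A)\<close> being nonnegative.\<close>
  have \<phi>_add: "AE x in M1. \<phi> A x + \<phi> (A' - A) x = \<phi> A' x"
    if [measurable]: "A \<in> sets borel" "A' \<in> sets borel" and sub: "A \<subseteq> A'" for A A'
  proof (rule AE_add_eq_if_set_nn_integral_eq)
    show "finite_measure M1" by unfold_locales
    show "(\<integral>\<^sup>+x. \<phi> A' x \<partial>M1) < \<infinity>"
    proof -
      have "(\<integral>\<^sup>+x. \<phi> A' x \<partial>M1) = (\<integral>\<^sup>+x\<in>space M. \<phi> A' x \<partial>M1)"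
        by (rule nn_integral_cong) simp
      also have "\<dots> < \<infinity>" by (simp add: \<phi> J.emeasure_eq_measure)
      finally show ?thesis .
    qed
  next
    fix B assume "B \<in> sets M1"
    then have [measurable]: "B \<in> sets M" by (simp add: sets_M1)
    have "emeasure J (B \<times> A) + emeasure J (B \<times> (A' - A)) = emeasure J (B \<times> A \<union> B \<times> (A' - A))"
      by (rule plus_emeasure) auto
    also have "B \<times> A \<union> B \<times> (A' - A) = B \<times> A'" using sub by auto
    finally show "(\<integral>\<^sup>+x\<in>B. \<phi> A x \<partial>M1) + (\<integral>\<^sup>+x\<in>B. \<phi> (A' - A) x \<partial>M1) = (\<integral>\<^sup>+x\<in>B. \<phi> A' x \<partial>M1)"
      by (simp add: \<phi>)
  qed simp_all
  have \<phi>_mono: "AE x in M1. \<phi> A x \<le> \<phi> A' x"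
    if "A \<in> sets borel" "A' \<in> sets borel" "A \<subseteq> A'" for A A'
    using \<phi>_add[OF that] by eventually_elim (metis le_iff_add)
  have \<phi>_UNIV: "AE x in M1. \<phi> UNIV x = 1"
  proof -
    have "AE x in M1. \<phi> UNIV x + 0 = 1"
    proof (rule AE_add_eq_if_set_nn_integral_eq)
      show "finite_measure M1" by unfold_locales
      show "(\<integral>\<^sup>+x. 1 \<partial>M1) < \<infinity>" using M1.emeasure_space_1 by simp
    next
      fix B assume "B \<in> sets M1"
      then have [measurable]: "B \<in> sets M" by (simp add: sets_M1)
      then show "(\<integral>\<^sup>+x\<in>B. \<phi> UNIV x \<partial>M1) + (\<integral>\<^sup>+x\<in>B. 0 \<partial>M1) = (\<integral>\<^sup>+x\<in>B. 1 \<partial>M1)"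
        by (simp add: \<phi> em_M1 sets_M1)
    qed simp_all
    then show ?thesis by simp
  qed

  \<comment> \<open>Conditional distribution functions at rational points\<close>
  define g where "g q x = enn2real (\<phi> {..real_of_rat q} x)" for q x
  have g_meas[measurable]: "g q \<in> borel_measurable M" for q unfolding g_def by measurable
  have \<phi>_le1: "AE x in M1. \<phi> A x \<le> 1" if "A \<in> sets borel" for A
    using \<phi>_mono[OF that, of UNIV, simplified] \<phi>_UNIV by eventually_elim simp
  have \<phi>_g: "AE x in M1. \<phi> {..real_of_rat q} x = ennreal (g q x)" for q
    using \<phi>_le1[of "{..real_of_rat q}", simplified] unfolding g_def
    by eventually_elim (auto simp: less_top[symmetric] intro!: ennreal_enn2real[symmetric] elim: le_less_trans)
  \<comment> \<open>On a set of full measure the conditional distribution functions are coherent along the rationals;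
    off this set the kernel is the point mass at 0.\<close>
  define good where "good x \<longleftrightarrow> (\<forall>p q. p \<le> q \<longrightarrow> g p x \<le> g q x) \<and> (\<forall>q. g q x \<le> 1) \<and>
     (\<forall>k::nat. \<exists>n::nat. g (- of_nat n) x < 1 / Suc k) \<and> (\<forall>k::nat. \<exists>n::nat. 1 - 1 / Suc k < g (of_nat n) x)" for x
  have [measurable]: "Measurable.pred M good" unfolding good_def by measurable
  have int_g: "(\<integral>\<^sup>+x. ennreal (g q x) \<partial>M1) = emeasure J (space M \<times> {..real_of_rat q})" for q
  proof -
    have "(\<integral>\<^sup>+x. ennreal (g q x) \<partial>M1) = (\<integral>\<^sup>+x\<in>space M. \<phi> {..real_of_rat q} x \<partial>M1)"
      by (intro nn_integral_cong_AE AE_mp[OF \<phi>_g[of q] AE_I2]) auto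
    then show ?thesis by (simp add: \<phi>)
  qed
  have good_mono: "AE x in M1. \<forall>p q. p \<le> q \<longrightarrow> g p x \<le> g q x"
  proof -
    have "AE x in M1. p \<le> q \<longrightarrow> g p x \<le> g q x" for p q
    proof (cases "p \<le> q")
      case True
      then have "AE x in M1. \<phi> {..real_of_rat p} x \<le> \<phi> {..real_of_rat q} x"
        by (intro \<phi>_mono) (auto simp: of_rat_less_eq intro: order_trans)
      with \<phi>_g[of p] \<phi>_g[of q] show ?thesis
        by eventually_elim (metis ennreal_le_iff enn2real_nonneg g_def)
    qed simp
    then show ?thesis by (simp add: AE_all_countable)
  qed
  have good_le1: "AE x in M1. \<forall>q. g q x \<le> 1"
  proof -
    have "AE x in M1. g q x \<le> 1" for q
      using \<phi>_g[of q] \<phi>_le1[of "{..real_of_rat q}", simplified] by eventually_elim simp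
    then show ?thesis by (simp add: AE_all_countable)
  qed
  have good_0: "AE x in M1. \<exists>n::nat. g (- of_nat n) x < 1 / Suc k" for k :: nat
  proof -
    \<comment> \<open>Markov's inequality: on \<open>Z\<close> every \<open>g (- n)\<close> is at
      least 1/(k+1), so the mass of \<open>Z\<close> is at most k+1 times the mass of the strips
      {..-n}, which decrease to the empty set.\<close>
    define Z where "Z = {x\<in>space M. \<forall>n::nat. \<not> g (- of_nat n) x < 1 / Suc k}"
    have [measurable]: "Z \<in> sets M" unfolding Z_def by measurable
    have le: "emeasure M1 Z * ennreal (1 / Suc k) \<le> emeasure J (space M \<times> {..- real n})" for n
    proof -
      have "emeasure M1 Z * ennreal (1 / Suc k) = (\<integral>\<^sup>+x. ennreal (1 / Suc k) * indicator Z x \<partial>M1)"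
        by (subst nn_integral_cmult_indicator) (simp_all add: sets_M1 mult.commute)
      also have "\<dots> \<le> (\<integral>\<^sup>+x. ennreal (g (- of_nat n) x) \<partial>M1)"
        by (intro nn_integral_mono) (auto simp: Z_def indicator_def not_less intro!: ennreal_leI)
      also have "\<dots> = emeasure J (space M \<times> {..- real n})" by (simp add: int_g of_rat_minus)
      finally show ?thesis .
    qed
    have "(\<lambda>n. emeasure J (space M \<times> {..- real n})) \<longlonglongrightarrow> emeasure J (\<Inter>n. space M \<times> {..- real n})"
      by (intro Lim_emeasure_decseq) (auto simp: decseq_def)
    also have "(\<Inter>n. space M \<times> {..- real n}) = {}"
    proof safe
      fix a b assume *: "(a, b) \<in> (\<Inter>n. space M \<times> {..- real n})"
      obtain n :: nat where "- b < real n" using reals_Archimedean2 by blast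
      with * show "(a, b) \<in> {}" by (auto dest!: spec[of _ n])
    qed
    finally have "emeasure M1 Z * ennreal (1 / Suc k) \<le> emeasure J {}"
      by (rule LIMSEQ_le_const) (use le in auto)
    then have "emeasure M1 Z = 0" by (auto simp: ennreal_eq_0_iff)
    then show ?thesis
      by (intro AE_I[of _ _ Z]) (auto simp: Z_def sets_M1)
  qed
  have good_1: "AE x in M1. \<exists>n::nat. 1 - 1 / Suc k < g (of_nat n) x" for k :: nat
  proof -
    \<comment> \<open>On \<open>Z\<close> every \<open>g n\<close> is at most 1 - 1/(k+1). The
      strips {..n} exhaust the line, so M1(Z) is at most (1 - 1/(k+1)) M1(Z), which forces it to be
      0.\<close>
    define Z where "Z = {x\<in>space M. \<forall>n::nat. \<not> 1 - 1 / Suc k < g (of_nat n) x}"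
    have Z[measurable]: "Z \<in> sets M" unfolding Z_def by measurable
    have le: "emeasure J (Z \<times> {..real n}) \<le> emeasure M1 Z * ennreal (1 - 1 / Suc k)" for n
    proof -
      have "emeasure J (Z \<times> {..real n}) = (\<integral>\<^sup>+x\<in>Z. ennreal (g (of_nat n) x) \<partial>M1)"
        by (subst \<phi>[symmetric]) (auto intro!: nn_integral_cong_AE AE_mp[OF \<phi>_g[of "of_nat n"] AE_I2])
      also have "\<dots> \<le> (\<integral>\<^sup>+x. ennreal (1 - 1 / Suc k) * indicator Z x \<partial>M1)"
        by (intro nn_integral_mono) (auto simp: Z_def indicator_def not_less intro!: ennreal_leI)
      also have "\<dots> = emeasure M1 Z * ennreal (1 - 1 / Suc k)"
        by (subst nn_integral_cmult_indicator) (simp_all add: sets_M1 mult.commute)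
      finally show ?thesis .
    qed
    have "(\<lambda>n. emeasure J (Z \<times> {..real n})) \<longlonglongrightarrow> emeasure J (\<Union>n. Z \<times> {..real n})"
      by (intro Lim_emeasure_incseq) (auto simp: incseq_def)
    also have "(\<Union>n. Z \<times> {..real n}) = Z \<times> UNIV"
      by (auto simp: real_arch_simple)
    finally have "emeasure J (Z \<times> UNIV) \<le> emeasure M1 Z * ennreal (1 - 1 / Suc k)"
      by (rule LIMSEQ_le_const2) (use le in auto)
    then have "ennreal (measure M1 Z) \<le> ennreal (measure M1 Z * (1 - 1 / Suc k))"
      by (simp only: em_M1[symmetric, OF Z] M1.emeasure_eq_measure ennreal_mult' measure_nonneg)
    then have "measure M1 Z \<le> measure M1 Z * (1 - 1 / Suc k)"
      by (subst (asm) ennreal_le_iff) auto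
    then have "measure M1 Z = 0"
      using measure_nonneg[of M1 Z] by (simp add: field_simps)
    then have "emeasure M1 Z = 0" by (simp add: M1.emeasure_eq_measure)
    then show ?thesis
      by (intro AE_I[of _ _ Z]) (auto simp: Z_def sets_M1)
  qed
  have good_AE: "AE x in M1. good x"
    unfolding good_def using good_mono good_le1 good_0 good_1 by (simp add: AE_all_countable)

  \<comment> \<open>Right-continuous extension to the reals and the resulting kernel\<close>
  have g_nn[simp]: "0 \<le> g q x" for q x by (simp add: g_def)
  \<comment> \<open>Only rationals strictly above \<open>t\<close> enter the infimum. This makes
    \<open>F\<close> right continuous automatically, whereas \<open>g\<close> need not be so along
    the rationals.\<close>
  define S where "S t = {q. t < real_of_rat q}" for t
  have S_ne[simp]: "S t \<noteq> {}" for t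
    using of_rat_dense[of t "t + 1"] by (auto simp: S_def)
  have bdd[simp]: "bdd_below ((\<lambda>q. g q x) ` S t)" for t x
    by (auto intro!: bdd_belowI[of _ 0])
  define F where "F x t = (if good x then (INF q\<in>S t. g q x) else indicator {0..} t)" for x t
  have F_le: "F x t \<le> g q x" if "good x" "t < real_of_rat q" for x t q
    using that cINF_lower[OF bdd[of x t], of q] by (simp add: F_def S_def)

  have F_ge: "c \<le> F x t" if "good x" "\<And>q. t < real_of_rat q \<Longrightarrow> c \<le> g q x" for x t c
    using that by (auto simp: F_def intro!: cINF_greatest) (auto simp: S_def)
  have F_less: "\<exists>q. t < real_of_rat q \<and> g q x < c" if "good x" "F x t < c" for x t c
    using F_ge[of x t c] that by force
  have F_nn: "0 \<le> F x t" for x t by (cases "good x") (auto intro: F_ge, simp add: F_def)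
  have good_mono': "g p x \<le> g q x" if "good x" "p \<le> q" for p q x using that by (auto simp: good_def)
  have F_mono: "F x s \<le> F x t" if "s \<le> t" for x s t
  proof (cases "good x")
    case True then show ?thesis using that by (intro F_ge F_le) auto
  next
    case False then show ?thesis using that by (auto simp: F_def indicator_def)
  qed
  have F_right: "continuous (at_right t) (F x)" for x t
  proof (subst continuous_at_right_real_increasing, rule F_mono, assumption, safe)
    fix e :: real assume e: "0 < e"
    show "\<exists>d>0. F x (t + d) - F x t < e"
    proof (cases "good x")
      case True
      from F_less[OF True, of t "F x t + e"] e obtain q where q: "t < real_of_rat q" "g q x < F x t + e" by auto
      have "F x (t + (real_of_rat q - t) / 2) \<le> g q x" by (rule F_le) (use True q in \<open>auto simp: field_simps\<close>)
      with q show ?thesis by (intro exI[of _ "(real_of_rat q - t) / 2"]) auto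
    next
      case False
      then show ?thesis using e
        by (intro exI[of _ "if t < 0 then - t / 2 else 1"]) (auto simp: F_def indicator_def field_simps)
    qed
  qed
  have F_le1: "F x t \<le> 1" for x t
  proof (cases "good x")
    case True
    obtain q where "t < real_of_rat q" using S_ne[of t] by (auto simp: S_def)
    with F_le[OF True this] True show ?thesis unfolding good_def by (meson order_trans)
  qed (simp add: F_def)
  have F_bot: "(F x \<longlongrightarrow> 0) at_bot" for x
  proof (rule order_tendstoI)
    fix c :: real assume "0 < c"
    then obtain k :: nat where k: "1 / Suc k < c" using nat_approx_posE by blast
    show "eventually (\<lambda>t. F x t < c) at_bot"
    proof (cases "good x")
      case True
      then obtain n :: nat where n: "g (- of_nat n) x < 1 / Suc k" unfolding good_def by blast
      have "F x t < c" if "t < - real n" for t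
        using F_le[OF True, of t "- of_nat n"] that n k by (simp add: of_rat_minus)
      then show ?thesis by (auto simp: eventually_at_bot_dense)
    next
      case False
      then show ?thesis using \<open>0 < c\<close>
        by (auto simp: eventually_at_bot_dense F_def indicator_def intro!: exI[of _ 0])
    qed
  qed (auto intro!: always_eventually less_le_trans[OF _ F_nn])
  have F_top: "(F x \<longlongrightarrow> 1) at_top" for x
  proof (rule order_tendstoI)
    fix c :: real assume "c < 1"
    then obtain k :: nat where k: "1 / Suc k < 1 - c" using nat_approx_posE[of "1 - c"] by auto
    show "eventually (\<lambda>t. c < F x t) at_top"
    proof (cases "good x")
      case True
      then obtain n :: nat where n: "1 - 1 / Suc k < g (of_nat n) x" unfolding good_def by blast
      have "g (of_nat n) x \<le> F x t" if "real n < t" for t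
      proof (rule F_ge[OF True])
        fix q assume "t < real_of_rat q"
        with that have "real_of_rat (of_nat n) < real_of_rat q" by simp
        then show "g (of_nat n) x \<le> g q x" by (intro good_mono'[OF True]) (simp only: of_rat_less less_imp_le)
      qed
      then have "c < F x t" if "real n < t" for t using that n k by fastforce
      then show ?thesis by (auto simp: eventually_at_top_dense)
    next
      case False
      then show ?thesis using \<open>c < 1\<close>
        by (auto simp: eventually_at_top_dense F_def indicator_def intro!: exI[of _ 0])
    qed
  qed (auto intro!: always_eventually le_less_trans[OF F_le1])
  define \<kappa> where "\<kappa> x = interval_measure (F x)" for x
  have \<kappa>_real: "real_distribution (\<kappa> x)" for x
    unfolding \<kappa>_def by (rule real_distribution_interval_measure) (fact F_mono F_right F_bot F_top)+
  have \<kappa>_prob: "prob_space (\<kappa> x)" for x using \<kappa>_real[of x] by (simp add: real_distribution_def)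
  have \<kappa>_sets[simp]: "sets (\<kappa> x) = sets borel" for x by (simp add: \<kappa>_def)
  have \<kappa>_Iic: "emeasure (\<kappa> x) {..t} = ennreal (F x t)" for x t
  proof -
    interpret prob_space "\<kappa> x" by (rule \<kappa>_prob)
    have "cdf (\<kappa> x) = F x" unfolding \<kappa>_def by (rule cdf_interval_measure) (fact F_mono F_right F_bot)+
    then show ?thesis by (simp add: emeasure_eq_measure cdf_def fun_eq_iff)
  qed
  have F_meas[measurable]: "(\<lambda>x. F x t) \<in> borel_measurable M" for t
    unfolding F_def by (intro measurable_If borel_measurable_cINF) (auto simp: borel_measurable_count_space)
  have borel_gen: "sets borel = sigma_sets UNIV (range (\<lambda>a::real. {..a}))"
    by (subst borel_eq_atMost) simp
  have \<kappa>_meas: "\<kappa> \<in> M \<rightarrow>\<^sub>M prob_algebra borel"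
  proof (rule measurable_prob_algebra_generated[where \<Omega>=UNIV and G="range (\<lambda>a::real. {..a})"])
    show "sets borel = sigma_sets UNIV (range (\<lambda>a::real. {..a}))" by (rule borel_gen)
    show "Int_stable (range (\<lambda>a::real. {..a}))" by (auto simp: Int_stable_def intro!: exI[of _ "min _ _"])
  qed (auto simp: \<kappa>_prob \<kappa>_Iic)
  \<comment> \<open>\<open>F x t\<close> is an infimum over rationals beyond \<open>t\<close>, while
    J(B x {..t}) uses \<open>t\<close> itself. The upper bound comes from rationals between t and t
    + 1/(n+1) and continuity of \<open>J\<close> from above, the lower bound from monotonicity of
    \<open>\<phi>\<close>.\<close>
  have int_F: "(\<integral>\<^sup>+x\<in>B. ennreal (F x t) \<partial>M1) = emeasure J (B \<times> {..t})" if [measurable]: "B \<in> sets M" for B t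
  proof (rule antisym)
    have le: "(\<integral>\<^sup>+x\<in>B. ennreal (F x t) \<partial>M1) \<le> emeasure J (B \<times> {..real_of_rat q})" if "t < real_of_rat q" for q
    proof -
      have "AE x in M1. ennreal (F x t) * indicator B x \<le> \<phi> {..real_of_rat q} x * indicator B x"
        using good_AE \<phi>_g[of q]
        by eventually_elim (auto simp: indicator_def intro!: ennreal_leI F_le that)
      then have "(\<integral>\<^sup>+x\<in>B. ennreal (F x t) \<partial>M1) \<le> (\<integral>\<^sup>+x\<in>B. \<phi> {..real_of_rat q} x \<partial>M1)"
        by (rule nn_integral_mono_AE)
      then show ?thesis by (simp add: \<phi>)
    qed
    have le': "(\<integral>\<^sup>+x\<in>B. ennreal (F x t) \<partial>M1) \<le> emeasure J (B \<times> {..t + 1 / Suc n})" for n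
    proof -
      obtain q where q: "t < real_of_rat q" "real_of_rat q < t + 1 / Suc n"
        using of_rat_dense[of t "t + 1 / Suc n"] by auto
      have "emeasure J (B \<times> {..real_of_rat q}) \<le> emeasure J (B \<times> {..t + 1 / Suc n})"
        using q by (intro emeasure_mono) auto
      with le[OF q(1)] show ?thesis by simp
    qed
    have "(\<lambda>n. emeasure J (B \<times> {..t + 1 / Suc n})) \<longlonglongrightarrow> emeasure J (\<Inter>n. B \<times> {..t + 1 / Suc n})"
    proof (intro Lim_emeasure_decseq)
      have "1 / real (Suc n) \<le> 1 / real (Suc m)" if "m \<le> n" for m n using that by (simp add: frac_le)
      then show "decseq (\<lambda>n. B \<times> {..t + 1 / Suc n})"
        unfolding decseq_def by (intro allI impI Sigma_mono) (auto intro: order_trans[OF _ add_left_mono])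
    qed auto
    also have "(\<Inter>n. B \<times> {..t + 1 / Suc n}) = B \<times> {..t}"
    proof safe
      fix a b assume *: "(a, b) \<in> (\<Inter>n. B \<times> {..t + 1 / Suc n})"
      then show "a \<in> B" by auto
      show "b \<le> t"
      proof (rule field_le_epsilon)
        fix e :: real assume "0 < e"
        then obtain n where "1 / Suc n < e" using nat_approx_posE by blast
        with * show "b \<le> t + e" by (auto dest!: spec[of _ n])
      qed
    qed (auto intro: order_trans[of _ t])
    finally show "(\<integral>\<^sup>+x\<in>B. ennreal (F x t) \<partial>M1) \<le> emeasure J (B \<times> {..t})"
      by (rule LIMSEQ_le_const) (use le' in auto)
    \<comment> \<open>The quantifier over \<open>q\<close> can be moved inside because there are
      countably many rationals; \<open>F_ge\<close> then compares \<open>\<phi> {..t}\<close> with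
      the infimum on one set of full measure.\<close>
    have "AE x in M1. \<forall>q. t < real_of_rat q \<longrightarrow> \<phi> {..t} x \<le> ennreal (g q x)"
    proof (subst AE_all_countable, rule allI)
      fix q
      show "AE x in M1. t < real_of_rat q \<longrightarrow> \<phi> {..t} x \<le> ennreal (g q x)"
      proof (cases "t < real_of_rat q")
        case True
        then have "AE x in M1. \<phi> {..t} x \<le> \<phi> {..real_of_rat q} x" by (intro \<phi>_mono) auto
        with \<phi>_g[of q] show ?thesis by eventually_elim auto
      qed simp
    qed
    then have "AE x in M1. \<phi> {..t} x \<le> ennreal (F x t)"
      using good_AE \<phi>_le1[of "{..t}", simplified]
    proof eventually_elim
      case (elim x)
      obtain r where r: "\<phi> {..t} x = ennreal r"
        using elim by (cases "\<phi> {..t} x") (auto simp: top_unique)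
      show ?case unfolding r
        by (rule ennreal_leI, rule F_ge) (use elim r in auto)
    qed
    then have "AE x in M1. \<phi> {..t} x * indicator B x \<le> ennreal (F x t) * indicator B x"
      by eventually_elim (auto simp: indicator_def)
    then have "(\<integral>\<^sup>+x\<in>B. \<phi> {..t} x \<partial>M1) \<le> (\<integral>\<^sup>+x\<in>B. ennreal (F x t) \<partial>M1)"
      by (rule nn_integral_mono_AE)
    then show "emeasure J (B \<times> {..t}) \<le> (\<integral>\<^sup>+x\<in>B. ennreal (F x t) \<partial>M1)" by (simp add: \<phi>)
  qed

  \<comment> \<open>Reassembling the joint law from its marginal and the kernel\<close>
  have kern: "(\<lambda>x. distr (\<kappa> x) (M \<Otimes>\<^sub>M borel) (Pair x)) \<in> M1 \<rightarrow>\<^sub>M prob_algebra (M \<Otimes>\<^sub>M borel)"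
    using \<kappa>_meas by (simp add: measurable_cong_sets[OF sets_M1 refl]) measurable
  define J' where "J' = M1 \<bind> (\<lambda>x. distr (\<kappa> x) (M \<Otimes>\<^sub>M borel) (Pair x))"
  have M1_in: "M1 \<in> space (prob_algebra M1)" by (simp add: space_prob_algebra M1.prob_space_axioms)
  have sets_J': "sets J' = sets (M \<Otimes>\<^sub>M borel)"
    unfolding J'_def by (rule sets_bind'[OF M1_in kern])
  note sets_J'[measurable_cong]
  interpret J': prob_space J' unfolding J'_def by (rule prob_space_bind'[OF M1_in kern])
  have J'_rect: "emeasure J' (B \<times> A) = (\<integral>\<^sup>+x\<in>B. emeasure (\<kappa> x) A \<partial>M1)"
    if [measurable]: "B \<in> sets M" "A \<in> sets borel" for B A
  proof -
    have "emeasure J' (B \<times> A) = (\<integral>\<^sup>+x. emeasure (distr (\<kappa> x) (M \<Otimes>\<^sub>M borel) (Pair x)) (B \<times> A) \<partial>M1)"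
      unfolding J'_def by (rule emeasure_bind_prob_algebra[OF M1_in kern]) simp
    also have "\<dots> = (\<integral>\<^sup>+x\<in>B. emeasure (\<kappa> x) A \<partial>M1)"
    proof (rule nn_integral_cong)
      fix x assume "x \<in> space M1"
      then have "emeasure (distr (\<kappa> x) (M \<Otimes>\<^sub>M borel) (Pair x)) (B \<times> A) = emeasure (\<kappa> x) (Pair x -` (B \<times> A) \<inter> space (\<kappa> x))"
        by (intro emeasure_distr) (auto simp: measurable_cong_sets[OF \<kappa>_sets refl])
      also have "Pair x -` (B \<times> A) \<inter> space (\<kappa> x) = (if x \<in> B then A else {})"
        by (auto simp: sets_eq_imp_space_eq[OF \<kappa>_sets])
      finally show "emeasure (distr (\<kappa> x) (M \<Otimes>\<^sub>M borel) (Pair x)) (B \<times> A) = emeasure (\<kappa> x) A * indicator B x"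
        by (auto simp: indicator_def)
    qed
    finally show ?thesis .
  qed
  \<comment> \<open>With \<open>B\<close> fixed, cutting by B x UNIV and projecting to the second
    coordinate turns A |-> J(B x A) and A |-> J'(B x A) into finite measures on the line. They agree
    on half-lines by \<open>int_F\<close>, and half-lines form a generator stable under
    intersections.\<close>
  have rect: "emeasure J (B \<times> A) = emeasure J' (B \<times> A)"
    if [measurable]: "B \<in> sets M" "A \<in> sets borel" for B A
  proof -
    have em: "emeasure (distr (density L (indicator (B \<times> UNIV))) borel snd) C = emeasure L (B \<times> C)"
      if L[measurable_cong]: "sets L = sets (M \<Otimes>\<^sub>M borel)" and [measurable]: "C \<in> sets borel" for L :: "('a \<times> real) measure" and C
    proof -
      have "emeasure (distr (density L (indicator (B \<times> UNIV))) borel snd) C =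
          (\<integral>\<^sup>+p. indicator (B \<times> UNIV) p * indicator (snd -` C \<inter> space L) p \<partial>L)"
        by (simp add: emeasure_distr emeasure_density)
      also have "\<dots> = (\<integral>\<^sup>+p. indicator (B \<times> C) p \<partial>L)"
        using sets.sets_into_space[OF \<open>B \<in> sets M\<close>] sets_eq_imp_space_eq[OF L]
        by (intro nn_integral_cong) (auto simp: space_pair_measure indicator_def)
      finally show ?thesis by simp
    qed
    have "distr (density J (indicator (B \<times> UNIV))) borel snd = distr (density J' (indicator (B \<times> UNIV))) borel snd"
    proof (rule measure_eqI_generator_eq[where \<Omega>=UNIV and E="range (\<lambda>a::real. {..a})" and A="\<lambda>n. {..real n}"])
      show "Int_stable (range (\<lambda>a::real. {..a}))" by (auto simp: Int_stable_def intro!: exI[of _ "min _ _"])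
      show "(\<Union>i. {..real i}) = UNIV" by (auto simp: real_arch_simple)
      show "emeasure (distr (density J (indicator (B \<times> UNIV))) borel snd) {..real i} \<noteq> \<infinity>" for i
        by (simp add: em sets_J)
      fix X assume "X \<in> range (\<lambda>a::real. {..a})"
      then show "emeasure (distr (density J (indicator (B \<times> UNIV))) borel snd) X =
         emeasure (distr (density J' (indicator (B \<times> UNIV))) borel snd) X"
        by (auto simp: em sets_J sets_J' J'_rect \<kappa>_Iic int_F)
    qed (auto simp: borel_gen[symmetric])
    then show ?thesis using em[OF sets_J, of A] em[OF sets_J', of A] by simp
  qed
  have "J = J'"
  proof (rule measure_eqI_generator_eq[OF Int_stable_pair_measure_generator[of M borel],
       where \<Omega>="space M \<times> UNIV" and A="\<lambda>_. space M \<times> UNIV"])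
    show "{a \<times> b |a b. a \<in> sets M \<and> b \<in> sets (borel::real measure)} \<subseteq> Pow (space M \<times> UNIV)"
      using sets.sets_into_space by fastforce
    show "sets J = sigma_sets (space M \<times> UNIV) {a \<times> b |a b. a \<in> sets M \<and> b \<in> sets borel}"
      "sets J' = sigma_sets (space M \<times> UNIV) {a \<times> b |a b. a \<in> sets M \<and> b \<in> sets borel}"
      by (simp_all add: sets_J sets_J' sets_pair_measure)
  qed (auto simp: rect intro!: exI[of _ "space M"] exI[of _ "UNIV::real set"])
  then show ?thesis using that[OF \<kappa>_meas] by (simp add: J'_def M1_def)
qed

section \<open>Polar decompositions\<close>

lemma sgn_measurable[measurable]: "(sgn :: real^'d::finite \<Rightarrow> _) \<in> borel_measurable borel"
  unfolding sgn_div_norm[abs_def] by measurable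

text \<open>The density w(|y|)/c turns \<open>Q\<close> into a probability measure, whose image
  under (sgn, norm) is disintegrated; putting the factor c/w(r) back into the radial laws restores
  \<open>Q\<close>. Since c/w times \<open>w\<close> is the constant \<open>c\<close>, each radial
  part gives \<open>w\<close> an integral of at most \<open>c\<close>.\<close>

lemma polar_decomposition_exists:
  fixes Q :: "(real^'d::finite) measure" and w :: "real \<Rightarrow> real"
  assumes sets_Q[measurable_cong]: "sets Q = sets borel" and Q0: "emeasure Q {0} = 0"
    and [measurable]: "w \<in> borel_measurable borel" and w_pos: "\<And>r. 0 < r \<Longrightarrow> 0 < w r"
    and fin: "(\<integral>\<^sup>+y. ennreal (w (norm y)) \<partial>Q) < \<infinity>"
  shows "\<exists>Q\<^sub>o Q\<^sub>r. polar_decomposition Q Q\<^sub>o Q\<^sub>r \<and> (\<forall>\<xi>\<in>sphere 0 1. (\<integral>\<^sup>+r. ennreal (w r) \<partial>Q\<^sub>r \<xi>) < \<infinity>)"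
proof -
  define S where "S = (sphere 0 1 :: (real^'d) set)"
  have S[measurable]: "S \<in> sets borel" unfolding S_def by (intro borel_closed) simp
  have space_Q: "space Q = UNIV" using sets_eq_imp_space_eq[OF sets_Q] by simp
  have AE_nz: "AE y in Q. y \<noteq> 0"
    using Q0 by (intro AE_I[of _ _ "{0}"]) (auto simp: sets_Q)
  obtain c where c: "(\<integral>\<^sup>+y. ennreal (w (norm y)) \<partial>Q) = ennreal c" "0 \<le> c"
    using fin by (cases "\<integral>\<^sup>+y. ennreal (w (norm y)) \<partial>Q") auto
  show ?thesis
  proof (cases "c = 0")
    case True
    then have "AE y in Q. ennreal (w (norm y)) = 0"
      using c by (simp add: nn_integral_0_iff_AE)
    then have "AE y in Q. False"
      using AE_nz by eventually_elim (use w_pos in \<open>auto simp: ennreal_eq_0_iff not_le[symmetric]\<close>)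
    then have "emeasure Q (space Q) = 0" by (simp add: AE_iff_null null_sets_def)
    then have Q_null: "emeasure Q B = 0" for B
      using emeasure_space[of Q B] by simp
    define R where "R = restrict_space borel {0::real<..}"
    have [simp]: "sets R = sets (restrict_space borel {0<..})" by (simp add: R_def)
    have R1: "1 \<in> space R" by (simp add: R_def space_restrict_space)
    have R_sets: "{0<..} \<in> sets R" by (simp add: R_def sets_restrict_space image_iff) (metis Int_absorb UNIV_I sets.top space_borel inf_commute inf_top_right)
    interpret ret: prob_space "return R 1" by (rule prob_space_return[OF R1])
    \<comment> \<open>Here \<open>Q\<close> is the zero measure. Radial parts must nevertheless have
      positive mass in every direction, so all the vanishing is put into the spherical part and the
      radial parts are point masses at 1.\<close>
    have "polar_decomposition Q (null_measure (restrict_space borel (sphere 0 1))) (\<lambda>_. return R 1)"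
      unfolding polar_decomposition_def
      using R_sets ret.sigma_finite_measure_axioms
      by (auto simp: Q_null intro!: finite_measureI)
    moreover have "(\<integral>\<^sup>+r. ennreal (w r) \<partial>return R 1) < \<infinity>"
      by (subst nn_integral_return[OF R1]) (auto simp: R_def intro!: measurable_restrict_space1)
    ultimately show ?thesis by blast
  next
    case False
    with c(2) have c0: "0 < c" by simp
    define P where "P = density Q (\<lambda>y. ennreal (w (norm y) / c))"
    have sets_P[measurable_cong, simp]: "sets P = sets borel" by (simp add: P_def sets_Q)
    have P: "prob_space P"
    proof
      have "emeasure P (space P) = (\<integral>\<^sup>+y. ennreal (w (norm y)) / ennreal c \<partial>Q)"
        unfolding P_def using c0 by (simp add: emeasure_density divide_ennreal_def
            inverse_ennreal ennreal_mult'' divide_real_def cong: nn_integral_cong)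
      also have "\<dots> = 1" using c0 by (simp add: nn_integral_divide c ennreal_divide_self)
      finally show "emeasure P (space P) = 1" .
    qed
    define J where "J = distr P (borel \<Otimes>\<^sub>M borel) (\<lambda>y. (sgn y, norm y))"
    have J: "prob_space J"
      unfolding J_def by (rule prob_space.prob_space_distr[OF P]) measurable
    have "sets J = sets (borel \<Otimes>\<^sub>M borel)" by (simp add: J_def)
    from prob_disintegration[OF J this] obtain \<kappa> where
      \<kappa>[measurable]: "\<kappa> \<in> borel \<rightarrow>\<^sub>M prob_algebra borel" and
      J_eq: "J = distr J borel fst \<bind> (\<lambda>x. distr (\<kappa> x) (borel \<Otimes>\<^sub>M borel) (Pair x))" by blast
    define M1 where "M1 = distr J borel fst"
    have sets_M1[measurable_cong, simp]: "sets M1 = sets borel" by (simp add: M1_def)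
    interpret M1: prob_space M1 unfolding M1_def by (rule prob_space.prob_space_distr[OF J]) (simp add: J_def)
    have \<kappa>_prob: "prob_space (\<kappa> x)" and \<kappa>_sets[simp]: "sets (\<kappa> x) = sets borel" for x
      using measurable_space[OF \<kappa>, of x] by (auto simp: space_prob_algebra)
    have int_J: "(\<integral>\<^sup>+p. g p \<partial>J) = (\<integral>\<^sup>+x. (\<integral>\<^sup>+r. g (x, r) \<partial>\<kappa> x) \<partial>M1)"
      if [measurable]: "g \<in> borel_measurable (borel \<Otimes>\<^sub>M borel)" for g
    proof -
      have "(\<integral>\<^sup>+p. g p \<partial>J) = (\<integral>\<^sup>+x. (\<integral>\<^sup>+p. g p \<partial>distr (\<kappa> x) (borel \<Otimes>\<^sub>M borel) (Pair x)) \<partial>M1)"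
        by (subst J_eq, fold M1_def, rule nn_integral_bind[where B="borel \<Otimes>\<^sub>M borel"])
           (auto intro!: measurable_prob_algebraD simp: measurable_cong_sets[OF sets_M1 refl])
      also have "\<dots> = (\<integral>\<^sup>+x. (\<integral>\<^sup>+r. g (x, r) \<partial>\<kappa> x) \<partial>M1)"
        by (intro nn_integral_cong nn_integral_distr) (auto simp: measurable_cong_sets[OF \<kappa>_sets refl])
      finally show ?thesis .
    qed
    have int_J': "(\<integral>\<^sup>+p. g p \<partial>J) = (\<integral>\<^sup>+y. ennreal (w (norm y) / c) * g (sgn y, norm y) \<partial>Q)"
      if [measurable]: "g \<in> borel_measurable (borel \<Otimes>\<^sub>M borel)" for g
      unfolding J_def P_def by (subst nn_integral_distr, simp_all) (subst nn_integral_density, simp_all)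
    \<comment> \<open>The joint law lives on unit vectors times positive radii: only y = 0 is sent
      elsewhere, to the pair (0, 0), and \<open>Q\<close> does not charge it.\<close>
    have "(\<integral>\<^sup>+p. indicator {p. \<not> (fst p \<in> S \<and> 0 < snd p)} p \<partial>J) = 0"
    proof -
      have "(\<integral>\<^sup>+p. indicator {p. \<not> (fst p \<in> S \<and> 0 < snd p)} p \<partial>J)
         = (\<integral>\<^sup>+y. ennreal (w (norm y) / c) * indicator {p. \<not> (fst p \<in> S \<and> 0 < snd p)} (sgn y, norm y) \<partial>Q)"
        by (rule int_J') measurable
      also have "\<dots> = (\<integral>\<^sup>+y. 0 \<partial>Q)"
        using AE_nz by (intro nn_integral_cong_AE) (auto simp: S_def norm_sgn elim!: eventually_mono)
      finally show ?thesis by simp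
    qed
    then have "(\<integral>\<^sup>+x. (\<integral>\<^sup>+r. indicator {p. \<not> (fst p \<in> S \<and> 0 < snd p)} (x, r) \<partial>\<kappa> x) \<partial>M1) = 0"
      by (subst (asm) int_J) auto
    then have "AE x in M1. (\<integral>\<^sup>+r. indicator {p. \<not> (fst p \<in> S \<and> 0 < snd p)} (x, r) \<partial>\<kappa> x) = 0"
      by (subst (asm) nn_integral_0_iff_AE)
         (auto simp: measurable_cong_sets[OF sets_M1 refl]
           intro!: nn_integral_measurable_subprob_algebra2[where N=borel] measurable_prob_algebraD \<kappa>)
    then have AE_M1: "AE x in M1. x \<in> S \<and> emeasure (\<kappa> x) {..0} = 0"
    proof eventually_elim
      case (elim x)
      interpret prob_space "\<kappa> x" by (rule \<kappa>_prob)
      have "x \<in> S"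
      proof (rule ccontr)
        assume "x \<notin> S"
        then have "(\<integral>\<^sup>+r. indicator {p. \<not> (fst p \<in> S \<and> 0 < snd p)} (x, r) \<partial>\<kappa> x) = (\<integral>\<^sup>+r. 1 \<partial>\<kappa> x)"
          by (intro nn_integral_cong) auto
        with elim emeasure_space_1 show False by simp
      qed
      moreover from this have "(\<integral>\<^sup>+r. indicator {p. \<not> (fst p \<in> S \<and> 0 < snd p)} (x, r) \<partial>\<kappa> x) = (\<integral>\<^sup>+r. indicator {..0} r \<partial>\<kappa> x)"
        by (intro nn_integral_cong) (auto simp: indicator_def)
      ultimately show ?case using elim by simp
    qed
    \<comment> \<open>\<open>polar_decomposition\<close> constrains every direction, not just almost
      every one. Where \<open>\<kappa> x\<close> charges nonpositive radii, an exceptional set by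
      \<open>AE_M1\<close>, it is replaced by the point mass at 1.\<close>
    define \<kappa>' where "\<kappa>' x = (if emeasure (\<kappa> x) {..0} = 0 then \<kappa> x else return borel 1)" for x
    have em_meas: "(\<lambda>x. emeasure (\<kappa> x) A) \<in> borel_measurable borel" if "A \<in> sets borel" for A
      using measurable_emeasure_kernel[OF measurable_prob_algebraD[OF \<kappa>] that] .
    have \<kappa>'[measurable]: "\<kappa>' \<in> borel \<rightarrow>\<^sub>M subprob_algebra borel"
      unfolding \<kappa>'_def using em_meas[of "{..0}"]
      by (intro measurable_If measurable_prob_algebraD[OF \<kappa>] measurable_const)
         (auto simp: space_subprob_algebra intro!: prob_space_imp_subprob_space prob_space_return)
    have \<kappa>'_prob: "prob_space (\<kappa>' x)" and \<kappa>'_sets[simp, measurable_cong]: "sets (\<kappa>' x) = sets borel" for x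
      by (auto simp: \<kappa>'_def \<kappa>_prob prob_space_return)
    have \<kappa>'_0: "emeasure (\<kappa>' x) {..0} = 0" for x by (auto simp: \<kappa>'_def)
    have AE_\<kappa>': "AE r in \<kappa>' x. 0 < r" for x
      using \<kappa>'_0[of x] by (intro AE_I[of _ _ "{..0}"]) auto
    define Qo where "Qo = restrict_space M1 S"
    \<comment> \<open>The density c/w cancels the weight used to define \<open>P\<close>; the result
      can be infinite near radius 0 but stays sigma-finite, the density being finite.\<close>
    define Qr where "Qr x = density (restrict_space (\<kappa>' x) {0<..}) (\<lambda>r. ennreal (c / w r))" for x
    have sets_Qr: "sets (Qr x) = sets (restrict_space borel {0<..})" for x
      by (simp add: Qr_def sets_restrict_space)
    have int_Qr: "(\<integral>\<^sup>+r. g r \<partial>Qr x) = (\<integral>\<^sup>+r. ennreal (c / w r) * g r * indicator {0<..} r \<partial>\<kappa>' x)"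
      if [measurable]: "g \<in> borel_measurable borel" for g x
      unfolding Qr_def
      by (subst nn_integral_density)
         (auto simp: nn_integral_restrict_space measurable_cong_sets[OF \<kappa>'_sets refl] intro!: measurable_restrict_space1)
    have Qr_pos: "0 < emeasure (Qr x) {0<..}" for x
    proof (rule ccontr)
      interpret prob_space "\<kappa>' x" by (rule \<kappa>'_prob)
      assume "\<not> 0 < emeasure (Qr x) {0<..}"
      moreover have "{0<..} \<in> sets (Qr x)" unfolding sets_Qr by (auto simp: sets_restrict_space image_iff intro!: bexI[of _ UNIV])
      ultimately have "(\<integral>\<^sup>+r. indicator {0<..} r \<partial>Qr x) = 0" by simp
      then have "AE r in \<kappa>' x. ennreal (c / w r) * indicator {0<..} r * indicator {0<..} r = 0"
        by (subst (asm) int_Qr, simp) (subst (asm) nn_integral_0_iff_AE, auto simp: measurable_cong_sets[OF \<kappa>'_sets refl])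
      with AE_\<kappa>' have "AE r in \<kappa>' x. False"
        by eventually_elim (use w_pos c0 in \<open>auto simp: ennreal_eq_0_iff not_le[symmetric] divide_le_0_iff dest: order.asym\<close>)
      then show False by simp
    qed
    have Qr_sf: "sigma_finite_measure (Qr x)" for x
    proof -
      interpret prob_space "\<kappa>' x" by (rule \<kappa>'_prob)
      interpret fm: finite_measure "restrict_space (\<kappa>' x) {0<..}"
        by (rule finite_measure_restrict_space[OF finite_measure_axioms]) simp
      show ?thesis unfolding Qr_def
        by (subst fm.sigma_finite_iff_density_finite)
           (auto simp: measurable_cong_sets[OF \<kappa>'_sets refl] intro!: measurable_restrict_space1)
    qed
    have inner_meas: "(\<lambda>x. \<integral>\<^sup>+r. ennreal (c / w r) * g (x, r) * indicator {0<..} r \<partial>\<kappa>' x) \<in> borel_measurable borel"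
      if [measurable]: "g \<in> borel_measurable (borel \<Otimes>\<^sub>M borel)" for g :: "(real^'d) \<times> real \<Rightarrow> ennreal"
      by (rule nn_integral_measurable_subprob_algebra2[where N=borel]) measurable
    have em_Qr: "(\<lambda>\<xi>. emeasure (Qr \<xi>) R) \<in> borel_measurable (restrict_space borel (sphere 0 1))"
      if R: "R \<in> sets (restrict_space borel {0<..})" for R
    proof -
      from R have [measurable]: "R \<in> sets borel" by (auto simp: sets_restrict_space)
      have "emeasure (Qr \<xi>) R = (\<integral>\<^sup>+r. ennreal (c / w r) * (\<lambda>p. indicator R (snd p)) (\<xi>, r) * indicator {0<..} r \<partial>\<kappa>' \<xi>)" for \<xi>
      proof -
        have "emeasure (Qr \<xi>) R = (\<integral>\<^sup>+r. indicator R r \<partial>Qr \<xi>)" using R by (simp add: sets_Qr)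
        then show ?thesis by (subst (asm) int_Qr) simp_all
      qed
      then show ?thesis using inner_meas[of "\<lambda>p. indicator R (snd p)"] by (simp add: measurable_restrict_space1)
    qed
    have main: "emeasure Q B = (\<integral>\<^sup>+\<xi>. (\<integral>\<^sup>+r. indicator B (r *\<^sub>R \<xi>) \<partial>Qr \<xi>) \<partial>Qo)" if [measurable]: "B \<in> sets borel" for B
    proof -
      define g where "g p = ennreal (c / w (snd p)) * indicator B (snd p *\<^sub>R fst p) * indicator {0<..} (snd p) * indicator S (fst p)"
        for p :: "(real^'d) \<times> real"
      have [measurable]: "g \<in> borel_measurable (borel \<Otimes>\<^sub>M borel)" unfolding g_def by measurable
      have "(\<integral>\<^sup>+\<xi>. (\<integral>\<^sup>+r. indicator B (r *\<^sub>R \<xi>) \<partial>Qr \<xi>) \<partial>Qo) =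
          (\<integral>\<^sup>+\<xi>. (\<integral>\<^sup>+r. ennreal (c / w r) * indicator B (r *\<^sub>R \<xi>) * indicator {0<..} r \<partial>\<kappa>' \<xi>) * indicator S \<xi> \<partial>M1)"
        unfolding Qo_def by (subst nn_integral_restrict_space) (auto simp: int_Qr)
      also have "\<dots> = (\<integral>\<^sup>+\<xi>. (\<integral>\<^sup>+r. g (\<xi>, r) \<partial>\<kappa> \<xi>) \<partial>M1)"
      proof (rule nn_integral_cong_AE, use AE_M1 in eventually_elim)
        case (elim \<xi>)
        then show ?case by (simp add: g_def \<kappa>'_def)
      qed
      also have "\<dots> = (\<integral>\<^sup>+y. ennreal (w (norm y) / c) * g (sgn y, norm y) \<partial>Q)"
        by (simp add: int_J[symmetric] int_J')
      also have "\<dots> = (\<integral>\<^sup>+y. indicator B y \<partial>Q)"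
      proof (rule nn_integral_cong_AE, use AE_nz in eventually_elim)
        case (elim y)
        with w_pos[of "norm y"] c0 show ?case
          by (auto simp: g_def S_def norm_sgn sgn_div_norm indicator_def ennreal_mult[symmetric])
      qed
      finally show ?thesis by (simp add: sets_Q)
    qed
    have "polar_decomposition Q Qo Qr"
      unfolding polar_decomposition_def
    proof (intro conjI ballI)
      show "sets Qo = sets (restrict_space borel (sphere 0 1))"
        by (simp add: Qo_def S_def sets_restrict_space)
      show "finite_measure Qo" unfolding Qo_def
        by (rule finite_measure_restrict_space[OF M1.finite_measure_axioms]) simp
    qed (auto simp: sets_Qr Qr_sf Qr_pos em_Qr main)
    moreover have "(\<integral>\<^sup>+r. ennreal (w r) \<partial>Qr \<xi>) < \<infinity>" for \<xi>
    proof -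
      interpret prob_space "\<kappa>' \<xi>" by (rule \<kappa>'_prob)
      have "(\<integral>\<^sup>+r. ennreal (w r) \<partial>Qr \<xi>) = (\<integral>\<^sup>+r. ennreal (c / w r) * ennreal (w r) * indicator {0<..} r \<partial>\<kappa>' \<xi>)"
        by (rule int_Qr) measurable
      also have "\<dots> \<le> (\<integral>\<^sup>+r. ennreal c \<partial>\<kappa>' \<xi>)"
      proof (rule nn_integral_mono_AE, use AE_\<kappa>'[of \<xi>] in eventually_elim)
        case (elim r)
        with w_pos[of r] c0 have "ennreal (c / w r) * ennreal (w r) = ennreal c"
          by (simp add: ennreal_mult[symmetric])
        then show ?case by (simp add: indicator_def)
      qed
      also have "\<dots> < \<infinity>" using emeasure_space_1 by simp
      finally show ?thesis .
    qed
    ultimately show ?thesis by blast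
  qed
qed

text \<open>An arbitrary decomposition is fixed, not the one constructed above, because the tails
  use whichever one the choice operator returns. The weight is a parameter so that both choices,
  \<open>levy_polar\<close> and \<open>levy_polar2\<close>, are instances.\<close>

locale polar =
  fixes Q :: "(real^'d::finite) measure" and Qo Qr and w :: "real \<Rightarrow> real"
  assumes polar: "polar_decomposition Q Qo Qr"
    and sets_Q[measurable_cong]: "sets Q = sets borel"
    and w_measurable[measurable]: "w \<in> borel_measurable borel" and w_pos: "\<And>r. 0 < r \<Longrightarrow> 0 < w r"
    and w_integrable: "\<And>\<xi>. \<xi> \<in> sphere 0 1 \<Longrightarrow> (\<integral>\<^sup>+r. ennreal (w r) \<partial>Qr \<xi>) < \<infinity>"
begin

abbreviation "S \<equiv> restrict_space borel (sphere 0 1 :: (real^'d) set)"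
abbreviation "R \<equiv> restrict_space borel {0::real<..}"

lemma space_S: "space S = sphere 0 1" and space_R: "space R = {0<..}"
  by (simp_all add: space_restrict_space)

lemma sets_Qo[measurable_cong, simp]: "sets Qo = sets S"
  and sets_Qr: "\<xi> \<in> sphere 0 1 \<Longrightarrow> sets (Qr \<xi>) = sets R"
  and Qr_sigma_finite: "\<xi> \<in> sphere 0 1 \<Longrightarrow> sigma_finite_measure (Qr \<xi>)"
  and Qr_pos: "\<xi> \<in> sphere 0 1 \<Longrightarrow> 0 < emeasure (Qr \<xi>) {0<..}"
  and Qr_emeasure[measurable]: "A \<in> sets R \<Longrightarrow> (\<lambda>\<xi>. emeasure (Qr \<xi>) A) \<in> borel_measurable S"
  and emeasure_Q: "B \<in> sets borel \<Longrightarrow> emeasure Q B = (\<integral>\<^sup>+\<xi>. (\<integral>\<^sup>+r. indicator B (r *\<^sub>R \<xi>) \<partial>Qr \<xi>) \<partial>Qo)"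
  using polar unfolding polar_decomposition_def by auto

lemma space_Qo[simp]: "space Qo = sphere 0 1"
  using sets_eq_imp_space_eq[OF sets_Qo] by (simp add: space_S)

lemma space_Qr[simp]: "\<xi> \<in> sphere 0 1 \<Longrightarrow> space (Qr \<xi>) = {0<..}"
  using sets_eq_imp_space_eq[OF sets_Qr] by (simp add: space_R)

lemma measurable_Qr: "\<xi> \<in> sphere 0 1 \<Longrightarrow> f \<in> borel_measurable borel \<Longrightarrow> f \<in> borel_measurable (Qr \<xi>)"
  by (subst measurable_cong_sets[OF sets_Qr refl]) (auto intro: measurable_restrict_space1)

text \<open>Extension from indicators by monotone classes. It treats integrands of the radius alone,
  in particular the normalising mass in \<open>kernel_measurable\<close>, where the direction is
  allowed to enter the integrand.\<close>

lemma nn_integral_Qr_measurable: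
  assumes "f \<in> borel_measurable R"
  shows "(\<lambda>\<xi>. \<integral>\<^sup>+r. f r \<partial>Qr \<xi>) \<in> borel_measurable S"
  using assms
proof (induct rule: borel_measurable_induct)
  case (cong f g)
  then have eq: "(\<integral>\<^sup>+r. f r \<partial>Qr \<xi>) = (\<integral>\<^sup>+r. g r \<partial>Qr \<xi>)" if "\<xi> \<in> space S" for \<xi>
    using that by (intro nn_integral_cong) (auto simp: space_S space_R)
  show ?case using cong by (subst measurable_cong[OF eq]) auto
next
  case (set A)
  then have eq: "(\<integral>\<^sup>+r. indicator A r \<partial>Qr \<xi>) = emeasure (Qr \<xi>) A" if "\<xi> \<in> space S" for \<xi>
    using that by (simp add: space_S sets_Qr)
  show ?case using set by (subst measurable_cong[OF eq]) auto
next
  case (mult u c)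
  then have eq: "(\<integral>\<^sup>+r. c * u r \<partial>Qr \<xi>) = c * (\<integral>\<^sup>+r. u r \<partial>Qr \<xi>)" if "\<xi> \<in> space S" for \<xi>
    using that by (intro nn_integral_cmult) (simp add: space_S measurable_cong_sets[OF sets_Qr refl])
  show ?case using mult by (subst measurable_cong[OF eq]) auto
next
  case (add u v)
  then have eq: "(\<integral>\<^sup>+r. v r + u r \<partial>Qr \<xi>) = (\<integral>\<^sup>+r. v r \<partial>Qr \<xi>) + (\<integral>\<^sup>+r. u r \<partial>Qr \<xi>)" if "\<xi> \<in> space S" for \<xi>
    using that by (intro nn_integral_add) (simp_all add: space_S measurable_cong_sets[OF sets_Qr refl])
  show ?case using add by (subst measurable_cong[OF eq]) auto
next
  case (seq U)
  then have eq: "(\<integral>\<^sup>+r. (SUP i. U i) r \<partial>Qr \<xi>) = (SUP i. \<integral>\<^sup>+r. U i r \<partial>Qr \<xi>)" if "\<xi> \<in> space S" for \<xi>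
    using that unfolding SUP_apply
    by (intro nn_integral_monotone_convergence_SUP) (simp_all add: space_S measurable_cong_sets[OF sets_Qr refl])
  show ?case using seq by (subst measurable_cong[OF eq]) auto
qed

text \<open>Joint measurability rests on the weight \<open>w\<close>: normalising \<open>w\<cdot>Qr \<xi>\<close> turns the radial parts,
  which need not be uniformly \<open>\<sigma>\<close>-finite, into a Markov kernel.\<close>

lemma kernel_measurable:
  assumes [measurable]: "g \<in> borel_measurable (borel \<Otimes>\<^sub>M borel)"
  shows "(\<lambda>\<xi>. \<integral>\<^sup>+r. g (\<xi>, r) \<partial>Qr \<xi>) \<in> borel_measurable S"
proof -
  define m where "m \<xi> = (\<integral>\<^sup>+r. ennreal (w r) \<partial>Qr \<xi>)" for \<xi>
  have wR[measurable]: "w \<in> borel_measurable R" by (rule measurable_restrict_space1) simp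
  have m[measurable]: "m \<in> borel_measurable S"
    unfolding m_def by (rule nn_integral_Qr_measurable) measurable
  have m_fin: "m \<xi> < \<infinity>" if "\<xi> \<in> sphere 0 1" for \<xi> using w_integrable[OF that] by (simp add: m_def)
  have m_pos: "m \<xi> \<noteq> 0" if \<xi>: "\<xi> \<in> sphere 0 1" for \<xi>
  proof
    assume "m \<xi> = 0"
    then have "AE r in Qr \<xi>. ennreal (w r) = 0"
      unfolding m_def by (subst (asm) nn_integral_0_iff_AE) (auto intro: measurable_Qr[OF \<xi>])
    moreover have "AE r in Qr \<xi>. 0 < r" using \<xi> by (intro AE_I2) auto
    ultimately have "AE r in Qr \<xi>. False"
      by eventually_elim (use w_pos in \<open>auto simp: ennreal_eq_0_iff not_le[symmetric]\<close>)
    then have "emeasure (Qr \<xi>) (space (Qr \<xi>)) = 0" by (simp add: AE_iff_null null_sets_def)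
    with Qr_pos[OF \<xi>] \<xi> show False by simp
  qed
  define N where "N \<xi> = density (Qr \<xi>) (\<lambda>r. ennreal (w r) / m \<xi>)" for \<xi>
  have N[measurable]: "N \<in> S \<rightarrow>\<^sub>M subprob_algebra R"
  proof (rule measurable_subprob_algebra)
    fix \<xi> assume "\<xi> \<in> space S"
    then have \<xi>: "\<xi> \<in> sphere 0 1" by (simp add: space_S)
    show "sets (N \<xi>) = sets R" using \<xi> by (simp add: N_def sets_Qr)
    have [measurable]: "w \<in> borel_measurable (Qr \<xi>)" by (rule measurable_Qr[OF \<xi>]) simp
    show "subprob_space (N \<xi>)"
    proof
      have "emeasure (N \<xi>) (space (N \<xi>)) = (\<integral>\<^sup>+r. ennreal (w r) / m \<xi> \<partial>Qr \<xi>)"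
        unfolding N_def by (simp add: emeasure_density cong: nn_integral_cong)
      also have "\<dots> = m \<xi> / m \<xi>" unfolding m_def by (rule nn_integral_divide) simp
      also have "\<dots> \<le> 1" using m_pos[OF \<xi>] m_fin[OF \<xi>] by (simp add: ennreal_divide_self)
      finally show "emeasure (N \<xi>) (space (N \<xi>)) \<le> 1" .
      show "space (N \<xi>) \<noteq> {}" using \<xi> by (simp add: N_def)
    qed
  next
    fix A assume A[measurable]: "A \<in> sets R"
    have eq: "emeasure (N \<xi>) A = (\<integral>\<^sup>+r. ennreal (w r) * indicator A r \<partial>Qr \<xi>) / m \<xi>" if "\<xi> \<in> space S" for \<xi>
    proof -
      from that have \<xi>: "\<xi> \<in> sphere 0 1" by (simp add: space_S)
      have [measurable]: "w \<in> borel_measurable (Qr \<xi>)" "A \<in> sets (Qr \<xi>)"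
        using A by (auto simp: sets_Qr[OF \<xi>] intro!: measurable_Qr[OF \<xi>])
      have "emeasure (N \<xi>) A = (\<integral>\<^sup>+r. ennreal (w r) * indicator A r / m \<xi> \<partial>Qr \<xi>)"
        unfolding N_def by (auto simp: emeasure_density indicator_def intro!: nn_integral_cong)
      then show ?thesis by (simp add: nn_integral_divide)
    qed
    have "(\<lambda>\<xi>. (\<integral>\<^sup>+r. ennreal (w r) * indicator A r \<partial>Qr \<xi>) / m \<xi>) \<in> borel_measurable S"
      by (intro borel_measurable_divide_ennreal m nn_integral_Qr_measurable) measurable
    then show "(\<lambda>\<xi>. emeasure (N \<xi>) A) \<in> borel_measurable S"
      by (subst measurable_cong[OF eq])
  qed
  have [measurable]: "(\<lambda>p. p) \<in> S \<Otimes>\<^sub>M R \<rightarrow>\<^sub>M borel \<Otimes>\<^sub>M borel"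
    by (rule measurable_pair) (auto intro!: measurable_restrict_space1 measurable_fst'' measurable_snd'' simp: comp_def)
  have gSR[measurable]: "(\<lambda>p. g p) \<in> borel_measurable (S \<Otimes>\<^sub>M R)"
    by (rule measurable_compose[of "\<lambda>p. p" _ "borel \<Otimes>\<^sub>M borel"]) simp_all
  \<comment> \<open>The normalisation is undone: 1/w cancels \<open>w\<close> because radii are
    positive, and m/m = 1 because \<open>m\<close> is neither 0 (positive radial mass) nor infinite
    (\<open>w_integrable\<close>).\<close>
  have eq: "(\<integral>\<^sup>+r. g (\<xi>, r) \<partial>Qr \<xi>) = m \<xi> * (\<integral>\<^sup>+r. g (\<xi>, r) * ennreal (1 / w r) \<partial>N \<xi>)" if "\<xi> \<in> space S" for \<xi>
  proof -
    from that have \<xi>: "\<xi> \<in> sphere 0 1" by (simp add: space_S)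
    have [measurable]: "w \<in> borel_measurable (Qr \<xi>)" "(\<lambda>r. g (\<xi>, r)) \<in> borel_measurable (Qr \<xi>)"
      by (auto intro!: measurable_Qr[OF \<xi>])
    have "m \<xi> * (\<integral>\<^sup>+r. g (\<xi>, r) * ennreal (1 / w r) \<partial>N \<xi>)
        = (\<integral>\<^sup>+r. m \<xi> * (ennreal (w r) / m \<xi> * (g (\<xi>, r) * ennreal (1 / w r))) \<partial>Qr \<xi>)"
      unfolding N_def by (subst nn_integral_density) (simp_all add: nn_integral_cmult)
    also have "\<dots> = (\<integral>\<^sup>+r. g (\<xi>, r) \<partial>Qr \<xi>)"
    proof (rule nn_integral_cong)
      fix r assume "r \<in> space (Qr \<xi>)"
      with \<xi> have w: "0 < w r" by (simp add: w_pos)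
      have "m \<xi> * (ennreal (w r) / m \<xi> * (g (\<xi>, r) * ennreal (1 / w r))) =
         (m \<xi> / m \<xi>) * (ennreal (w r) * ennreal (1 / w r)) * g (\<xi>, r)"
        by (simp add: divide_ennreal_def ac_simps)
      also have "ennreal (w r) * ennreal (1 / w r) = 1" using w by (simp add: ennreal_mult[symmetric])
      also have "m \<xi> / m \<xi> = 1" using m_pos[OF \<xi>] m_fin[OF \<xi>] by (simp add: ennreal_divide_self)
      finally show "m \<xi> * (ennreal (w r) / m \<xi> * (g (\<xi>, r) * ennreal (1 / w r))) = g (\<xi>, r)" by simp
    qed
    finally show ?thesis by simp
  qed
  have "(\<lambda>\<xi>. m \<xi> * (\<integral>\<^sup>+r. g (\<xi>, r) * ennreal (1 / w r) \<partial>N \<xi>)) \<in> borel_measurable S"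
  proof (intro borel_measurable_times_ennreal m)
    show "(\<lambda>\<xi>. \<integral>\<^sup>+r. g (\<xi>, r) * ennreal (1 / w r) \<partial>N \<xi>) \<in> borel_measurable S"
      by (rule nn_integral_measurable_subprob_algebra2[where N=R]) measurable
  qed
  then show ?thesis by (subst measurable_cong[OF eq])
qed

lemma kernel_measurable':
  assumes [measurable]: "g \<in> borel_measurable borel"
  shows "(\<lambda>\<xi>. \<integral>\<^sup>+r. g (r *\<^sub>R \<xi>) \<partial>Qr \<xi>) \<in> borel_measurable Qo"
  using kernel_measurable[of "\<lambda>p. g (snd p *\<^sub>R fst p)"] by simp

lemma nn_integral_Q:
  assumes "g \<in> borel_measurable borel"
  shows "(\<integral>\<^sup>+y. g y \<partial>Q) = (\<integral>\<^sup>+\<xi>. (\<integral>\<^sup>+r. g (r *\<^sub>R \<xi>) \<partial>Qr \<xi>) \<partial>Qo)"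
  using assms
proof (induct rule: borel_measurable_induct)
  case (cong f g) then show ?case by simp
next
  case (set A) then show ?case by (simp add: emeasure_Q sets_Q)
next
  case (mult u c)
  have [measurable]: "u \<in> borel_measurable borel" by fact
  have "(\<integral>\<^sup>+\<xi>. (\<integral>\<^sup>+r. c * u (r *\<^sub>R \<xi>) \<partial>Qr \<xi>) \<partial>Qo) = (\<integral>\<^sup>+\<xi>. c * (\<integral>\<^sup>+r. u (r *\<^sub>R \<xi>) \<partial>Qr \<xi>) \<partial>Qo)"
    by (intro nn_integral_cong nn_integral_cmult measurable_Qr) (simp, measurable)
  also have "\<dots> = c * (\<integral>\<^sup>+\<xi>. (\<integral>\<^sup>+r. u (r *\<^sub>R \<xi>) \<partial>Qr \<xi>) \<partial>Qo)"
    by (intro nn_integral_cmult kernel_measurable') simp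
  finally show ?case using mult by (simp add: nn_integral_cmult)
next
  case (add u v)
  have [measurable]: "u \<in> borel_measurable borel" "v \<in> borel_measurable borel" by fact+
  have "(\<integral>\<^sup>+\<xi>. (\<integral>\<^sup>+r. v (r *\<^sub>R \<xi>) + u (r *\<^sub>R \<xi>) \<partial>Qr \<xi>) \<partial>Qo) =
      (\<integral>\<^sup>+\<xi>. (\<integral>\<^sup>+r. v (r *\<^sub>R \<xi>) \<partial>Qr \<xi>) + (\<integral>\<^sup>+r. u (r *\<^sub>R \<xi>) \<partial>Qr \<xi>) \<partial>Qo)"
    by (intro nn_integral_cong nn_integral_add measurable_Qr) simp_all
  also have "\<dots> = (\<integral>\<^sup>+\<xi>. (\<integral>\<^sup>+r. v (r *\<^sub>R \<xi>) \<partial>Qr \<xi>) \<partial>Qo) + (\<integral>\<^sup>+\<xi>. (\<integral>\<^sup>+r. u (r *\<^sub>R \<xi>) \<partial>Qr \<xi>) \<partial>Qo)"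
    by (intro nn_integral_add kernel_measurable') simp_all
  finally show ?case using add by (simp add: nn_integral_add)
next
  case (seq U)
  note [measurable] = seq(1)
  have mono: "incseq (\<lambda>i. U i (x :: real^'d))" for x using \<open>incseq U\<close> by (auto simp: incseq_def le_fun_def)
  have "(\<integral>\<^sup>+\<xi>. (\<integral>\<^sup>+r. (SUP i. U i (r *\<^sub>R \<xi>)) \<partial>Qr \<xi>) \<partial>Qo) =
      (\<integral>\<^sup>+\<xi>. (SUP i. \<integral>\<^sup>+r. U i (r *\<^sub>R \<xi>) \<partial>Qr \<xi>) \<partial>Qo)"
    using mono by (intro nn_integral_cong nn_integral_monotone_convergence_SUP measurable_Qr)
      (auto simp: incseq_def le_fun_def)
  also have "\<dots> = (SUP i. \<integral>\<^sup>+\<xi>. (\<integral>\<^sup>+r. U i (r *\<^sub>R \<xi>) \<partial>Qr \<xi>) \<partial>Qo)"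
    using mono by (intro nn_integral_monotone_convergence_SUP kernel_measurable')
      (auto simp: incseq_def le_fun_def intro!: nn_integral_mono)
  finally have "(\<integral>\<^sup>+\<xi>. (\<integral>\<^sup>+r. (SUP i. U i (r *\<^sub>R \<xi>)) \<partial>Qr \<xi>) \<partial>Qo) = (SUP i. \<integral>\<^sup>+y. U i y \<partial>Q)"
    using seq by simp
  moreover have "(SUP i. \<integral>\<^sup>+y. U i y \<partial>Q) = (\<integral>\<^sup>+y. (SUP i. U i y) \<partial>Q)"
    using mono by (intro nn_integral_monotone_convergence_SUP[symmetric])
      (auto simp: incseq_def le_fun_def measurable_cong_sets[OF sets_Q refl])
  ultimately show ?case by (simp add: SUP_apply image_comp)
qed

end

text \<open>The common shape of both tails: a jump \<open>y\<close> spreads mass with density k(|y|,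
  z) dz over the segment from 0 to \<open>y\<close>. Taking k = 1 yields the integrated tail and
  k(r, z) = r - z the double-integrated one, with no reference to a polar decomposition.\<close>

definition radial_integral :: "(real \<Rightarrow> real \<Rightarrow> ennreal) \<Rightarrow> (real^'d::finite \<Rightarrow> ennreal) \<Rightarrow> real^'d \<Rightarrow> ennreal" where
  "radial_integral k g y = (\<integral>\<^sup>+z\<in>{0<..<norm y}. k (norm y) z * g (z *\<^sub>R sgn y) \<partial>lborel)"

lemma radial_integrand_measurable:
  fixes k :: "real \<Rightarrow> real \<Rightarrow> ennreal"
  assumes [measurable]: "case_prod k \<in> borel_measurable (borel \<Otimes>\<^sub>M borel)" "g \<in> borel_measurable borel"
  shows "(\<lambda>(y :: real^'d::finite, z). k (norm y) z * g (z *\<^sub>R sgn y) * indicator {0<..<norm y} z)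
    \<in> borel_measurable (borel \<Otimes>\<^sub>M borel)"
proof -
  have k: "(\<lambda>p :: (real^'d) \<times> real. k (norm (fst p)) (snd p)) \<in> borel_measurable (borel \<Otimes>\<^sub>M borel)"
    using measurable_compose[of "\<lambda>p :: (real^'d) \<times> real. (norm (fst p), snd p)", OF _ assms(1)] by simp
  have "(\<lambda>p :: (real^'d) \<times> real. k (norm (fst p)) (snd p) * g (snd p *\<^sub>R sgn (fst p)) *
      indicator {p. 0 < snd p \<and> snd p < norm (fst p)} p) \<in> borel_measurable (borel \<Otimes>\<^sub>M borel)"
    by (intro borel_measurable_times_ennreal k) measurable
  then show ?thesis
    by (rule measurable_cong[THEN iffD1, rotated]) (auto simp: indicator_def)
qed

lemma radial_integral_measurable:
  assumes "case_prod k \<in> borel_measurable (borel \<Otimes>\<^sub>M borel)" "g \<in> borel_measurable borel"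
  shows "radial_integral k g \<in> borel_measurable borel"
  unfolding radial_integral_def[abs_def]
  by (rule lborel.borel_measurable_nn_integral) (use radial_integrand_measurable[OF assms] in measurable)

section \<open>Integrated tails\<close>

context polar
begin

text \<open>On a single ray both measures are sigma-finite, so Tonelli applies although the radial
  parts need not be uniformly sigma-finite across directions.\<close>

lemma Fubini_ray:
  assumes \<xi>: "\<xi> \<in> sphere 0 1" and g: "case_prod g \<in> borel_measurable (borel \<Otimes>\<^sub>M borel)"
  shows "(\<integral>\<^sup>+z. (\<integral>\<^sup>+r. g z r \<partial>Qr \<xi>) \<partial>lborel) = (\<integral>\<^sup>+r. (\<integral>\<^sup>+z. g z r \<partial>lborel) \<partial>Qr \<xi>)"
proof -
  interpret Qr: sigma_finite_measure "Qr \<xi>" by (rule Qr_sigma_finite[OF \<xi>])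
  interpret pair_sigma_finite lborel "Qr \<xi>" ..
  have "(\<lambda>r. r) \<in> borel_measurable (Qr \<xi>)" by (rule measurable_Qr[OF \<xi>]) simp
  then have "(\<lambda>p. (fst p, snd p)) \<in> lborel \<Otimes>\<^sub>M Qr \<xi> \<rightarrow>\<^sub>M borel \<Otimes>\<^sub>M borel"
    by (intro measurable_Pair) (auto intro: measurable_compose[OF measurable_snd] measurable_compose[OF measurable_fst])
  from measurable_compose[OF this g] have "case_prod g \<in> borel_measurable (lborel \<Otimes>\<^sub>M Qr \<xi>)"
    by (simp add: case_prod_beta')
  from Fubini'[OF this] show ?thesis by simp
qed

lemma radial_integral_ray:
  assumes "\<xi> \<in> sphere 0 1" "0 < r"
  shows "radial_integral k g (r *\<^sub>R \<xi>) = (\<integral>\<^sup>+z\<in>{0<..<r}. k r z * g (z *\<^sub>R \<xi>) \<partial>lborel)"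
  using assms by (simp add: radial_integral_def sgn_div_norm)

lemma nn_integral_radial:
  assumes "case_prod k \<in> borel_measurable (borel \<Otimes>\<^sub>M borel)" "g \<in> borel_measurable borel"
  shows "(\<integral>\<^sup>+y. radial_integral k g y \<partial>Q) = (\<integral>\<^sup>+\<xi>. (\<integral>\<^sup>+r. (\<integral>\<^sup>+z\<in>{0<..<r}. k r z * g (z *\<^sub>R \<xi>) \<partial>lborel) \<partial>Qr \<xi>) \<partial>Qo)"
  unfolding nn_integral_Q[OF radial_integral_measurable[OF assms]]
  by (intro nn_integral_cong) (simp add: radial_integral_ray)

text \<open>The bound 0 \<le> z keeps the half-line inside (0, infinity); otherwise it is not a
  measurable set of the radial space and \<open>emeasure\<close> returns the default value
  0.\<close>

lemma emeasure_Qr_tail: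
  assumes \<xi>: "\<xi> \<in> sphere 0 1" and "0 \<le> z"
  shows "emeasure (Qr \<xi>) {z<..} = (\<integral>\<^sup>+r. indicator {z<..} r \<partial>Qr \<xi>)"
proof -
  have "{z<..} \<in> sets R"
    using \<open>0 \<le> z\<close> by (auto simp: sets_restrict_space image_iff intro!: bexI[of _ "{z<..}"])
  then show ?thesis by (simp add: sets_Qr[OF \<xi>])
qed

text \<open>Writing the tail mass beyond \<open>z\<close> as an integral of the indicator of z < r
  and swapping the order leaves, for each radius \<open>r\<close>, Lebesgue measure on (0,
  r).\<close>

lemma single_tail:
  assumes [measurable]: "B \<in> sets borel"
  shows "(\<integral>\<^sup>+\<xi>. (\<integral>\<^sup>+z\<in>{0<..}. indicator B (z *\<^sub>R \<xi>) * emeasure (Qr \<xi>) {z<..} \<partial>lborel) \<partial>Qo)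
    = (\<integral>\<^sup>+y. radial_integral (\<lambda>_ _. 1) (indicator B) y \<partial>Q)"
proof -
  have "(\<integral>\<^sup>+z\<in>{0<..}. indicator B (z *\<^sub>R \<xi>) * emeasure (Qr \<xi>) {z<..} \<partial>lborel)
      = (\<integral>\<^sup>+r. (\<integral>\<^sup>+z\<in>{0<..<r}. 1 * indicator B (z *\<^sub>R \<xi>) \<partial>lborel) \<partial>Qr \<xi>)" if \<xi>: "\<xi> \<in> sphere 0 1" for \<xi>
  proof -
    have "(\<integral>\<^sup>+z\<in>{0<..}. indicator B (z *\<^sub>R \<xi>) * emeasure (Qr \<xi>) {z<..} \<partial>lborel)
        = (\<integral>\<^sup>+z. (\<integral>\<^sup>+r. indicator B (z *\<^sub>R \<xi>) * indicator {p. 0 < fst p \<and> fst p < snd p} (z, r) \<partial>Qr \<xi>) \<partial>lborel)"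
    proof (intro nn_integral_cong)
      fix z :: real
      show "indicator B (z *\<^sub>R \<xi>) * emeasure (Qr \<xi>) {z<..} * indicator {0<..} z =
        (\<integral>\<^sup>+r. indicator B (z *\<^sub>R \<xi>) * indicator {p. 0 < fst p \<and> fst p < snd p} (z, r) \<partial>Qr \<xi>)"
        by (cases "0 < z") (auto simp: emeasure_Qr_tail[OF \<xi>] indicator_def)
    qed
    also have "\<dots> = (\<integral>\<^sup>+r. (\<integral>\<^sup>+z. indicator B (z *\<^sub>R \<xi>) * indicator {p. 0 < fst p \<and> fst p < snd p} (z, r) \<partial>lborel) \<partial>Qr \<xi>)"
      by (rule Fubini_ray[OF \<xi>]) measurable
    also have "\<dots> = (\<integral>\<^sup>+r. (\<integral>\<^sup>+z\<in>{0<..<r}. 1 * indicator B (z *\<^sub>R \<xi>) \<partial>lborel) \<partial>Qr \<xi>)"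
      by (intro nn_integral_cong) (auto simp: indicator_def)
    finally show ?thesis .
  qed
  then show ?thesis
    by (subst nn_integral_radial) (auto intro!: nn_integral_cong)
qed

text \<open>One further integration in z1 replaces the weight 1 by the length r - z2 of the interval
  between z2 and \<open>r\<close>.\<close>

lemma double_tail:
  assumes [measurable]: "B \<in> sets borel"
  shows "(\<integral>\<^sup>+\<xi>. (\<integral>\<^sup>+z\<^sub>2\<in>{0<..}. indicator B (z\<^sub>2 *\<^sub>R \<xi>) *
         (\<integral>\<^sup>+z\<^sub>1\<in>{z\<^sub>2<..}. emeasure (Qr \<xi>) {z\<^sub>1<..} \<partial>lborel) \<partial>lborel) \<partial>Qo)
    = (\<integral>\<^sup>+y. radial_integral (\<lambda>r z. ennreal (r - z)) (indicator B) y \<partial>Q)"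
proof -
  \<comment> \<open>Integrating the tail function gives the mean excess over z2. No indicator of z2
    < r appears because \<open>ennreal\<close> sends negative numbers to 0.\<close>
  have inner: "(\<integral>\<^sup>+z\<^sub>1\<in>{z\<^sub>2<..}. emeasure (Qr \<xi>) {z\<^sub>1<..} \<partial>lborel) = (\<integral>\<^sup>+r. ennreal (r - z\<^sub>2) \<partial>Qr \<xi>)"
    if \<xi>: "\<xi> \<in> sphere 0 1" and z2: "0 < z\<^sub>2" for \<xi> z\<^sub>2
  proof -
    have "(\<integral>\<^sup>+z\<^sub>1\<in>{z\<^sub>2<..}. emeasure (Qr \<xi>) {z\<^sub>1<..} \<partial>lborel)
        = (\<integral>\<^sup>+z. (\<integral>\<^sup>+r. indicator {p. z\<^sub>2 < fst p \<and> fst p < snd p} (z, r) \<partial>Qr \<xi>) \<partial>lborel)"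
    proof (intro nn_integral_cong)
      fix z :: real
      show "emeasure (Qr \<xi>) {z<..} * indicator {z\<^sub>2<..} z =
        (\<integral>\<^sup>+r. indicator {p. z\<^sub>2 < fst p \<and> fst p < snd p} (z, r) \<partial>Qr \<xi>)"
        using z2 by (cases "z\<^sub>2 < z") (auto simp: emeasure_Qr_tail[OF \<xi>] indicator_def)
    qed
    also have "\<dots> = (\<integral>\<^sup>+r. (\<integral>\<^sup>+z. indicator {p. z\<^sub>2 < fst p \<and> fst p < snd p} (z, r) \<partial>lborel) \<partial>Qr \<xi>)"
      by (rule Fubini_ray[OF \<xi>]) measurable
    also have "\<dots> = (\<integral>\<^sup>+r. ennreal (r - z\<^sub>2) \<partial>Qr \<xi>)"
    proof (intro nn_integral_cong)
      fix r
      have "(\<integral>\<^sup>+z. indicator {p. z\<^sub>2 < fst p \<and> fst p < snd p} (z, r) \<partial>lborel) = (\<integral>\<^sup>+z. indicator {z\<^sub>2<..<r} z \<partial>lborel)"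
        by (intro nn_integral_cong) (auto simp: indicator_def)
      also have "\<dots> = emeasure lborel {z\<^sub>2<..<r}" by simp
      also have "\<dots> = ennreal (r - z\<^sub>2)" by (cases "z\<^sub>2 \<le> r") (auto simp: ennreal_neg)
      finally show "(\<integral>\<^sup>+z. indicator {p. z\<^sub>2 < fst p \<and> fst p < snd p} (z, r) \<partial>lborel) = ennreal (r - z\<^sub>2)" .
    qed
    finally show ?thesis .
  qed
  have "(\<integral>\<^sup>+z\<^sub>2\<in>{0<..}. indicator B (z\<^sub>2 *\<^sub>R \<xi>) * (\<integral>\<^sup>+z\<^sub>1\<in>{z\<^sub>2<..}. emeasure (Qr \<xi>) {z\<^sub>1<..} \<partial>lborel) \<partial>lborel)
      = (\<integral>\<^sup>+r. (\<integral>\<^sup>+z\<in>{0<..<r}. ennreal (r - z) * indicator B (z *\<^sub>R \<xi>) \<partial>lborel) \<partial>Qr \<xi>)" if \<xi>: "\<xi> \<in> sphere 0 1" for \<xi>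
  proof -
    have "(\<integral>\<^sup>+z\<^sub>2\<in>{0<..}. indicator B (z\<^sub>2 *\<^sub>R \<xi>) * (\<integral>\<^sup>+z\<^sub>1\<in>{z\<^sub>2<..}. emeasure (Qr \<xi>) {z\<^sub>1<..} \<partial>lborel) \<partial>lborel)
        = (\<integral>\<^sup>+z. (\<integral>\<^sup>+r. indicator B (z *\<^sub>R \<xi>) * (indicator {0<..} z * ennreal (r - z)) \<partial>Qr \<xi>) \<partial>lborel)"
    proof (intro nn_integral_cong)
      fix z :: real
      have [measurable]: "(\<lambda>r. ennreal (r - z)) \<in> borel_measurable (Qr \<xi>)" by (rule measurable_Qr[OF \<xi>]) measurable
      show "indicator B (z *\<^sub>R \<xi>) * (\<integral>\<^sup>+z\<^sub>1\<in>{z<..}. emeasure (Qr \<xi>) {z\<^sub>1<..} \<partial>lborel) * indicator {0<..} z =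
        (\<integral>\<^sup>+r. indicator B (z *\<^sub>R \<xi>) * (indicator {0<..} z * ennreal (r - z)) \<partial>Qr \<xi>)"
        by (cases "0 < z") (simp_all add: inner[OF \<xi>] nn_integral_cmult)
    qed
    also have "\<dots> = (\<integral>\<^sup>+r. (\<integral>\<^sup>+z. indicator B (z *\<^sub>R \<xi>) * (indicator {0<..} z * ennreal (r - z)) \<partial>lborel) \<partial>Qr \<xi>)"
      by (rule Fubini_ray[OF \<xi>]) measurable
    also have "\<dots> = (\<integral>\<^sup>+r. (\<integral>\<^sup>+z\<in>{0<..<r}. ennreal (r - z) * indicator B (z *\<^sub>R \<xi>) \<partial>lborel) \<partial>Qr \<xi>)"
      by (intro nn_integral_cong) (auto simp: indicator_def ennreal_neg)
    finally show ?thesis .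
  qed
  then show ?thesis
    by (subst nn_integral_radial) (auto intro!: nn_integral_cong)
qed

end

text \<open>\<open>measure_of\<close> silently yields the zero measure unless \<open>T\<close> is
  countably additive. That is obtained by pulling the sum through both integrals defining
  \<open>T\<close>; the formula then extends from indicators to all nonnegative
  \<open>g\<close>.\<close>

lemma nn_integral_measure_of_radial:
  fixes Q :: "(real^'d::finite) measure"
  assumes sets_Q[measurable_cong]: "sets Q = sets borel"
    and k: "case_prod k \<in> borel_measurable (borel \<Otimes>\<^sub>M borel)"
    and T: "\<And>B. B \<in> sets borel \<Longrightarrow> T B = (\<integral>\<^sup>+y. radial_integral k (indicator B) y \<partial>Q)"
    and g: "g \<in> borel_measurable borel"
  shows "(\<integral>\<^sup>+y. g y \<partial>measure_of UNIV (sets borel) T) = (\<integral>\<^sup>+y. radial_integral k g y \<partial>Q)"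
proof -
  let ?T = "measure_of UNIV (sets (borel :: (real^'d) measure)) T"
  have sets_T: "sets ?T = sets borel"    using sets.sets_measure_of_eq[of borel T] by simp
  have meas[measurable]: "radial_integral k g \<in> borel_measurable Q" if "g \<in> borel_measurable borel" for g
    using radial_integral_measurable[OF k that] by (simp add: measurable_cong_sets[OF sets_Q refl])
  have meas_in: "(\<lambda>z. k (norm y) z * g (z *\<^sub>R sgn y) * indicator {0<..<norm y} z) \<in> borel_measurable lborel"
    if "g \<in> borel_measurable borel" for g and y :: "real^'d"
    using measurable_compose[OF measurable_Pair1'[of y borel borel] radial_integrand_measurable[OF k that]] by simp
  have em: "emeasure ?T B = (\<integral>\<^sup>+y. radial_integral k (indicator B) y \<partial>Q)" if B: "B \<in> sets borel" for B
  proof -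
    have "emeasure ?T B = T B"
    proof (rule emeasure_measure_of[OF refl _ _ _])
      show "positive (sets ?T) T" by (auto simp: positive_def T radial_integral_def)
      show "countably_additive (sets ?T) T"
      proof (rule countably_additiveI, unfold sets_T)
        fix A :: "nat \<Rightarrow> (real^'d) set"
        assume A: "range A \<subseteq> sets borel" "disjoint_family A" "(\<Union>i. A i) \<in> sets borel"
        then have A'[measurable]: "A i \<in> sets borel" for i by auto
        have "(\<Sum>i. T (A i)) = (\<integral>\<^sup>+y. (\<Sum>i. radial_integral k (indicator (A i)) y) \<partial>Q)"
          by (subst nn_integral_suminf) (auto simp: T intro!: meas)
        also have "\<dots> = (\<integral>\<^sup>+y. radial_integral k (indicator (\<Union>i. A i)) y \<partial>Q)"
        proof (intro nn_integral_cong)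
          fix y
          have "(\<Sum>i. radial_integral k (indicator (A i)) y) =
              (\<integral>\<^sup>+z. (\<Sum>i. k (norm y) z * indicator (A i) (z *\<^sub>R sgn y) * indicator {0<..<norm y} z) \<partial>lborel)"
            unfolding radial_integral_def
            by (subst nn_integral_suminf) (auto intro!: meas_in[simplified] borel_measurable_indicator A')
          also have "\<dots> = radial_integral k (indicator (\<Union>i. A i)) y"
            unfolding radial_integral_def
            by (intro nn_integral_cong) (simp add: suminf_indicator[OF A(2), symmetric])
          finally show "(\<Sum>i. radial_integral k (indicator (A i)) y) = radial_integral k (indicator (\<Union>i. A i)) y" .
        qed
        also have "\<dots> = T (\<Union>i. A i)" using T[OF A(3)] by simp
        finally show "(\<Sum>i. T (A i)) = T (\<Union>i. A i)" .
      qed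
    qed (use B sets_T in auto)
    with T[OF B] show ?thesis by simp
  qed
  note [measurable_cong] = sets_T
  show ?thesis using g
  proof (induct rule: borel_measurable_induct)
    case (cong f g) then show ?case by simp
  next
    case (set A) then show ?case by (simp add: em sets_T)
  next
    case (mult u c)
    note [measurable] = \<open>u \<in> borel_measurable borel\<close>
    have "radial_integral k (\<lambda>x. c * u x) y = c * radial_integral k u y" for y
      unfolding radial_integral_def by (subst nn_integral_cmult[OF meas_in, symmetric]) (auto simp: ac_simps)
    then show ?case using mult by (simp add: nn_integral_cmult meas)
  next
    case (add u v)
    note [measurable] = \<open>u \<in> borel_measurable borel\<close> \<open>v \<in> borel_measurable borel\<close>
    have "radial_integral k (\<lambda>x. v x + u x) y = radial_integral k v y + radial_integral k u y" for y
      unfolding radial_integral_def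
      by (subst nn_integral_add[OF meas_in meas_in, symmetric]) (auto simp: distrib_left distrib_right)
    then show ?case using add by (simp add: nn_integral_add meas)
  next
    case (seq U)
    note [measurable] = seq(1)
    have mono: "U i x \<le> U j x" if "i \<le> j" for i j x using \<open>incseq U\<close> that by (auto simp: incseq_def le_fun_def)
    have "(\<integral>\<^sup>+y. (SUP i. U i y) \<partial>?T) = (SUP i. \<integral>\<^sup>+y. U i y \<partial>?T)"
      by (intro nn_integral_monotone_convergence_SUP) (auto simp: incseq_def le_fun_def mono)
    also have "\<dots> = (SUP i. \<integral>\<^sup>+y. radial_integral k (U i) y \<partial>Q)" using seq by simp
    also have "\<dots> = (\<integral>\<^sup>+y. (SUP i. radial_integral k (U i) y) \<partial>Q)"
      by (intro nn_integral_monotone_convergence_SUP[symmetric] meas seq(1))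
         (auto simp: incseq_def le_fun_def radial_integral_def intro!: nn_integral_mono mult_left_mono mult_right_mono mono)
    also have "\<dots> = (\<integral>\<^sup>+y. radial_integral k (\<lambda>x. SUP i. U i x) y \<partial>Q)"
    proof (intro nn_integral_cong)
      fix y
      have "radial_integral k (\<lambda>x. SUP i. U i x) y =
          (\<integral>\<^sup>+z. (SUP i. k (norm y) z * U i (z *\<^sub>R sgn y) * indicator {0<..<norm y} z) \<partial>lborel)"
        unfolding radial_integral_def
        by (intro nn_integral_cong) (auto simp: SUP_mult_left_ennreal SUP_mult_right_ennreal indicator_def)
      also have "\<dots> = (SUP i. radial_integral k (U i) y)"
        unfolding radial_integral_def
        by (intro nn_integral_monotone_convergence_SUP meas_in seq(1))
           (auto simp: incseq_def le_fun_def intro!: mult_left_mono mult_right_mono mono)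
      finally show "(SUP i. radial_integral k (U i) y) = radial_integral k (\<lambda>x. SUP i. U i x) y" ..
    qed
    finally show ?case by (simp add: SUP_apply image_comp)
  qed
qed

lemma sets_integrated_tail: "sets (integrated_tail Q) = sets borel"
  and sets_double_integrated_tail: "sets (double_integrated_tail Q) = sets borel"
  unfolding integrated_tail_def double_integrated_tail_def case_prod_beta
  using sets.sets_measure_of_eq[of borel] by simp_all

text \<open>The right-hand side depends on \<open>Q\<close> alone, so this also shows that the tail
  does not depend on the polar decomposition chosen.\<close>

lemma nn_integral_integrated_tail:
  assumes Q: "levy_measure Q" and g: "g \<in> borel_measurable borel"
  shows "(\<integral>\<^sup>+y. g y \<partial>integrated_tail Q) = (\<integral>\<^sup>+y. radial_integral (\<lambda>_ _. 1) g y \<partial>Q)"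
proof -
  obtain Qo Qr where lp: "levy_polar Q = (Qo, Qr)" by force
  have "\<exists>Q\<^sub>o Q\<^sub>r. polar_decomposition Q Q\<^sub>o Q\<^sub>r \<and>
     (\<forall>\<xi>\<in>sphere 0 1. (\<integral>\<^sup>+r. ennreal (min 1 (r\<^sup>2)) \<partial>Q\<^sub>r \<xi>) < \<infinity>)"
    \<comment> \<open>Existence is what makes the choice in \<open>levy_polar\<close> satisfy its
      specification; without it \<open>SOME\<close> would return an unknown pair.\<close>
    by (rule polar_decomposition_exists[where w="\<lambda>r. min 1 (r\<^sup>2)"]) (use Q in \<open>auto simp: levy_measure_def\<close>)
  then have "\<exists>p. case p of (Q\<^sub>o, Q\<^sub>r) \<Rightarrow> polar_decomposition Q Q\<^sub>o Q\<^sub>r \<and>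
     (\<forall>\<xi>\<in>sphere 0 1. (\<integral>\<^sup>+r. ennreal (min 1 (r\<^sup>2)) \<partial>Q\<^sub>r \<xi>) < \<infinity>)" by auto
  from someI_ex[OF this] lp have
    "polar_decomposition Q Qo Qr" "\<And>\<xi>. \<xi>\<in>sphere 0 1 \<Longrightarrow> (\<integral>\<^sup>+r. ennreal (min 1 (r\<^sup>2)) \<partial>Qr \<xi>) < \<infinity>"
    unfolding levy_polar_def by auto
  then interpret polar Q Qo Qr "\<lambda>r. min 1 (r\<^sup>2)"
  proof (unfold_locales, goal_cases)
    case 2 show ?case using Q by (simp add: levy_measure_def)
  next
    case 3 show ?case by measurable
  next
    case (4 r) from 4(3) show ?case by simp
  qed
  show ?thesis
    unfolding integrated_tail_def lp prod.case
  proof (rule nn_integral_measure_of_radial[OF sets_Q _ _ g])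
    show "case_prod (\<lambda>_ _. 1 :: ennreal) \<in> borel_measurable (borel \<Otimes>\<^sub>M borel)" by measurable
  qed (rule single_tail)
qed

text \<open>\<open>levy_polar2\<close> is specified with the weight min r r^2, so its existence
  statement rests on \<open>fin\<close>, which is stronger than the Levy condition for large
  jumps.\<close>

lemma nn_integral_double_integrated_tail:
  assumes Q: "levy_measure Q" and fin: "(\<integral>\<^sup>+y. ennreal (min (norm y) ((norm y)\<^sup>2)) \<partial>Q) < \<infinity>"
    and g: "g \<in> borel_measurable borel"
  shows "(\<integral>\<^sup>+y. g y \<partial>double_integrated_tail Q) = (\<integral>\<^sup>+y. radial_integral (\<lambda>r z. ennreal (r - z)) g y \<partial>Q)"
proof -
  have pos: "0 < min r (r\<^sup>2)" if "0 < r" for r :: real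
    using that zero_less_power[OF that, of 2] by (metis min_less_iff_conj)
  obtain Qo Qr where lp: "levy_polar2 Q = (Qo, Qr)" by force
  have "\<exists>Q\<^sub>o Q\<^sub>r. polar_decomposition Q Q\<^sub>o Q\<^sub>r \<and>
     (\<forall>\<xi>\<in>sphere 0 1. (\<integral>\<^sup>+r. ennreal (min r (r\<^sup>2)) \<partial>Q\<^sub>r \<xi>) < \<infinity>)"
  proof (rule polar_decomposition_exists[where w="\<lambda>r. min r (r\<^sup>2)"])
    show "sets Q = sets borel" "emeasure Q {0} = 0" using Q by (auto simp: levy_measure_def)
    show "(\<lambda>r::real. min r (r\<^sup>2)) \<in> borel_measurable borel" by measurable
    show "0 < min r (r\<^sup>2)" if "0 < r" for r :: real using that by (rule pos)
    show "(\<integral>\<^sup>+y. ennreal (min (norm y) ((norm y)\<^sup>2)) \<partial>Q) < \<infinity>" by (fact fin)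
  qed
  then have "\<exists>p. case p of (Q\<^sub>o, Q\<^sub>r) \<Rightarrow> polar_decomposition Q Q\<^sub>o Q\<^sub>r \<and>
     (\<forall>\<xi>\<in>sphere 0 1. (\<integral>\<^sup>+r. ennreal (min r (r\<^sup>2)) \<partial>Q\<^sub>r \<xi>) < \<infinity>)" by auto
  from someI_ex[OF this] lp have
    "polar_decomposition Q Qo Qr" "\<And>\<xi>. \<xi>\<in>sphere 0 1 \<Longrightarrow> (\<integral>\<^sup>+r. ennreal (min r (r\<^sup>2)) \<partial>Qr \<xi>) < \<infinity>"
    unfolding levy_polar2_def by auto
  then interpret polar Q Qo Qr "\<lambda>r. min r (r\<^sup>2)"
  proof (unfold_locales, goal_cases)
    case 2 show ?case using Q by (simp add: levy_measure_def)
  next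
    case 3 show ?case by measurable
  next
    case (4 r) show ?case by (rule pos[OF 4(3)])
  qed
  show ?thesis
    unfolding double_integrated_tail_def lp prod.case
  proof (rule nn_integral_measure_of_radial[OF sets_Q _ _ g])
    show "case_prod (\<lambda>r z. ennreal (r - z)) \<in> borel_measurable (borel \<Otimes>\<^sub>M borel)" by measurable
  qed (rule double_tail)
qed

text \<open>Positive and negative parts of \<open>G\<close> reduce the signed case to the formula
  for nonnegative functions. Finiteness of the total makes the radial integral of |G| finite for
  \<open>Q\<close>-almost every \<open>y\<close>, and for such \<open>y\<close> the difference of
  the two parts is the ordinary integral along the segment.\<close>

lemma integral_tail:
  fixes Q T :: "(real^'d::finite) measure" and \<kappa> :: "real \<Rightarrow> real \<Rightarrow> real" and G :: "real^'d \<Rightarrow> real"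
  assumes sets_Q[measurable_cong]: "sets Q = sets borel" and sets_T[measurable_cong]: "sets T = sets borel"
    and T: "\<And>g. g \<in> borel_measurable borel \<Longrightarrow> (\<integral>\<^sup>+y. g y \<partial>T) = (\<integral>\<^sup>+y. radial_integral (\<lambda>r z. ennreal (\<kappa> r z)) g y \<partial>Q)"
    and \<kappa>: "case_prod \<kappa> \<in> borel_measurable (borel \<Otimes>\<^sub>M borel)"
    and \<kappa>_nn: "\<And>r z. 0 < z \<Longrightarrow> z < r \<Longrightarrow> 0 \<le> \<kappa> r z"
    and G[measurable]: "G \<in> borel_measurable borel"
    and fin: "(\<integral>\<^sup>+y. radial_integral (\<lambda>r z. ennreal (\<kappa> r z)) (\<lambda>y. ennreal \<bar>G y\<bar>) y \<partial>Q) < \<infinity>"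
  shows "integrable T G"
    and "(LINT y|T. G y) = (LINT y|Q. (LINT z:{0<..<norm y}|lborel. \<kappa> (norm y) z * G (z *\<^sub>R sgn y)))"
proof -
  let ?k = "\<lambda>r z. ennreal (\<kappa> r z)"
  have k: "case_prod ?k \<in> borel_measurable (borel \<Otimes>\<^sub>M borel)"
    using measurable_compose[OF \<kappa> measurable_ennreal] by (simp add: case_prod_beta')
  show int: "integrable T G"
    using fin by (intro integrableI_bounded) (simp_all add: T)
  let ?P = "\<lambda>y. ennreal (G y)" and ?N = "\<lambda>y. ennreal (- G y)"
  have meas: "radial_integral ?k g \<in> borel_measurable Q" if "g \<in> borel_measurable borel" for g
    using radial_integral_measurable[OF k that] by (simp add: measurable_cong_sets[OF sets_Q refl])
  have le: "radial_integral ?k g y \<le> radial_integral ?k (\<lambda>y. ennreal \<bar>G y\<bar>) y" if "\<And>y. g y \<le> ennreal \<bar>G y\<bar>" for g y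
    unfolding radial_integral_def by (intro nn_integral_mono mult_right_mono mult_left_mono that) auto
  have finP: "(\<integral>\<^sup>+y. radial_integral ?k g y \<partial>Q) < \<infinity>" if "\<And>y. g y \<le> ennreal \<bar>G y\<bar>" for g
    using fin by (rule le_less_trans[rotated]) (intro nn_integral_mono le that)
  have AE_fin: "AE y in Q. radial_integral ?k (\<lambda>y. ennreal \<bar>G y\<bar>) y \<noteq> \<infinity>"
    using fin by (intro nn_integral_PInf_AE meas) auto
  have real_part: "enn2real (\<integral>\<^sup>+y. radial_integral ?k g y \<partial>Q) = (LINT y|Q. enn2real (radial_integral ?k g y))"
      "integrable Q (\<lambda>y. enn2real (radial_integral ?k g y))"
    if "\<And>y. g y \<le> ennreal \<bar>G y\<bar>" and g: "g \<in> borel_measurable borel" for g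
  proof -
    \<comment> \<open>\<open>enn2real\<close> sends infinity to 0, so the passage to real values is
      faithful only off the null set where the dominating radial integral is infinite.\<close>
    have "AE y in Q. ennreal (enn2real (radial_integral ?k g y)) = radial_integral ?k g y"
      using AE_fin
    proof eventually_elim
      case (elim y)
      with le[OF that(1), of y] show ?case by (intro ennreal_enn2real) (auto simp: less_top top_unique)
    qed
    then have *: "(\<integral>\<^sup>+y. ennreal (enn2real (radial_integral ?k g y)) \<partial>Q) = (\<integral>\<^sup>+y. radial_integral ?k g y \<partial>Q)"
      by (rule nn_integral_cong_AE)
    have m: "(\<lambda>y. enn2real (radial_integral ?k g y)) \<in> borel_measurable Q"
      using meas[OF g] by measurable
    show "integrable Q (\<lambda>y. enn2real (radial_integral ?k g y))"
      by (rule integrableI_nonneg) (use m * finP[OF that(1)] in auto)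
    show "enn2real (\<integral>\<^sup>+y. radial_integral ?k g y \<partial>Q) = (LINT y|Q. enn2real (radial_integral ?k g y))"
      by (subst integral_eq_nn_integral) (use m * in auto)
  qed
  have "(LINT y|T. G y) = enn2real (\<integral>\<^sup>+y. ?P y \<partial>T) - enn2real (\<integral>\<^sup>+y. ?N y \<partial>T)"
    by (rule real_lebesgue_integral_def[OF int])
  also have "\<dots> = enn2real (\<integral>\<^sup>+y. radial_integral ?k ?P y \<partial>Q) - enn2real (\<integral>\<^sup>+y. radial_integral ?k ?N y \<partial>Q)"
    by (simp add: T)
  also have "\<dots> = (LINT y|Q. enn2real (radial_integral ?k ?P y)) - (LINT y|Q. enn2real (radial_integral ?k ?N y))"
    by (subst (1 2) real_part) (auto intro: ennreal_leI)
  also have "\<dots> = (LINT y|Q. enn2real (radial_integral ?k ?P y) - enn2real (radial_integral ?k ?N y))"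
    by (rule Bochner_Integration.integral_diff[symmetric]) (auto intro!: real_part ennreal_leI)
  also have "\<dots> = (LINT y|Q. (LINT z:{0<..<norm y}|lborel. \<kappa> (norm y) z * G (z *\<^sub>R sgn y)))"
  proof (rule integral_cong_AE)
    have "(\<lambda>(y::real^'d, z). indicator {0<..<norm y} z *\<^sub>R (\<kappa> (norm y) z * G (z *\<^sub>R sgn y))) \<in> borel_measurable (borel \<Otimes>\<^sub>M borel)"
    proof -
      have k': "(\<lambda>p :: (real^'d) \<times> real. \<kappa> (norm (fst p)) (snd p)) \<in> borel_measurable (borel \<Otimes>\<^sub>M borel)"
        using measurable_compose[of "\<lambda>p :: (real^'d) \<times> real. (norm (fst p), snd p)", OF _ \<kappa>] by simp
      have "(\<lambda>p :: (real^'d) \<times> real. (\<kappa> (norm (fst p)) (snd p) * G (snd p *\<^sub>R sgn (fst p))) *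
          indicator {p. 0 < snd p \<and> snd p < norm (fst p)} p) \<in> borel_measurable (borel \<Otimes>\<^sub>M borel)"
        by (intro borel_measurable_times k') measurable
      then show ?thesis
        by (rule measurable_cong[THEN iffD1, rotated]) (auto simp: indicator_def)
    qed
    then have "(\<lambda>y::real^'d. LINT z:{0<..<norm y}|lborel. \<kappa> (norm y) z * G (z *\<^sub>R sgn y)) \<in> borel_measurable borel"
      unfolding set_lebesgue_integral_def
      by (intro lborel.borel_measurable_lebesgue_integral) (simp add: measurable_cong_sets[OF sets_pair_measure_cong[OF refl sets_lborel] refl])
    then show "(\<lambda>y::real^'d. LINT z:{0<..<norm y}|lborel. \<kappa> (norm y) z * G (z *\<^sub>R sgn y)) \<in> borel_measurable Q"
      by (simp add: measurable_cong_sets[OF sets_Q refl])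
    show "(\<lambda>y. enn2real (radial_integral ?k ?P y) - enn2real (radial_integral ?k ?N y)) \<in> borel_measurable Q"
      using meas[of ?P] meas[of ?N] by measurable
    show "AE y in Q. enn2real (radial_integral ?k ?P y) - enn2real (radial_integral ?k ?N y) =
      (LINT z:{0<..<norm y}|lborel. \<kappa> (norm y) z * G (z *\<^sub>R sgn y))"
      using AE_fin
    proof eventually_elim
      case (elim y)
      let ?h = "\<lambda>z. indicator {0<..<norm y} z *\<^sub>R (\<kappa> (norm y) z * G (z *\<^sub>R sgn y))"
      have m: "?h \<in> borel_measurable lborel"
        using measurable_compose[OF measurable_Pair1'[of "norm y" borel borel] \<kappa>] by simp
      have "integrable lborel ?h"
      proof (rule integrableI_bounded[OF m])
        have "(\<integral>\<^sup>+z. ennreal (norm (?h z)) \<partial>lborel) = radial_integral ?k (\<lambda>y. ennreal \<bar>G y\<bar>) y"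
          unfolding radial_integral_def
          by (intro nn_integral_cong) (auto simp: indicator_def abs_mult ennreal_mult \<kappa>_nn)
        with elim show "(\<integral>\<^sup>+z. ennreal (norm (?h z)) \<partial>lborel) < \<infinity>" by (simp add: less_top)
      qed
      then have "(LINT z|lborel. ?h z) = enn2real (\<integral>\<^sup>+z. ennreal (?h z) \<partial>lborel) - enn2real (\<integral>\<^sup>+z. ennreal (- ?h z) \<partial>lborel)"
        by (rule real_lebesgue_integral_def)
      also have "(\<integral>\<^sup>+z. ennreal (?h z) \<partial>lborel) = radial_integral ?k ?P y"
        unfolding radial_integral_def
        by (intro nn_integral_cong) (auto simp: indicator_def ennreal_mult' \<kappa>_nn)
      also have "(\<integral>\<^sup>+z. ennreal (- ?h z) \<partial>lborel) = radial_integral ?k ?N y"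
        unfolding radial_integral_def
        by (intro nn_integral_cong) (auto simp: indicator_def ennreal_mult'[symmetric] \<kappa>_nn)
      finally show ?case unfolding set_lebesgue_integral_def by simp
    qed
  qed
  finally show "(LINT y|T. G y) = (LINT y|Q. (LINT z:{0<..<norm y}|lborel. \<kappa> (norm y) z * G (z *\<^sub>R sgn y)))" .
qed

section \<open>Taylor expansion along rays\<close>

lemma partials_partial: "partials is (partial i f) = partials (is @ [i]) f"
  by (simp add: partials_def)

lemma smooth_partial: "smooth f \<Longrightarrow> smooth (partial i f)"
  unfolding smooth_def by (simp add: partials_partial)

text \<open>Off the closed set \<open>supp f\<close> the function vanishes on a whole ball, hence
  along a short piece of every coordinate line.\<close>

lemma supp_partial: "supp (partial i f) \<subseteq> supp f"
proof -
  have "x \<in> supp f" if "partial i f x \<noteq> 0" for x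
  proof (rule ccontr)
    assume "x \<notin> supp f"
    moreover have "open (- supp f)" by (simp add: supp_def open_Compl)
    ultimately obtain e where e: "0 < e" "ball x e \<subseteq> - supp f" by (meson ComplI openE)
    have f0: "f y = 0" if "dist y x < e" for y
    proof -
      from that e(2) have "y \<notin> supp f" by (auto simp: dist_commute)
      then show ?thesis using closure_subset[of "{x. f x \<noteq> 0}"] by (auto simp: supp_def)
    qed
    have "((\<lambda>t. f (x + t *\<^sub>R axis i 1)) has_field_derivative 0) (at 0)"
    proof (rule has_field_derivative_transform_within[OF DERIV_const e(1)])
      fix t :: real assume "dist t 0 < e"
      then show "0 = f (x + t *\<^sub>R axis i 1)" by (intro f0[symmetric]) (simp add: dist_norm)
    qed simp
    then have "partial i f x = 0" unfolding partial_def by (rule DERIV_imp_deriv)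
    with that show False by simp
  qed
  then show ?thesis unfolding supp_def[of "partial i f"]
    by (intro closure_minimal) (auto simp: supp_def)
qed

lemma test_functions_partial:
  assumes "f \<in> test_functions" shows "partial i f \<in> test_functions"
proof -
  have "compact (supp f \<inter> supp (partial i f))"
    using assms by (intro compact_Int_closed) (auto simp: test_functions_def supp_def)
  then show ?thesis
    using assms supp_partial[of i f] by (simp add: test_functions_def smooth_partial inf_absorb2)
qed

text \<open>The order 0 case of \<open>smooth\<close> supplies a Frechet derivative, while
  \<open>partial\<close> is a limit along an axis; restricting the former to the axes identifies its
  coordinates with the gradient.\<close>

lemma test_functions_has_derivative:
  fixes f :: "real^'d::finite \<Rightarrow> real"
  assumes "f \<in> test_functions"
  shows "(f has_derivative (\<lambda>v. grad f x \<bullet> v)) (at x)"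
proof -
  from assms have "partials [] f differentiable_on UNIV" unfolding test_functions_def smooth_def by blast
  then obtain f' where f': "(f has_derivative f') (at x)"
    by (auto simp: partials_def differentiable_on_def differentiable_def)
  then interpret f': bounded_linear f' by (rule has_derivative_bounded_linear)
  have "partial i f x = f' (axis i 1)" for i
  proof -
    have "((\<lambda>t. f (x + t *\<^sub>R axis i 1)) has_derivative (\<lambda>t. f' (t *\<^sub>R axis i 1))) (at 0)"
      by (rule has_derivative_compose[where g=f and f="\<lambda>t. x + t *\<^sub>R axis i 1"])
         (use f' in \<open>auto intro!: derivative_eq_intros\<close>)
    then have "((\<lambda>t. f (x + t *\<^sub>R axis i 1)) has_field_derivative f' (axis i 1)) (at 0)"
      by (simp add: has_field_derivative_def f'.scaleR mult_commute_abs)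
    then show ?thesis unfolding partial_def by (rule DERIV_imp_deriv)
  qed
  then have "f' v = grad f x \<bullet> v" for v
  proof -
    have "f' v = f' (\<Sum>i\<in>UNIV. (v $ i) *\<^sub>R axis i 1)" by (simp add: basis_expansion[where 'a=real, unfolded scalar_mult_eq_scaleR])
    also have "\<dots> = (\<Sum>i\<in>UNIV. v $ i * f' (axis i 1))" by (simp add: f'.sum f'.scaleR)
    finally show ?thesis
      using \<open>\<And>i. partial i f x = f' (axis i 1)\<close> by (simp add: inner_vec_def grad_def mult.commute)
  qed
  then have "f' = (\<lambda>v. grad f x \<bullet> v)" by auto
  with f' show ?thesis by simp
qed

lemma test_functions_continuous: "f \<in> test_functions \<Longrightarrow> continuous_on UNIV f"
  by (meson test_functions_has_derivative has_derivative_continuous continuous_at_imp_continuous_on)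

lemma test_functions_measurable: "f \<in> test_functions \<Longrightarrow> f \<in> borel_measurable borel"
  by (rule borel_measurable_continuous_onI[OF test_functions_continuous])

lemma test_functions_bounded:
  fixes f :: "real^'d::finite \<Rightarrow> real"
  assumes f: "f \<in> test_functions"
  obtains C r where "0 \<le> C" "0 \<le> r" "\<And>x. \<bar>f x\<bar> \<le> C" "\<And>x. r < norm x \<Longrightarrow> f x = 0"
proof -
  from f have c: "compact (supp f)" by (simp add: test_functions_def)
  have in_supp: "x \<in> supp f" if "f x \<noteq> 0" for x
    using that closure_subset[of "{x. f x \<noteq> 0}"] by (auto simp: supp_def)
  have "bounded (f ` supp f)"
    by (intro compact_imp_bounded compact_continuous_image c continuous_on_subset[OF test_functions_continuous[OF f]]) simp
  then obtain C where C: "\<And>x. x \<in> supp f \<Longrightarrow> \<bar>f x\<bar> \<le> C" by (auto simp: bounded_iff)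
  from compact_imp_bounded[OF c] obtain r where r: "\<And>x. x \<in> supp f \<Longrightarrow> norm x \<le> r" by (auto simp: bounded_iff)
  show ?thesis
  proof (rule that[of "max C 0" "max r 0"])
    show "\<bar>f x\<bar> \<le> max C 0" for x using C[of x] in_supp[of x] by (cases "f x = 0") auto
    show "f x = 0" if "max r 0 < norm x" for x using r[of x] in_supp[of x] that by force
  qed auto
qed

lemma test_functions_DERIV_ray:
  fixes f :: "real^'d::finite \<Rightarrow> real"
  assumes "f \<in> test_functions"
  shows "((\<lambda>t. f (x + t *\<^sub>R v)) has_real_derivative (grad f (x + t *\<^sub>R v) \<bullet> v)) (at t)"
proof -
  have "((\<lambda>t. f (x + t *\<^sub>R v)) has_derivative (\<lambda>s. grad f (x + t *\<^sub>R v) \<bullet> (s *\<^sub>R v))) (at t)"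
    by (rule has_derivative_compose[where f="\<lambda>t. x + t *\<^sub>R v", OF _ test_functions_has_derivative[OF assms]])
       (auto intro!: derivative_eq_intros)
  then show ?thesis
    unfolding has_field_derivative_def by (simp add: mult_commute_abs)
qed

lemma set_integral_FTC:
  fixes F g :: "real \<Rightarrow> real"
  assumes "0 \<le> r" "\<And>t. (F has_real_derivative g t) (at t)" "continuous_on UNIV g"
  shows "(LINT z:{0<..<r}|lborel. g z) = F r - F 0"
proof -
  have "(LINT z:{0<..<r}|lborel. g z) = (\<integral>z. g z * indicator {0..r} z \<partial>lborel)"
    unfolding set_lebesgue_integral_def
  proof (rule integral_cong_AE)
    have [measurable]: "g \<in> borel_measurable borel" by (rule borel_measurable_continuous_onI[OF assms(3)])
    show "(\<lambda>z. indicator {0<..<r} z *\<^sub>R g z) \<in> borel_measurable lborel"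
      "(\<lambda>z. g z * indicator {0..r} z) \<in> borel_measurable lborel" by measurable
    show "AE z in lborel. indicator {0<..<r} z *\<^sub>R g z = g z * indicator {0..r} z"
      using AE_lborel_singleton[of 0] AE_lborel_singleton[of r]
      by eventually_elim (auto simp: indicator_def)
  qed
  also have "\<dots> = F r - F 0"
    using assms by (intro integral_FTC_Icc_real) (auto simp: continuous_on_eq_continuous_at)
  finally show ?thesis .
qed

text \<open>The segment from 0 to \<open>y\<close> meets the ball of radius \<open>r\<close> in
  length min r |y|, and 1 \<le> r bounds this by r min 1 |y|. With c = 1 the result is the weight
  integrable for \<open>\<mu>\<close>; with c = |y| it is |y| min 1 |y| = min |y| |y|^2, the weight
  integrable for \<open>\<rho>\<close>.\<close>

lemma radial_integral_bound:
  fixes G :: "real^'d::finite \<Rightarrow> real"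
  assumes C: "0 \<le> C" "\<And>y. \<bar>G y\<bar> \<le> C" and r: "1 \<le> r" "\<And>y. r < norm y \<Longrightarrow> G y = 0"
    and k: "\<And>z. 0 < z \<Longrightarrow> z < norm y \<Longrightarrow> k (norm y) z \<le> ennreal c" and c: "0 \<le> c"
  shows "radial_integral k (\<lambda>y. ennreal \<bar>G y\<bar>) y \<le> ennreal (C * r * (c * min 1 (norm y)))"
proof -
  have "radial_integral k (\<lambda>y. ennreal \<bar>G y\<bar>) y \<le> (\<integral>\<^sup>+z. ennreal (c * C) * indicator {0..min r (norm y)} z \<partial>lborel)"
    unfolding radial_integral_def
  proof (rule nn_integral_mono)
    fix z
    show "k (norm y) z * ennreal \<bar>G (z *\<^sub>R sgn y)\<bar> * indicator {0<..<norm y} z \<le> ennreal (c * C) * indicator {0..min r (norm y)} z"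
    proof (cases "0 < z \<and> z < norm y")
      case True
      then have "y \<noteq> 0" by auto
      with True have n: "norm (z *\<^sub>R sgn y) = z" by (simp add: norm_sgn)
      show ?thesis
      proof (cases "z \<le> r")
        case le: True
        have "k (norm y) z * ennreal \<bar>G (z *\<^sub>R sgn y)\<bar> \<le> ennreal c * ennreal C"
          using True k[of z] C(2) by (intro mult_mono ennreal_leI) auto
        then show ?thesis using True le c C(1) by (simp add: ennreal_mult)
      next
        case False
        then have "G (z *\<^sub>R sgn y) = 0" using r(2)[of "z *\<^sub>R sgn y"] n by simp
        then show ?thesis by simp
      qed
    qed (auto simp: indicator_def)
  qed
  also have "\<dots> = ennreal (c * C) * ennreal (min r (norm y))"
    using r(1) by (subst nn_integral_cmult_indicator) auto
  also have "\<dots> \<le> ennreal (c * C) * ennreal (r * min 1 (norm y))"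
  proof (intro mult_left_mono ennreal_leI)
    show "min r (norm y) \<le> r * min 1 (norm y)"
      using r(1) mult_right_mono[of 1 r "norm y"] by (simp add: min_def)
  qed simp
  also have "\<dots> = ennreal (C * r * (c * min 1 (norm y)))"
    using c C(1) r(1) by (simp add: ennreal_mult[symmetric] ac_simps)
  finally show ?thesis .
qed

lemma test_function_shift_bounded:
  fixes f :: "real^'d::finite \<Rightarrow> real" and \<phi> :: "real^'d \<Rightarrow> real"
  assumes f: "f \<in> test_functions" and \<phi>: "\<And>y. \<bar>\<phi> y\<bar> \<le> 1"
  shows "\<exists>C r. 0 \<le> C \<and> 1 \<le> r \<and> (\<forall>y. \<bar>f (x + y) * \<phi> y\<bar> \<le> C) \<and> (\<forall>y. r < norm y \<longrightarrow> f (x + y) * \<phi> y = 0)"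
proof -
  from test_functions_bounded[OF f] obtain C r where *:
    "0 \<le> C" "0 \<le> r" "\<And>x. \<bar>f x\<bar> \<le> C" "\<And>x. r < norm x \<Longrightarrow> f x = 0" by blast
  show ?thesis
  \<comment> \<open>Shifting by \<open>x\<close> moves the support by at most |x|; the extra 1
    secures the lower bound on the radius that \<open>radial_integral_bound\<close> asks
    for.\<close>
  proof (rule exI[of _ C], rule exI[of _ "r + norm x + 1"], intro conjI allI impI)
    show "\<bar>f (x + y) * \<phi> y\<bar> \<le> C" for y
      using mult_mono[OF *(3)[of "x + y"] \<phi>[of y]] *(1) by (simp add: abs_mult)
    fix y :: "real^'d" assume "r + norm x + 1 < norm y"
    with norm_triangle_ineq2[of y "- x"] have "r < norm (x + y)" by (simp add: add.commute)
    then show "f (x + y) * \<phi> y = 0" using *(4) by simp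
  qed (use * in auto)
qed

lemma sum_bounded_compact_support:
  fixes G :: "'i \<Rightarrow> real^'d::finite \<Rightarrow> real"
  assumes "finite I" "\<And>i. i \<in> I \<Longrightarrow> \<exists>C r. 0 \<le> C \<and> 1 \<le> r \<and> (\<forall>y. \<bar>G i y\<bar> \<le> C) \<and> (\<forall>y. r < norm y \<longrightarrow> G i y = 0)"
  shows "\<exists>C r. 0 \<le> C \<and> 1 \<le> r \<and> (\<forall>y. \<bar>\<Sum>i\<in>I. G i y\<bar> \<le> C) \<and> (\<forall>y. r < norm y \<longrightarrow> (\<Sum>i\<in>I. G i y) = 0)"
  using assms
proof (induct I)
  case empty show ?case by (auto intro!: exI[of _ 0] exI[of _ 1])
next
  case (insert i I)
  from insert.prems[of i] obtain C r where 1: "0 \<le> C" "1 \<le> r" "\<And>y. \<bar>G i y\<bar> \<le> C" "\<And>y. r < norm y \<Longrightarrow> G i y = 0" by auto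
  from insert.hyps(3) insert.prems obtain C' r' where 2: "0 \<le> C'" "1 \<le> r'"
    "\<And>y. \<bar>\<Sum>i\<in>I. G i y\<bar> \<le> C'" "\<And>y. r' < norm y \<Longrightarrow> (\<Sum>i\<in>I. G i y) = 0" by auto
  show ?case
  proof (rule exI[of _ "C + C'"], rule exI[of _ "max r r'"], intro conjI allI impI)
    fix y
    show "\<bar>\<Sum>i\<in>insert i I. G i y\<bar> \<le> C + C'"
      using insert.hyps 1(3)[of y] 2(3)[of y] by simp
    show "(\<Sum>i\<in>insert i I. G i y) = 0" if "max r r' < norm y"
      using insert.hyps 1(4)[of y] 2(4)[of y] that by simp
  qed (use 1 2 in auto)
qed

lemma component_ratio_le: "\<bar>y $ i / norm y\<bar> \<le> 1" for y :: "real^'d::finite"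
  using component_le_norm_cart[of y i] by (cases "y = 0") (auto simp: abs_divide)

lemma
  fixes Q :: "(real^'d::finite) measure"
  assumes Q: "levy_measure Q" and fin: "(\<integral>\<^sup>+y. ennreal (min 1 (norm y)) \<partial>Q) < \<infinity>"
    and G[measurable]: "G \<in> borel_measurable borel"
    and bd: "\<exists>C r. 0 \<le> C \<and> 1 \<le> r \<and> (\<forall>y. \<bar>G y\<bar> \<le> C) \<and> (\<forall>y. r < norm y \<longrightarrow> G y = (0::real))"
  shows integrable_integrated_tail: "integrable (integrated_tail Q) G"
    and integral_integrated_tail: "(LINT y|integrated_tail Q. G y) =
      (LINT y|Q. (LINT z:{0<..<norm y}|lborel. 1 * G (z *\<^sub>R sgn y)))"
proof -
  from bd obtain C r where *: "0 \<le> C" "1 \<le> r" "\<And>y. \<bar>G y\<bar> \<le> C" "\<And>y. r < norm y \<Longrightarrow> G y = 0" by blast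
  have sets_Q[measurable_cong]: "sets Q = sets borel" using Q by (simp add: levy_measure_def)
  have "(\<integral>\<^sup>+y. radial_integral (\<lambda>r z. ennreal 1) (\<lambda>y. ennreal \<bar>G y\<bar>) y \<partial>Q) \<le>
      (\<integral>\<^sup>+y. ennreal (C * r * (1 * min 1 (norm y))) \<partial>Q)"
    by (intro nn_integral_mono radial_integral_bound *) auto
  also have "\<dots> = ennreal (C * r) * (\<integral>\<^sup>+y. ennreal (min 1 (norm y)) \<partial>Q)"
    using * by (subst nn_integral_cmult[symmetric]) (auto simp: ennreal_mult)
  also have "\<dots> < \<infinity>" using fin by (simp add: ennreal_mult_less_top)
  finally have f: "(\<integral>\<^sup>+y. radial_integral (\<lambda>r z. ennreal 1) (\<lambda>y. ennreal \<bar>G y\<bar>) y \<partial>Q) < \<infinity>" .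
  have T: "(\<integral>\<^sup>+y. g y \<partial>integrated_tail Q) = (\<integral>\<^sup>+y. radial_integral (\<lambda>r z. ennreal 1) g y \<partial>Q)"
    if "g \<in> borel_measurable borel" for g
    using nn_integral_integrated_tail[OF Q that] by simp
  have m: "case_prod (\<lambda>(_ :: real) (_ :: real). 1 :: real) \<in> borel_measurable (borel \<Otimes>\<^sub>M borel)" by measurable
  show "integrable (integrated_tail Q) G"
    by (rule integral_tail(1)[OF sets_Q sets_integrated_tail T m _ G f]) simp_all
  show "(LINT y|integrated_tail Q. G y) = (LINT y|Q. (LINT z:{0<..<norm y}|lborel. 1 * G (z *\<^sub>R sgn y)))"
    by (rule integral_tail(2)[OF sets_Q sets_integrated_tail T m _ G f]) simp_all
qed

lemma
  fixes Q :: "(real^'d::finite) measure"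
  assumes Q: "levy_measure Q" and fin: "(\<integral>\<^sup>+y. ennreal (min (norm y) ((norm y)\<^sup>2)) \<partial>Q) < \<infinity>"
    and G[measurable]: "G \<in> borel_measurable borel"
    and bd: "\<exists>C r. 0 \<le> C \<and> 1 \<le> r \<and> (\<forall>y. \<bar>G y\<bar> \<le> C) \<and> (\<forall>y. r < norm y \<longrightarrow> G y = (0::real))"
  shows integrable_double_integrated_tail: "integrable (double_integrated_tail Q) G"
    and integral_double_integrated_tail: "(LINT y|double_integrated_tail Q. G y) =
      (LINT y|Q. (LINT z:{0<..<norm y}|lborel. (norm y - z) * G (z *\<^sub>R sgn y)))"
proof -
  from bd obtain C r where *: "0 \<le> C" "1 \<le> r" "\<And>y. \<bar>G y\<bar> \<le> C" "\<And>y. r < norm y \<Longrightarrow> G y = 0" by blast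
  have sets_Q[measurable_cong]: "sets Q = sets borel" using Q by (simp add: levy_measure_def)
  have "(\<integral>\<^sup>+y. radial_integral (\<lambda>r z. ennreal (r - z)) (\<lambda>y. ennreal \<bar>G y\<bar>) y \<partial>Q) \<le>
      (\<integral>\<^sup>+y. ennreal (C * r * (norm y * min 1 (norm y))) \<partial>Q)"
    by (intro nn_integral_mono radial_integral_bound *) (auto intro!: ennreal_leI)
  also have "\<dots> = (\<integral>\<^sup>+y. ennreal (C * r) * ennreal (min (norm y) ((norm y)\<^sup>2)) \<partial>Q)"
    using * by (intro nn_integral_cong)
      (simp add: ennreal_mult[symmetric] min_mult_distrib_left power2_eq_square)
  also have "\<dots> = ennreal (C * r) * (\<integral>\<^sup>+y. ennreal (min (norm y) ((norm y)\<^sup>2)) \<partial>Q)"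
    by (rule nn_integral_cmult) measurable
  also have "\<dots> < \<infinity>"
  proof -
    have "ennreal c * x < \<infinity>" if "x < \<infinity>" for c x using that by (simp add: ennreal_mult_less_top)
    then show ?thesis using fin .
  qed
  finally have f: "(\<integral>\<^sup>+y. radial_integral (\<lambda>r z. ennreal (r - z)) (\<lambda>y. ennreal \<bar>G y\<bar>) y \<partial>Q) < \<infinity>" .
  note T = nn_integral_double_integrated_tail[OF Q fin]
  have m: "case_prod (\<lambda>r z. r - z :: real) \<in> borel_measurable (borel \<Otimes>\<^sub>M borel)" by measurable
  show "integrable (double_integrated_tail Q) G"
    by (rule integral_tail(1)[OF sets_Q sets_double_integrated_tail T m _ G f]) simp_all
  show "(LINT y|double_integrated_tail Q. G y) = (LINT y|Q. (LINT z:{0<..<norm y}|lborel. (norm y - z) * G (z *\<^sub>R sgn y)))"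
    by (rule integral_tail(2)[OF sets_Q sets_double_integrated_tail T m _ G f]) simp_all
qed

lemma component_ratio_ray:
  fixes y :: "real^'d::finite"
  assumes "0 < z" "y \<noteq> 0"
  shows "(z *\<^sub>R sgn y) $ i / norm (z *\<^sub>R sgn y) = sgn y $ i"
  using assms by (simp add: norm_sgn)

text \<open>The ratio y_i/|y| is constant along a ray, so the sum over \<open>i\<close> is the
  derivative of \<open>f\<close> in the ray direction and integrates to an increment. The sum is
  moved inside first because only the full sum is such a derivative.\<close>

lemma sum_integral_integrated_tail:
  fixes Q :: "(real^'d::finite) measure"
  assumes Q: "levy_measure Q" and fin: "(\<integral>\<^sup>+y. ennreal (min 1 (norm y)) \<partial>Q) < \<infinity>"
    and f: "f \<in> test_functions"
  shows "(\<Sum>i\<in>UNIV. LINT y|integrated_tail Q. partial i f (x + y) * (y $ i / norm y)) = (LINT y|Q. f (x + y) - f x)"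
proof -
  define G where "G i y = partial i f (x + y) * (y $ i / norm y)" for i y
  note pf = test_functions_partial[OF f]
  have G_meas[measurable]: "G i \<in> borel_measurable borel" for i
    using test_functions_measurable[OF pf[of i]] unfolding G_def by measurable
  have bd: "\<exists>C r. 0 \<le> C \<and> 1 \<le> r \<and> (\<forall>y. \<bar>G i y\<bar> \<le> C) \<and> (\<forall>y. r < norm y \<longrightarrow> G i y = 0)" for i
    unfolding G_def by (rule test_function_shift_bounded[OF pf component_ratio_le])
  have "(\<Sum>i\<in>UNIV. LINT y|integrated_tail Q. G i y) = (LINT y|integrated_tail Q. (\<Sum>i\<in>UNIV. G i y))"
    by (rule Bochner_Integration.integral_sum[symmetric]) (rule integrable_integrated_tail[OF Q fin G_meas bd])
  also have "\<dots> = (LINT y|Q. (LINT z:{0<..<norm y}|lborel. 1 * (\<Sum>i\<in>UNIV. G i (z *\<^sub>R sgn y))))"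
    by (rule integral_integrated_tail[OF Q fin _ sum_bounded_compact_support]) (use bd in auto)
  also have "\<dots> = (LINT y|Q. f (x + y) - f x)"
  proof (rule Bochner_Integration.integral_cong[OF refl])
    fix y
    show "(LINT z:{0<..<norm y}|lborel. 1 * (\<Sum>i\<in>UNIV. G i (z *\<^sub>R sgn y))) = f (x + y) - f x"
    proof (cases "y = 0")
      case False
      have "(LINT z:{0<..<norm y}|lborel. 1 * (\<Sum>i\<in>UNIV. G i (z *\<^sub>R sgn y))) =
          (LINT z:{0<..<norm y}|lborel. grad f (x + z *\<^sub>R sgn y) \<bullet> sgn y)"
      proof (rule set_lebesgue_integral_cong, simp, safe)
        fix z assume "z \<in> {0<..<norm y}"
        then have "G i (z *\<^sub>R sgn y) = partial i f (x + z *\<^sub>R sgn y) * sgn y $ i" for i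
          unfolding G_def by (subst component_ratio_ray[OF _ False]) auto
        then show "1 * (\<Sum>i\<in>UNIV. G i (z *\<^sub>R sgn y)) = grad f (x + z *\<^sub>R sgn y) \<bullet> sgn y"
          by (simp add: inner_vec_def grad_def)
      qed
      also have "\<dots> = f (x + norm y *\<^sub>R sgn y) - f (x + 0 *\<^sub>R sgn y)"
      proof (rule set_integral_FTC)
        show "continuous_on UNIV (\<lambda>z. grad f (x + z *\<^sub>R sgn y) \<bullet> sgn y)"
          unfolding inner_vec_def grad_def vec_lambda_beta
          by (intro continuous_intros continuous_on_compose2[OF test_functions_continuous[OF pf]]) auto
      qed (auto intro: test_functions_DERIV_ray[OF f])
      finally show ?thesis using False by (simp add: sgn_div_norm)
    qed (simp add: set_lebesgue_integral_def)
  qed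
  finally show ?thesis by (simp add: G_def)
qed

text \<open>Taylor's formula with integral remainder on the segment from x to x + y. The order
  \<open>partial j (partial i f)\<close> is the one produced by unfolding
  \<open>dist_hess\<close>.\<close>

lemma sum_integral_double_integrated_tail:
  fixes Q :: "(real^'d::finite) measure"
  assumes Q: "levy_measure Q" and fin: "(\<integral>\<^sup>+y. ennreal (min (norm y) ((norm y)\<^sup>2)) \<partial>Q) < \<infinity>"
    and f: "f \<in> test_functions"
  shows "(\<Sum>i\<in>UNIV. \<Sum>j\<in>UNIV. LINT y|double_integrated_tail Q.
      partial j (partial i f) (x + y) * (y $ i * y $ j / (norm y)\<^sup>2)) = (LINT y|Q. f (x + y) - f x - grad f x \<bullet> y)"
proof -
  define G where "G i j y = partial j (partial i f) (x + y) * (y $ i * y $ j / (norm y)\<^sup>2)" for i j y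
  note pf = test_functions_partial[OF f]
  note ppf = test_functions_partial[OF pf]
  have G_meas[measurable]: "G i j \<in> borel_measurable borel" for i j
    using test_functions_measurable[OF ppf[of j i]] unfolding G_def by measurable
  have ratio: "y $ i * y $ j / (norm y)\<^sup>2 = (y $ i / norm y) * (y $ j / norm y)" for y :: "real^'d" and i j
    by (simp add: power2_eq_square)
  have bd: "\<exists>C r. 0 \<le> C \<and> 1 \<le> r \<and> (\<forall>y. \<bar>G i j y\<bar> \<le> C) \<and> (\<forall>y. r < norm y \<longrightarrow> G i j y = 0)" for i j
  proof -
    have "\<bar>y $ i * y $ j / (norm y)\<^sup>2\<bar> \<le> 1" for y :: "real^'d"
      unfolding ratio abs_mult using mult_mono[OF component_ratio_le[of y i] component_ratio_le[of y j]] by simp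
    then show ?thesis unfolding G_def by (rule test_function_shift_bounded[OF ppf])
  qed
  have bd': "\<exists>C r. 0 \<le> C \<and> 1 \<le> r \<and> (\<forall>y. \<bar>\<Sum>j\<in>UNIV. G i j y\<bar> \<le> C) \<and> (\<forall>y. r < norm y \<longrightarrow> (\<Sum>j\<in>UNIV. G i j y) = 0)" for i
    by (rule sum_bounded_compact_support[OF _ bd]) simp
  have int: "integrable (double_integrated_tail Q) (G i j)" for i j
    by (rule integrable_double_integrated_tail[OF Q fin G_meas bd])
  have "(\<Sum>i\<in>UNIV. \<Sum>j\<in>UNIV. LINT y|double_integrated_tail Q. G i j y) =
      (LINT y|double_integrated_tail Q. (\<Sum>i\<in>UNIV. \<Sum>j\<in>UNIV. G i j y))"
    by (simp add: Bochner_Integration.integral_sum int)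
  also have "\<dots> = (LINT y|Q. (LINT z:{0<..<norm y}|lborel. (norm y - z) * (\<Sum>i\<in>UNIV. \<Sum>j\<in>UNIV. G i j (z *\<^sub>R sgn y))))"
    by (rule integral_double_integrated_tail[OF Q fin _ sum_bounded_compact_support]) (use bd' in auto)
  also have "\<dots> = (LINT y|Q. f (x + y) - f x - grad f x \<bullet> y)"
  proof (rule Bochner_Integration.integral_cong[OF refl])
    fix y
    show "(LINT z:{0<..<norm y}|lborel. (norm y - z) * (\<Sum>i\<in>UNIV. \<Sum>j\<in>UNIV. G i j (z *\<^sub>R sgn y))) = f (x + y) - f x - grad f x \<bullet> y"
    proof (cases "y = 0")
      case False
      define \<xi> where "\<xi> = sgn y"
      \<comment> \<open>\<open>D1\<close> and \<open>D2\<close> are the first and second derivatives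
        of \<open>f\<close> along the ray; \<open>D2\<close> is written as derivatives of the
        partial derivatives so that the rule for test functions applies again.\<close>
      define D1 where "D1 z = grad f (x + z *\<^sub>R \<xi>) \<bullet> \<xi>" for z
      define D2 where "D2 z = (\<Sum>i\<in>UNIV. \<xi> $ i * (grad (partial i f) (x + z *\<^sub>R \<xi>) \<bullet> \<xi>))" for z
      have D1: "((\<lambda>z. f (x + z *\<^sub>R \<xi>)) has_real_derivative D1 z) (at z)" for z
        unfolding D1_def by (rule test_functions_DERIV_ray[OF f])
      have "((\<lambda>z. \<Sum>i\<in>UNIV. \<xi> $ i * partial i f (x + z *\<^sub>R \<xi>)) has_real_derivative D2 z) (at z)" for z
        unfolding D2_def by (intro DERIV_sum DERIV_cmult test_functions_DERIV_ray[OF pf])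
      moreover have "D1 = (\<lambda>z. \<Sum>i\<in>UNIV. \<xi> $ i * partial i f (x + z *\<^sub>R \<xi>))"
        by (simp add: fun_eq_iff D1_def inner_vec_def grad_def mult.commute)
      ultimately have D2: "(D1 has_real_derivative D2 z) (at z)" for z by simp
      have "(LINT z:{0<..<norm y}|lborel. (norm y - z) * (\<Sum>i\<in>UNIV. \<Sum>j\<in>UNIV. G i j (z *\<^sub>R sgn y))) =
          (LINT z:{0<..<norm y}|lborel. (norm y - z) * D2 z)"
      proof (rule set_lebesgue_integral_cong, simp, safe)
        fix z assume "z \<in> {0<..<norm y}"
        then have "G i j (z *\<^sub>R sgn y) = \<xi> $ i * (partial j (partial i f) (x + z *\<^sub>R \<xi>) * \<xi> $ j)" for i j
          unfolding G_def ratio by (subst (1 2) component_ratio_ray[OF _ False]) (auto simp: \<xi>_def)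
        then show "(norm y - z) * (\<Sum>i\<in>UNIV. \<Sum>j\<in>UNIV. G i j (z *\<^sub>R sgn y)) = (norm y - z) * D2 z"
          by (simp add: D2_def inner_vec_def grad_def sum_distrib_left)
      qed
      \<comment> \<open>Integration by parts is packed into the antiderivative (|y| - z) D1 z + f(x
        + z \<xi>): the derivative of its first factor is -1 and cancels that of the last term,
        leaving (|y| - z) D2 z.\<close>
      also have "\<dots> = ((norm y - norm y) * D1 (norm y) + f (x + norm y *\<^sub>R \<xi>)) - ((norm y - 0) * D1 0 + f (x + 0 *\<^sub>R \<xi>))"
      proof (rule set_integral_FTC)
        show "((\<lambda>z. (norm y - z) * D1 z + f (x + z *\<^sub>R \<xi>)) has_real_derivative (norm y - z) * D2 z) (at z)" for z
          by (rule derivative_eq_intros D1 D2 refl)+ simp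
        show "continuous_on UNIV (\<lambda>z. (norm y - z) * D2 z)"
          unfolding D2_def inner_vec_def grad_def vec_lambda_beta
          by (intro continuous_intros continuous_on_compose2[OF test_functions_continuous[OF ppf]]) auto
      qed simp
      also have "\<dots> = f (x + y) - f x - grad f x \<bullet> y"
        using False by (simp add: \<xi>_def D1_def sgn_div_norm)
      finally show ?thesis .
    qed (simp add: set_lebesgue_integral_def)
  qed
  finally show ?thesis by (simp add: G_def)
qed

section \<open>Jump functionals and infinitesimal invariance\<close>

lemma partial_integral_not_NoneD:
  assumes "partial_integral \<eta> P g \<noteq> None"
  shows "integrable \<eta> g" "the (partial_integral \<eta> P g) = (LINT x|\<eta>. g x)"
  using assms by (auto simp: partial_integral_def split: if_splits)

lemma pf_sum_not_NoneD:
  assumes "pf_sum T f \<noteq> None"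
  shows "T i f \<noteq> None" "the (pf_sum T f) = (\<Sum>i\<in>UNIV. the (T i f))"
proof -
  from assms have "\<forall>i. T i f \<noteq> None" unfolding pf_sum_def by meson
  then show "T i f \<noteq> None" "the (pf_sum T f) = (\<Sum>i\<in>UNIV. the (T i f))"
    by (simp_all only: pf_sum_def if_True option.sel simp_thms)
qed

lemma dist_partial_not_NoneD:
  assumes "dist_partial i T f \<noteq> None"
  shows "T (partial i f) \<noteq> None" "the (dist_partial i T f) = - the (T (partial i f))"
  using assms by (auto simp: dist_partial_def option.map_sel)

lemma dist_div_not_NoneD:
  assumes "dist_div F f \<noteq> None"
  shows "F i (partial i f) \<noteq> None" "pairing (dist_div F) f = - (\<Sum>i\<in>UNIV. the (F i (partial i f)))"
proof -
  have *: "dist_partial i (F i) f \<noteq> None" for i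
    using pf_sum_not_NoneD(1)[OF assms[unfolded dist_div_def]] by simp
  then show "F i (partial i f) \<noteq> None" by (rule dist_partial_not_NoneD)
  show "pairing (dist_div F) f = - (\<Sum>i\<in>UNIV. the (F i (partial i f)))"
    using pf_sum_not_NoneD(2)[OF assms[unfolded dist_div_def]] dist_partial_not_NoneD(2)[OF *]
    by (simp add: pairing_def dist_div_def sum_negf)
qed

lemma dist_hess_not_NoneD:
  assumes "dist_hess M f \<noteq> None"
  shows "M i j (partial j (partial i f)) \<noteq> None"
    "pairing (dist_hess M) f = (\<Sum>i\<in>UNIV. \<Sum>j\<in>UNIV. the (M i j (partial j (partial i f))))"
proof -
  note n = assms[unfolded dist_hess_def]
  have *: "dist_partial i (dist_partial j (M i j)) f \<noteq> None" for i j
    using pf_sum_not_NoneD(1)[OF pf_sum_not_NoneD(1)[OF n]] by simp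
  note ** = dist_partial_not_NoneD(1)[OF *]
  show "M i j (partial j (partial i f)) \<noteq> None" by (rule dist_partial_not_NoneD(1)[OF **])
  have "pairing (dist_hess M) f = (\<Sum>i\<in>UNIV. \<Sum>j\<in>UNIV. the (dist_partial i (dist_partial j (M i j)) f))"
    using pf_sum_not_NoneD(2)[OF n] pf_sum_not_NoneD(2)[OF pf_sum_not_NoneD(1)[OF n]]
    by (simp add: pairing_def dist_hess_def)
  then show "pairing (dist_hess M) f = (\<Sum>i\<in>UNIV. \<Sum>j\<in>UNIV. the (M i j (partial j (partial i f))))"
    by (simp add: dist_partial_not_NoneD(2)[OF *] dist_partial_not_NoneD(2)[OF **])
qed

text \<open>The sets where min 1 |y|^2 is at least 1/(n+1) have finite mass by Markov's inequality
  and exhaust everything but the null point 0. This is what permits comparing densities with respect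
  to \<open>K x\<close>.\<close>

lemma levy_measure_sigma_finite:
  fixes Q :: "(real^'d::finite) measure"
  assumes "levy_measure Q"
  shows "sigma_finite_measure Q"
proof
  from assms have sets_Q[measurable_cong]: "sets Q = sets borel" and Q0: "emeasure Q {0} = 0"
    and fin: "(\<integral>\<^sup>+y. ennreal (min 1 ((norm y)\<^sup>2)) \<partial>Q) < \<infinity>" by (auto simp: levy_measure_def)
  have space_Q: "space Q = UNIV" using sets_eq_imp_space_eq[OF sets_Q] by simp
  define B where "B n = {y :: real^'d. 1 / real (Suc n) \<le> min 1 ((norm y)\<^sup>2)}" for n
  have B[measurable]: "B n \<in> sets borel" for n unfolding B_def by measurable
  have B_fin: "emeasure Q (B n) \<noteq> \<infinity>" for n
  proof -
    have "ennreal (1 / real (Suc n)) * emeasure Q (B n) = (\<integral>\<^sup>+y. ennreal (1 / real (Suc n)) * indicator (B n) y \<partial>Q)"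
      by (subst nn_integral_cmult_indicator) (simp_all add: sets_Q)
    also have "\<dots> \<le> (\<integral>\<^sup>+y. ennreal (min 1 ((norm y)\<^sup>2)) \<partial>Q)"
    proof (rule nn_integral_mono)
      fix y
      show "ennreal (1 / real (Suc n)) * indicator (B n) y \<le> ennreal (min 1 ((norm y)\<^sup>2))"
      proof (cases "y \<in> B n")
        case True
        then have "ennreal (1 / real (Suc n)) \<le> ennreal (min 1 ((norm y)\<^sup>2))"
          unfolding B_def by (intro ennreal_leI) blast
        with True show ?thesis by (simp only: indicator_simps mult_1_right)
      qed (simp only: indicator_simps not_False_eq_True mult_zero_right zero_le)
    qed
    also note fin
    finally show ?thesis by (auto simp: ennreal_mult_top)
  qed
  show "\<exists>A. countable A \<and> A \<subseteq> sets Q \<and> \<Union> A = space Q \<and> (\<forall>a\<in>A. emeasure Q a \<noteq> \<infinity>)"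
  proof (intro exI[of _ "insert {0} (range B)"] conjI ballI)
    have "y \<in> (\<Union>n. B n)" if "y \<noteq> 0" for y
    proof -
      have "0 < min 1 ((norm y)\<^sup>2)" using that by (simp only: min_less_iff_conj) simp
      from nat_approx_posE[OF this] obtain n where "1 / real (Suc n) < min 1 ((norm y)\<^sup>2)" by blast
      then show ?thesis unfolding B_def by (blast intro: less_imp_le)
    qed
    then show "\<Union> (insert {0} (range B)) = space Q" by (auto simp: space_Q)
    fix a assume "a \<in> insert {0} (range B)"
    then show "emeasure Q a \<noteq> \<infinity>" using Q0 B_fin by auto
  qed (auto simp: sets_Q)
qed

text \<open>The decomposition is an identity of measures, so it determines the sum of the weights
  only almost everywhere; where the measure has no mass the sum may differ from 1.\<close>

lemma density_decomposition_AE: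
  fixes h1 h2 h3 :: "'a \<Rightarrow> real"
  assumes "sigma_finite_measure M"
    and [measurable]: "h1 \<in> borel_measurable M" "h2 \<in> borel_measurable M" "h3 \<in> borel_measurable M"
    and nn: "\<And>y. 0 \<le> h1 y" "\<And>y. 0 \<le> h2 y" "\<And>y. 0 \<le> h3 y"
    and eq: "\<And>B. B \<in> sets M \<Longrightarrow> emeasure M B = emeasure (density M (\<lambda>y. ennreal (h1 y))) B +
       emeasure (density M (\<lambda>y. ennreal (h2 y))) B + emeasure (density M (\<lambda>y. ennreal (h3 y))) B"
  shows "AE y in M. h1 y + h2 y + h3 y = 1"
proof -
  interpret sigma_finite_measure M by fact
  have "density M (\<lambda>y. ennreal (h1 y) + ennreal (h2 y) + ennreal (h3 y)) = density M (\<lambda>_. 1)"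
  proof (rule measure_eqI)
    fix B assume "B \<in> sets (density M (\<lambda>y. ennreal (h1 y) + ennreal (h2 y) + ennreal (h3 y)))"
    then have [measurable]: "B \<in> sets M" by simp
    show "emeasure (density M (\<lambda>y. ennreal (h1 y) + ennreal (h2 y) + ennreal (h3 y))) B = emeasure (density M (\<lambda>_. 1)) B"
      using eq[of B] by (simp add: emeasure_density distrib_right nn_integral_add)
  qed simp
  then have "AE y in M. ennreal (h1 y) + ennreal (h2 y) + ennreal (h3 y) = 1"
    by (subst (asm) density_unique_iff) auto
  then show ?thesis
    by eventually_elim (use nn in \<open>simp add: ennreal_plus[symmetric] del: ennreal_plus\<close>)
qed

text \<open>Nonnegative weights summing to 1 are each at most 1, so integrability passes from the
  whole measure to every part.\<close>

lemma integral_density_decomposition: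
  fixes g :: "'a \<Rightarrow> real" and h1 h2 h3 :: "'a \<Rightarrow> real"
  assumes ae: "AE y in M. h1 y + h2 y + h3 y = 1"
    and [measurable]: "h1 \<in> borel_measurable M" "h2 \<in> borel_measurable M" "h3 \<in> borel_measurable M"
    and nn: "\<And>y. 0 \<le> h1 y" "\<And>y. 0 \<le> h2 y" "\<And>y. 0 \<le> h3 y"
    and g: "integrable M g"
  defines "D \<equiv> \<lambda>h :: 'a \<Rightarrow> real. density M (\<lambda>y. ennreal (h y))"
  shows "integrable (D h1) g" "integrable (D h2) g" "integrable (D h3) g"
    "(LINT y|M. g y) = (LINT y|D h1. g y) + (LINT y|D h2. g y) + (LINT y|D h3. g y)"
proof -
  have g_meas[measurable]: "g \<in> borel_measurable M" using g by simp
  have int: "integrable M (\<lambda>y. h y * g y)"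
    if [measurable]: "h \<in> borel_measurable M" and h: "\<And>y. 0 \<le> h y" "AE y in M. h y \<le> 1" for h
  proof (rule Bochner_Integration.integrable_bound[OF g])
    show "AE y in M. norm (h y * g y) \<le> norm (g y)"
      using h(2) by eventually_elim (simp add: abs_mult h(1) mult_left_le_one_le)
  qed measurable
  have le: "AE y in M. h1 y \<le> 1" "AE y in M. h2 y \<le> 1" "AE y in M. h3 y \<le> 1"
    using ae by (eventually_elim, use nn in \<open>smt (verit)\<close>)+
  note ints = int[OF assms(2) nn(1) le(1)] int[OF assms(3) nn(2) le(2)] int[OF assms(4) nn(3) le(3)]
  show "integrable (D h1) g" "integrable (D h2) g" "integrable (D h3) g"
    using ints by (simp_all add: D_def integrable_density nn)
  have "(LINT y|M. g y) = (LINT y|M. h1 y * g y + h2 y * g y + h3 y * g y)"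
  proof (rule integral_cong_AE)
    show "AE y in M. g y = h1 y * g y + h2 y * g y + h3 y * g y"
      using ae by eventually_elim (simp add: distrib_right[symmetric])
  qed measurable
  also have "\<dots> = (LINT y|M. h1 y * g y) + (LINT y|M. h2 y * g y) + (LINT y|M. h3 y * g y)"
    using ints by (simp add: Bochner_Integration.integral_add)
  finally show "(LINT y|M. g y) = (LINT y|D h1. g y) + (LINT y|D h2. g y) + (LINT y|D h3. g y)"
    by (simp add: D_def integral_density nn)
qed

text \<open>Gives meaning to the three integrals in \<open>drift_correction\<close>:
  \<open>w\<close> is 1 for \<open>\<nu>\<close> and min 1 |y| for \<open>\<mu>\<close>, both on the
  unit ball, and min |y| |y|^2 for \<open>\<rho>\<close> outside it.\<close>

lemma integrable_cutoff:
  fixes Q :: "(real^'d::finite) measure"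
  assumes sets_Q[measurable_cong]: "sets Q = sets borel" and [measurable]: "A \<in> sets borel"
    and [measurable]: "w \<in> borel_measurable borel" and fin: "(\<integral>\<^sup>+y. ennreal (w y) \<partial>Q) < \<infinity>"
    and le: "\<And>y. y \<in> A \<Longrightarrow> norm y \<le> w y"
  shows "integrable Q (\<lambda>y. indicator A y *\<^sub>R y)"
proof (rule integrableI_bounded)
  have "(\<integral>\<^sup>+y. ennreal (norm (indicator A y *\<^sub>R y)) \<partial>Q) \<le> (\<integral>\<^sup>+y. ennreal (w y) \<partial>Q)"
    by (intro nn_integral_mono) (auto simp: indicator_def le intro!: ennreal_leI)
  then show "(\<integral>\<^sup>+y. ennreal (norm (indicator A y *\<^sub>R y)) \<partial>Q) < \<infinity>" using fin by (rule le_less_trans)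
qed measurable

text \<open>Each part is given the compensator that suits it: none for \<open>\<nu>\<close> and
  \<open>\<mu>\<close>, the full linear term for \<open>\<rho>\<close>. Removing the truncated term
  costs -y on the unit ball, completing it costs +y outside, and these costs add up to the drift
  correction.\<close>

lemma convenient_decomposition_jump_integral:
  fixes f :: "real^'d::finite \<Rightarrow> real"
  assumes K: "levy_kernel K" and dec: "convenient_decomposition K \<nu> \<mu> \<rho>"
    and f: "f \<in> test_functions" and int: "integrable (K x) (jump_integrand f x)"
  shows "(LINT y|K x. jump_integrand f x y) =
     drift_correction \<nu> \<mu> \<rho> x \<bullet> grad f x
     + ((LINT y|\<nu> x. f (x + y)) - f x * measure (\<nu> x) UNIV)
     + (\<Sum>i\<in>UNIV. LINT y|integrated_tail (\<mu> x). partial i f (x + y) * (y $ i / norm y))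
     + (\<Sum>i\<in>UNIV. \<Sum>j\<in>UNIV. LINT y|double_integrated_tail (\<rho> x).
         partial j (partial i f) (x + y) * (y $ i * y $ j / (norm y)\<^sup>2))"
proof -
  let ?J = "jump_integrand f x"
  let ?lt = "{y :: real^'d. norm y < 1}" and ?ge = "{y :: real^'d. 1 \<le> norm y}"
  from dec obtain h1 h2 h3 :: "real^'d \<Rightarrow> real" where
    cont: "continuous_on UNIV h1" "continuous_on UNIV h2" "continuous_on UNIV h3"
    and nn: "\<And>y. 0 \<le> h1 y" "\<And>y. 0 \<le> h2 y" "\<And>y. 0 \<le> h3 y"
    and \<nu>: "\<nu> x = density (K x) (\<lambda>y. ennreal (h1 y))" and \<mu>: "\<mu> x = density (K x) (\<lambda>y. ennreal (h2 y))"
    and \<rho>: "\<rho> x = density (K x) (\<lambda>y. ennreal (h3 y))"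
    and split: "\<And>B. B \<in> sets borel \<Longrightarrow> emeasure (K x) B = emeasure (\<nu> x) B + emeasure (\<mu> x) B + emeasure (\<rho> x) B"
    and fin\<nu>: "emeasure (\<nu> x) UNIV < \<infinity>" and fin\<mu>: "(\<integral>\<^sup>+y. ennreal (min 1 (norm y)) \<partial>\<mu> x) < \<infinity>"
    and fin\<rho>: "(\<integral>\<^sup>+y. ennreal (min (norm y) ((norm y)\<^sup>2)) \<partial>\<rho> x) < \<infinity>"
    unfolding convenient_decomposition_def by blast
  have LK: "levy_measure (K x)" using K by (simp add: levy_kernel_def)
  then have sets_K[measurable_cong]: "sets (K x) = sets borel" by (simp add: levy_measure_def)
  have h[measurable]: "h1 \<in> borel_measurable (K x)" "h2 \<in> borel_measurable (K x)" "h3 \<in> borel_measurable (K x)"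
    using cont by (simp_all add: measurable_cong_sets[OF sets_K refl] borel_measurable_continuous_onI)
  have sets[measurable_cong]: "sets (\<nu> x) = sets borel" "sets (\<mu> x) = sets borel" "sets (\<rho> x) = sets borel"
    by (simp_all add: \<nu> \<mu> \<rho> sets_K)
  have "emeasure (density (K x) (\<lambda>y. ennreal (k y))) {0} = 0" if [measurable]: "k \<in> borel_measurable (K x)" for k
    using LK absolutely_continuousI_density[of "\<lambda>y. ennreal (k y)" "K x"]
    by (auto simp: levy_measure_def absolutely_continuous_def null_sets_def)
  then have zero: "emeasure (\<mu> x) {0} = 0" "emeasure (\<rho> x) {0} = 0" by (simp_all add: \<mu> \<rho>)
  have "(\<integral>\<^sup>+y. ennreal (min 1 ((norm y)\<^sup>2)) \<partial>\<mu> x) \<le> (\<integral>\<^sup>+y. ennreal (min 1 (norm y)) \<partial>\<mu> x)"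
  proof (intro nn_integral_mono ennreal_leI)
    fix y :: "real^'d"
    show "min 1 ((norm y)\<^sup>2) \<le> min 1 (norm y)"
      using mult_left_le[of "norm y" "norm y"] by (cases "norm y \<le> 1") (auto simp: min_def power2_eq_square)
  qed
  with fin\<mu> have L\<mu>: "levy_measure (\<mu> x)"
    unfolding levy_measure_def using sets zero by (auto elim: le_less_trans)
  have "(\<integral>\<^sup>+y. ennreal (min 1 ((norm y)\<^sup>2)) \<partial>\<rho> x) \<le> (\<integral>\<^sup>+y. ennreal (min (norm y) ((norm y)\<^sup>2)) \<partial>\<rho> x)"
  proof (intro nn_integral_mono ennreal_leI)
    fix y :: "real^'d"
    show "min 1 ((norm y)\<^sup>2) \<le> min (norm y) ((norm y)\<^sup>2)"
      using mult_left_le[of "norm y" "norm y"] by (cases "norm y \<le> 1") (auto simp: min_def power2_eq_square)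
  qed
  with fin\<rho> have L\<rho>: "levy_measure (\<rho> x)"
    unfolding levy_measure_def using sets zero by (auto elim: le_less_trans)

  have "AE y in K x. h1 y + h2 y + h3 y = 1"
    by (rule density_decomposition_AE[OF levy_measure_sigma_finite[OF LK] h nn])
       (use split in \<open>simp add: \<nu> \<mu> \<rho> sets_K\<close>)
  note J = integral_density_decomposition[OF this h nn int, folded \<nu> \<mu> \<rho>]

  have space\<nu>: "space (\<nu> x) = UNIV" using sets_eq_imp_space_eq[OF sets(1)] by simp
  interpret \<nu>: finite_measure "\<nu> x" by standard (use fin\<nu> space\<nu> in simp)
  have lt\<nu>: "integrable (\<nu> x) (\<lambda>y. indicator ?lt y *\<^sub>R y)"
    by (rule integrable_cutoff[OF sets(1), where w="\<lambda>_. 1"]) (use fin\<nu> space\<nu> in auto)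
  have lt\<mu>: "integrable (\<mu> x) (\<lambda>y. indicator ?lt y *\<^sub>R y)"
    by (rule integrable_cutoff[OF sets(2) _ _ fin\<mu>]) auto
  have ge\<rho>: "integrable (\<rho> x) (\<lambda>y. indicator ?ge y *\<^sub>R y)"
  proof (rule integrable_cutoff[OF sets(3) _ _ fin\<rho>])
    show "norm y \<le> min (norm y) ((norm y)\<^sup>2)" if "y \<in> ?ge" for y :: "real^'d"
      using that mult_left_mono[of 1 "norm y" "norm y"] by (simp add: power2_eq_square)
  qed measurable

  from test_functions_bounded[OF f] obtain C where C: "\<And>x. \<bar>f x\<bar> \<le> C" by metis
  have [measurable]: "f \<in> borel_measurable borel" by (rule test_functions_measurable[OF f])
  have f\<nu>: "integrable (\<nu> x) (\<lambda>y. f (x + y))"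
    by (rule \<nu>.integrable_const_bound[where B=C]) (use C in auto)
  have "(LINT y|\<nu> x. ?J y) = (LINT y|\<nu> x. f (x + y) - f x - grad f x \<bullet> (indicator ?lt y *\<^sub>R y))"
    by (intro Bochner_Integration.integral_cong) (auto simp: jump_integrand_def indicator_def)
  also have "\<dots> = (LINT y|\<nu> x. f (x + y)) - f x * measure (\<nu> x) UNIV - grad f x \<bullet> (LINT y:?lt|\<nu> x. y)"
    unfolding set_lebesgue_integral_def
    by (subst Bochner_Integration.integral_diff[OF _ integrable_inner_right[OF lt\<nu>]])
       (use f\<nu> in \<open>simp_all add: space\<nu> mult.commute integral_inner_right[OF lt\<nu>] del: inner_scaleR_right\<close>)
  finally have 1: "(LINT y|\<nu> x. ?J y) = \<dots>" .

  have J\<mu>: "?J y = (f (x + y) - f x) - grad f x \<bullet> (indicator ?lt y *\<^sub>R y)" for y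
    by (auto simp: jump_integrand_def indicator_def)
  \<comment> \<open>Integrability of the increment is inherited: the compensated integrand is
    integrable for \<open>\<mu> x\<close> as part of \<open>K x\<close>, and the truncated linear
    term is integrable by itself. The same device serves \<open>\<rho>\<close> below, with the outer
    linear term.\<close>
  have "integrable (\<mu> x) (\<lambda>y. ?J y + grad f x \<bullet> (indicator ?lt y *\<^sub>R y))"
    by (intro Bochner_Integration.integrable_add J(2) integrable_inner_right lt\<mu>)
  then have f\<mu>: "integrable (\<mu> x) (\<lambda>y. f (x + y) - f x)" by (simp add: J\<mu>)
  have "(LINT y|\<mu> x. ?J y) = (LINT y|\<mu> x. f (x + y) - f x) - grad f x \<bullet> (LINT y:?lt|\<mu> x. y)"
    unfolding J\<mu> set_lebesgue_integral_def
    by (subst Bochner_Integration.integral_diff[OF f\<mu> integrable_inner_right[OF lt\<mu>]])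
       (simp add: integral_inner_right[OF lt\<mu>] del: inner_scaleR_right)
  then have 2: "(LINT y|\<mu> x. ?J y) =
      (\<Sum>i\<in>UNIV. LINT y|integrated_tail (\<mu> x). partial i f (x + y) * (y $ i / norm y)) - grad f x \<bullet> (LINT y:?lt|\<mu> x. y)"
    by (simp only: sum_integral_integrated_tail[OF L\<mu> fin\<mu> f])

  have J\<rho>: "?J y = (f (x + y) - f x - grad f x \<bullet> y) + grad f x \<bullet> (indicator ?ge y *\<^sub>R y)" for y
    by (auto simp: jump_integrand_def indicator_def)
  have "integrable (\<rho> x) (\<lambda>y. ?J y - grad f x \<bullet> (indicator ?ge y *\<^sub>R y))"
    by (intro Bochner_Integration.integrable_diff J(3) integrable_inner_right ge\<rho>)
  then have f\<rho>: "integrable (\<rho> x) (\<lambda>y. f (x + y) - f x - grad f x \<bullet> y)" by (simp add: J\<rho>)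
  have "(LINT y|\<rho> x. ?J y) = (LINT y|\<rho> x. f (x + y) - f x - grad f x \<bullet> y) + grad f x \<bullet> (LINT y:?ge|\<rho> x. y)"
    unfolding J\<rho> set_lebesgue_integral_def
    by (subst Bochner_Integration.integral_add[OF f\<rho> integrable_inner_right[OF ge\<rho>]])
       (simp add: integral_inner_right[OF ge\<rho>] del: inner_scaleR_right)
  then have 3: "(LINT y|\<rho> x. ?J y) =
      (\<Sum>i\<in>UNIV. \<Sum>j\<in>UNIV. LINT y|double_integrated_tail (\<rho> x).
         partial j (partial i f) (x + y) * (y $ i * y $ j / (norm y)\<^sup>2)) + grad f x \<bullet> (LINT y:?ge|\<rho> x. y)"
    by (simp only: sum_integral_double_integrated_tail[OF L\<rho> fin\<rho> f])
  show ?thesis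
    unfolding J(4) 1 2 3 drift_correction_def
    by (simp add: inner_commute[of _ "grad f x"] inner_add_right inner_diff_right)
qed

text \<open>The term with \<open>jump_V\<close> carries a minus sign, opposite to the informal
  equation: one distributional derivative contributes one sign, so with \<open>jump_V\<close>
  defined by a positive integral the increment of \<open>f\<close> is represented by minus the
  divergence. The two signs in \<open>dist_hess\<close> cancel.\<close>

theorem theorem4p2:
  fixes E D :: "(real^'d::finite \<Rightarrow> real) set"
    and N :: "(real^'d \<Rightarrow> real) \<Rightarrow> real"
    and A :: "(real^'d \<Rightarrow> real) \<Rightarrow> (real^'d \<Rightarrow> real)"
    and a :: "real^'d \<Rightarrow> real^'d"
    and b :: "real^'d \<Rightarrow> real^'d^'d"
    and K \<nu> \<mu> \<rho> :: "real^'d \<Rightarrow> (real^'d) measure"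
    and \<eta> :: "(real^'d) measure"
  assumes "levy_type_operator E N D A a b K"
    and "test_functions \<subseteq> D"
    and "convenient_decomposition K \<nu> \<mu> \<rho>"
    and "\<eta> \<in> admissible_measures a b \<nu> \<mu> \<rho>"
  shows "infinitesimally_invariant A \<eta> \<longleftrightarrow>
    (\<forall>f\<in>test_functions.
       - pairing (dist_div (weighted (\<lambda>x. a x + drift_correction \<nu> \<mu> \<rho> x) \<eta>)) f
       + pairing (diffusion_functional b \<eta>) f
       + pairing (jump_U \<nu> \<eta>) f
       - pairing (dist_div (jump_V \<mu> \<eta>)) f
       + pairing (dist_hess (jump_W \<rho> \<eta>)) f = 0)"
proof -
  let ?c = "\<lambda>x. a x + drift_correction \<nu> \<mu> \<rho> x"
  \<comment> \<open>Stronger than the equivalence: for every test function \<open>A f\<close> is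
    integrable and its integral is the left-hand side of the equation, so both conditions say that
    the same numbers vanish.\<close>
  have "integrable \<eta> (A f) \<and> (LINT x|\<eta>. A f x) =
       - pairing (dist_div (weighted ?c \<eta>)) f + pairing (diffusion_functional b \<eta>) f
       + pairing (jump_U \<nu> \<eta>) f - pairing (dist_div (jump_V \<mu> \<eta>)) f + pairing (dist_hess (jump_W \<rho> \<eta>)) f"
    if f: "f \<in> test_functions" for f
  proof -
    \<comment> \<open>Being a distribution includes having a value at every test function. For these
      functionals a value other than \<open>None\<close> certifies integrability in
      \<open>\<eta>\<close> of each single integrand, component by component.\<close>
    have defined: "T f \<noteq> None" if "is_distribution T" for T
      using that f by (auto simp: is_distribution_def)
    have d1: "dist_div (weighted ?c \<eta>) f \<noteq> None" and d2: "diffusion_functional b \<eta> f \<noteq> None"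
      and d3: "jump_U \<nu> \<eta> f \<noteq> None" and d4: "dist_div (jump_V \<mu> \<eta>) f \<noteq> None"
      and d5: "dist_hess (jump_W \<rho> \<eta>) f \<noteq> None"
      using assms(4) by (auto simp only: admissible_measures_def mem_Collect_eq intro!: defined)
    define g1 where "g1 i x = partial i f x * ?c x $ i" for i x
    define g2 where "g2 x = 1 / 2 * div_grad b f x" for x
    define g3 where "g3 x = (LINT y|\<nu> x. f (x + y)) - f x * measure (\<nu> x) UNIV" for x
    define g4 where "g4 i x = (LINT y|integrated_tail (\<mu> x). partial i f (x + y) * (y $ i / norm y))" for i x
    define g5 where "g5 i j x = (LINT y|double_integrated_tail (\<rho> x).
         partial j (partial i f) (x + y) * (y $ i * y $ j / (norm y)\<^sup>2))" for i j x
    note n1 = partial_integral_not_NoneD[OF dist_div_not_NoneD(1)[OF d1, unfolded weighted_def], folded g1_def]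
    note n2 = partial_integral_not_NoneD[OF d2[unfolded diffusion_functional_def], folded g2_def]
    note n3 = partial_integral_not_NoneD[OF d3[unfolded jump_U_def], folded g3_def]
    note n4 = partial_integral_not_NoneD[OF dist_div_not_NoneD(1)[OF d4, unfolded jump_V_def], folded g4_def]
    note n5 = partial_integral_not_NoneD[OF dist_hess_not_NoneD(1)[OF d5, unfolded jump_W_def], folded g5_def]
    have p1: "pairing (dist_div (weighted ?c \<eta>)) f = - (\<Sum>i\<in>UNIV. LINT x|\<eta>. g1 i x)"
      unfolding dist_div_not_NoneD(2)[OF d1] weighted_def n1(2)[unfolded g1_def] g1_def by (rule refl)
    have p2: "pairing (diffusion_functional b \<eta>) f = (LINT x|\<eta>. g2 x)"
      unfolding pairing_def diffusion_functional_def g2_def by (rule n2(2)[unfolded g2_def])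
    have p3: "pairing (jump_U \<nu> \<eta>) f = (LINT x|\<eta>. g3 x)"
      unfolding pairing_def jump_U_def g3_def by (rule n3(2)[unfolded g3_def])
    have p4: "pairing (dist_div (jump_V \<mu> \<eta>)) f = - (\<Sum>i\<in>UNIV. LINT x|\<eta>. g4 i x)"
      unfolding dist_div_not_NoneD(2)[OF d4] jump_V_def n4(2)[unfolded g4_def] g4_def by (rule refl)
    have p5: "pairing (dist_hess (jump_W \<rho> \<eta>)) f = (\<Sum>i\<in>UNIV. \<Sum>j\<in>UNIV. LINT x|\<eta>. g5 i j x)"
      unfolding dist_hess_not_NoneD(2)[OF d5] jump_W_def n5(2)[unfolded g5_def] g5_def by (rule refl)
    \<comment> \<open>The identity holds at every \<open>x\<close>, not just
      \<open>\<eta>\<close>-almost everywhere. The drift correction from the jump integral merges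
      with \<open>a\<close> in \<open>g1\<close>.\<close>
    have A: "A f = (\<lambda>x. (\<Sum>i\<in>UNIV. g1 i x) + g2 x + g3 x + (\<Sum>i\<in>UNIV. g4 i x) + (\<Sum>i\<in>UNIV. \<Sum>j\<in>UNIV. g5 i j x))"
    proof
      fix x
      from assms(1,2) f have K: "levy_kernel K" and int: "integrable (K x) (jump_integrand f x)"
        and Af: "A f x = a x \<bullet> grad f x + 1 / 2 * div_grad b f x + (LINT y|K x. jump_integrand f x y)"
        by (auto simp: levy_type_operator_def characteristic_triplet_def)
      have "(\<Sum>i\<in>UNIV. g1 i x) = a x \<bullet> grad f x + drift_correction \<nu> \<mu> \<rho> x \<bullet> grad f x"
        by (simp add: g1_def inner_vec_def grad_def sum.distrib[symmetric] algebra_simps)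
      then show "A f x = (\<Sum>i\<in>UNIV. g1 i x) + g2 x + g3 x + (\<Sum>i\<in>UNIV. g4 i x) + (\<Sum>i\<in>UNIV. \<Sum>j\<in>UNIV. g5 i j x)"
        unfolding Af convenient_decomposition_jump_integral[OF K assms(3) f int] g2_def g3_def g4_def g5_def
        by simp
    qed
    show ?thesis
      unfolding A p1 p2 p3 p4 p5 using n1(1) n2(1) n3(1) n4(1) n5(1)
      by (simp add: Bochner_Integration.integral_sum)
  qed
  then show ?thesis unfolding infinitesimally_invariant_def by auto
qed

end
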